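(* Let $I$ be an open subinterval of $\mathbb{R}$, $U$ an open subset of $\mathbb{R}^n$, $P$ an open subset of $\mathbb{R}^l$, $\tilde t_0$ a near-standard point in $\tilde I_c$ with $\tilde t_0\approx t_0\in I$, $\tilde x_0$ a near-standard point in $\tilde U_c$ with $\tilde x_0\approx x_0\in U$ and $F\in\mathcal{G}(I\times U\times P)^n$. With $\alpha>0$ and $\beta>0$ satisfying $[t_0-\alpha,t_0+\alpha]\subset\subset I$ and $\overline{B_\beta(x_0)}\subset\subset U$, respectively, set $$Q:=[t_0-\alpha,t_0+\alpha]\times\overline{B_\beta(x_0)}\qquad(\subset\subset I\times U).$$ Assume that $F$ has a representative $(F_\varepsilon)_\varepsilon$ satisfying $$\sup_{(t,x,p)\in Q\times P}|F_\varepsilon(t,x,p)|\le a\qquad(\varepsilon\le\varepsilon_0)$$ for some constant $a>0$ and $\varepsilon_0\in(0,1]$ and that for all compact subsets $K$ of $P$ $$\sup_{(t,x,p)\in Q\times K}|\partial_2F_\varepsilon(t,x,p)|=O(|\log\varepsilon|).$$ Then the following holds: For fixed $h\in\left(0,\min\big(\alpha,\frac{\beta}{a}\big)\right)$ there exist open neighbourhoods $J_1$ of $t_0$ in $J:=(t_0-h,t_0+h)$ and $U_1$ of $x_0$ in $U$ and a generalized function $u\in\mathcal{G}[J_1\times U_1\times P\times J,B_\gamma(x_0)]$ with $\gamma\in(0,\beta)$ and $\beta-\gamma>0$ sufficiently small, such that for all $(\tilde t_1,\tilde x_1,\tilde p)\in\tilde J_{1c}\times\tilde U_{1c}\times\tilde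 P_c$ the map $u(\tilde t_1,\tilde x_1,\tilde p,\,.\,)\in\mathcal{G}[J,B_\gamma(x_0)]$ is a solution of the initial value problem $$\dot u(t)=F(t,u(t),\tilde p),\quad u(\tilde t_1)=\tilde x_1.$$ The solution $u$ is unique in $\mathcal{G}[J_1\times U_1\times P\times J,B_\gamma(x_0)]$.
   Context: Notation. $A\subset\subset B$ means that $A$ is a compact subset of the interior of $B$. $B_r(x)$ is the open ball with centre $x$ and radius $r>0$. $\partial_2F_\varepsilon$ is the derivative with respect to the second slot ($x\in U$). All $O$-estimates are understood as $\varepsilon\to0$. Special Colombeau algebra. For a non-empty open $U\subseteq\mathbb{R}^n$ let $\mathcal{E}(U):=C^\infty(U,\mathbb{R})^{(0,1]}$. $\mathcal{E}_M(U)$ (moderate nets) is the set of $(u_\varepsilon)_\varepsilon\in\mathcal{E}(U)$ such that for all $K\subset\subset U$ and all multi-indices $\kappa\in\mathbb{N}_0^n$ there is $N\in\mathbb{N}$ with $\sup_{x\in K}|\partial^\kappa u_\varepsilon(x)|=O(\varepsilon^{-N})$. $\mathcal{N}(U)$ (negligible nets) is the set of $(u_\varepsilon)_\varepsilon\in\mathcal{E}(U)$ such that for all $K\subset\subset U$, $\kappa\in\mathbb{N}_0^n$, $m\in\mathbb{N}$ one has $\sup_{x\in K}|\partial^\kappa u_\varepsilon(x)|=O(\varepsilon^m)$. $\mathcal{G}(U):=\mathcal{E}_M(U)/\mathcal{N}(U)$; the class of $(u_\varepsilon)_\varepsilon$ is $[(u_\varepsilon)_\varepsilon]$. Derivatives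 are taken componentwise in $\varepsilon$. Generalized functions with values in $\mathbb{R}^m$ are elements of $\mathcal{G}(U)^m$. c-boundedness. For open $U\subseteq\mathbb{R}^n$, $V\subseteq\mathbb{R}^m$, a net $(u_\varepsilon)_\varepsilon\in\mathcal{E}_M(U)^m$ is c-bounded from $U$ into $V$ if (a) there is $\varepsilon_0\in(0,1]$ with $u_\varepsilon(U)\subseteq V$ for all $\varepsilon\le\varepsilon_0$, and (b) for every $K\subset\subset U$ there are $L\subset\subset V$ and $\varepsilon_0\in(0,1]$ with $u_\varepsilon(K)\subseteq L$ for all $\varepsilon\le\varepsilon_0$. $\mathcal{G}[U,V]$ is the set of $u\in\mathcal{G}(U)^m$ having a representative that is c-bounded from $U$ into $V$. For $u\in\mathcal{G}[U,V]$ and $v\in\mathcal{G}(V)^l$ the composition $v\circ u:=[(v_\varepsilon\circ u_\varepsilon)_\varepsilon]\in\mathcal{G}(U)^l$ is well defined (with a c-bounded representative $(u_\varepsilon)_\varepsilon$; only small $\varepsilon$ matter). Generalized points. $U_M$ is the set of nets $(x_\varepsilon)_\varepsilon\in U^{(0,1]}$ with $|x_\varepsilon|=O(\varepsilon^{-N})$ for some $N\in\mathbb{N}$; $(x_\varepsilon)_\varepsilon\sim(y_\varepsilon)_\varepsilon$ iff $|x_\varepsilon-y_\varepsilon|=O(\varepsilon^m)$ for all $m\in\mathbb{N}$; $\tilde U:=U_M/\!\sim$. $\tilde U_c$ (compactly supported points) is the set of $\tilde x=[(\tilde x_\varepsilon)_\varepsilon]\in\tilde U$ for which there are $K\subset\subset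 U$ and $\varepsilon_0\in(0,1]$ with $\tilde x_\varepsilon\in K$ for all $\varepsilon\le\varepsilon_0$; $\tilde I_c$, $\tilde P_c$, $\tilde J_{1c}$, $\tilde U_{1c}$ denote the compactly supported points of $I$, $P$, $J_1$, $U_1$. For $u\in\mathcal{G}(U)^m$, $\tilde x\in\tilde U_c$, the point value is $u(\tilde x):=[(u_\varepsilon(\tilde x_\varepsilon))_\varepsilon]$. Inserting compactly supported points into some of the slots is likewise done componentwise, e.g. $u(\tilde t_1,\tilde x_1,\tilde p,\,.\,):=[(u_\varepsilon(\tilde t_{1\varepsilon},\tilde x_{1\varepsilon},\tilde p_\varepsilon,\,.\,))_\varepsilon]$. A point $\tilde x\in\tilde U_c$ is near-standard, written $\tilde x\approx x$, if there is $x\in U$ with $\tilde x_\varepsilon\to x$ as $\varepsilon\to0$ for one (hence every) representative. Solutions. For an open subinterval $J$ of $I$, $\tilde t_1\in\tilde J_c$, $\tilde x_1\in\tilde U_c$ and $G\in\mathcal{G}(I\times U)^n$ (here $G=F(\,.\,,\,.\,,\tilde p)$), a solution of $\dot u(t)=G(t,u(t))$, $u(\tilde t_1)=\tilde x_1$ on $J$ is a $u\in\mathcal{G}[J,U]$ such that the differential equation holds in $\mathcal{G}(J)^n$, where $G(t,u(t))$ is the composition $G\circ(\mathrm{id},u)$, and the initial condition holds as an equality in the set $\tilde U$ of generalized points. *)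

theory Defs
  imports "HOL-Analysis.Analysis" "HOL-Library.Landau_Symbols"
begin

text \<open>
  Nets \<open>(u\<^sub>\<epsilon>)\<close> with index \<open>\<epsilon> \<in> (0,1]\<close> are functions on type \<^typ>\<open>real\<close>; a function on an open
  subset of a Euclidean space is a function on the whole type. No notion below depends on
  the values for indices outside \<open>(0,1]\<close> or for arguments outside the open set.
  Vector-valued functions are treated directly instead of component by component, so that
  \<open>gfuns U\<close> is \<open>\<G>(U)\<^sup>m\<close> when the value type has dimension \<open>m\<close>.
\<close>

definition compactly_in :: "'a::topological_space set \<Rightarrow> 'a set \<Rightarrow> bool" where
  "compactly_in A B \<longleftrightarrow> compact A \<and> A \<subseteq> interior B"

text \<open>
  \<open>sup\<^bsub>x \<in> K\<^esub> |f\<^sub>\<epsilon>(x)| = O(g(\<epsilon>))\<close> as \<open>\<epsilon> \<rightarrow> 0\<close>. The supremum is spelled out as a bound at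
  all points, because \<^const>\<open>Sup\<close> on \<^typ>\<open>real\<close> is unspecified on empty and unbounded sets.
\<close>
definition sup_bigo ::
  "'a set \<Rightarrow> (real \<Rightarrow> 'a \<Rightarrow> 'b::real_normed_vector) \<Rightarrow> (real \<Rightarrow> real) \<Rightarrow> bool" where
  "sup_bigo K f g \<longleftrightarrow> (\<exists>C. \<forall>\<^sub>F \<epsilon> in at_right 0. \<forall>x\<in>K. norm (f \<epsilon> x) \<le> C * g \<epsilon>)"


section \<open>Smooth functions and the special Colombeau algebra\<close>

text \<open>
  Iterated partial derivatives are indexed by finite sequences of coordinate directions
  rather than by multi-indices. On smooth functions the order of the directions is irrelevant,
  so quantifying over all such sequences amounts to quantifying over all multi-indices.
\<close>
primrec pderivs :: "'a list \<Rightarrow> ('a::euclidean_space \<Rightarrow> 'b::real_normed_vector) \<Rightarrow> 'a \<Rightarrow> 'b" where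
  "pderivs [] f = f"
| "pderivs (b # bs) f = (\<lambda>x. frechet_derivative (pderivs bs f) (at x) b)"

text \<open>
  \<open>C\<^sup>\<infinity>\<close> on an open set. Differentiability of all iterated partial derivatives includes
  their continuity.
\<close>
definition smooth_on :: "'a::euclidean_space set \<Rightarrow> ('a \<Rightarrow> 'b::real_normed_vector) \<Rightarrow> bool" where
  "smooth_on U f \<longleftrightarrow> (\<forall>bs. set bs \<subseteq> Basis \<longrightarrow> (\<forall>x\<in>U. pderivs bs f differentiable (at x)))"

definition smooth_nets ::
  "'a::euclidean_space set \<Rightarrow> (real \<Rightarrow> 'a \<Rightarrow> 'b::real_normed_vector) set" where
  "smooth_nets U = {u. \<forall>\<epsilon>\<in>{0<..1}. smooth_on U (u \<epsilon>)}"

definition moderate_nets ::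
  "'a::euclidean_space set \<Rightarrow> (real \<Rightarrow> 'a \<Rightarrow> 'b::real_normed_vector) set" where
  "moderate_nets U = {u \<in> smooth_nets U. \<forall>K bs. compactly_in K U \<longrightarrow> set bs \<subseteq> Basis \<longrightarrow>
     (\<exists>N::nat. sup_bigo K (\<lambda>\<epsilon>. pderivs bs (u \<epsilon>)) (\<lambda>\<epsilon>. 1 / \<epsilon> ^ N))}"

definition negligible_estimates ::
  "'a::euclidean_space set \<Rightarrow> (real \<Rightarrow> 'a \<Rightarrow> 'b::real_normed_vector) \<Rightarrow> bool" where
  "negligible_estimates U u \<longleftrightarrow> (\<forall>K bs. \<forall>m::nat. compactly_in K U \<longrightarrow> set bs \<subseteq> Basis \<longrightarrow>
     sup_bigo K (\<lambda>\<epsilon>. pderivs bs (u \<epsilon>)) (\<lambda>\<epsilon>. \<epsilon> ^ m))"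

definition negligible_nets ::
  "'a::euclidean_space set \<Rightarrow> (real \<Rightarrow> 'a \<Rightarrow> 'b::real_normed_vector) set" where
  "negligible_nets U = {u \<in> smooth_nets U. negligible_estimates U u}"

definition gf_rel ::
  "'a::euclidean_space set \<Rightarrow>
   ((real \<Rightarrow> 'a \<Rightarrow> 'b::real_normed_vector) \<times> (real \<Rightarrow> 'a \<Rightarrow> 'b)) set" where
  "gf_rel U = {(u, v). u \<in> moderate_nets U \<and> v \<in> moderate_nets U \<and>
     (\<lambda>\<epsilon> x. v \<epsilon> x - u \<epsilon> x) \<in> negligible_nets U}"

definition gfuns ::
  "'a::euclidean_space set \<Rightarrow> (real \<Rightarrow> 'a \<Rightarrow> 'b::real_normed_vector) set set" where
  "gfuns U = moderate_nets U // gf_rel U"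

text \<open>
  The class \<open>[(f\<^sub>\<epsilon>)]\<close>. For moderate \<open>f\<close> this is the equivalence class of \<open>f\<close>, see
  \<open>gf_class_eq_Image\<close> below. It also makes sense if \<open>f\<^sub>\<epsilon>\<close> is smooth on \<open>U\<close> for small \<open>\<epsilon>\<close> only,
  as happens for compositions: it then consists of the moderate nets which
  differ from \<open>f\<close> by a negligible amount for small \<open>\<epsilon>\<close>.
\<close>
definition gf_class ::
  "'a::euclidean_space set \<Rightarrow> (real \<Rightarrow> 'a \<Rightarrow> 'b::real_normed_vector) \<Rightarrow>
   (real \<Rightarrow> 'a \<Rightarrow> 'b) set" where
  "gf_class U f = {w \<in> moderate_nets U. negligible_estimates U (\<lambda>\<epsilon> x. w \<epsilon> x - f \<epsilon> x)}"

lemma pderivs_diff: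
  assumes "open U" "smooth_on U f" "smooth_on U g" "set bs \<subseteq> Basis"
  shows "x \<in> U \<Longrightarrow> pderivs bs (\<lambda>x. f x - g x) x = pderivs bs f x - pderivs bs g x"
  using assms(4)
proof (induction bs arbitrary: x)
  case Nil
  then show ?case by simp
next
  case (Cons b bs)
  have f: "pderivs bs f differentiable (at x)" and g: "pderivs bs g differentiable (at x)"
    using assms(2,3) Cons.prems by (auto simp: smooth_on_def)
  have "((\<lambda>y. pderivs bs f y - pderivs bs g y) has_derivative
      (\<lambda>h. frechet_derivative (pderivs bs f) (at x) h -
           frechet_derivative (pderivs bs g) (at x) h)) (at x)"
    using f g by (intro has_derivative_diff) (auto simp: frechet_derivative_works)
  then have "(pderivs bs (\<lambda>x. f x - g x) has_derivative
      (\<lambda>h. frechet_derivative (pderivs bs f) (at x) h -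
           frechet_derivative (pderivs bs g) (at x) h)) (at x)"
    by (rule has_derivative_transform_within_open[OF _ assms(1) Cons.prems(1)])
      (use Cons in auto)
  from frechet_derivative_at[OF this, symmetric] show ?case by simp
qed

lemma smooth_on_diff:
  assumes "open U" "smooth_on U f" "smooth_on U g"
  shows "smooth_on U (\<lambda>x. f x - g x)"
  unfolding smooth_on_def
proof (intro allI impI ballI)
  fix bs :: "'a list" and x assume bs: "set bs \<subseteq> Basis" and x: "x \<in> U"
  have "((\<lambda>y. pderivs bs f y - pderivs bs g y) has_derivative
      (\<lambda>h. frechet_derivative (pderivs bs f) (at x) h -
           frechet_derivative (pderivs bs g) (at x) h)) (at x)"
    using assms(2,3) bs x
    by (intro has_derivative_diff) (auto simp: smooth_on_def frechet_derivative_works)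
  then have "(pderivs bs (\<lambda>x. f x - g x) has_derivative
      (\<lambda>h. frechet_derivative (pderivs bs f) (at x) h -
           frechet_derivative (pderivs bs g) (at x) h)) (at x)"
    by (rule has_derivative_transform_within_open[OF _ assms(1) x])
      (use pderivs_diff[OF assms bs] in auto)
  then show "pderivs bs (\<lambda>x. f x - g x) differentiable (at x)"
    by (auto simp: differentiable_def)
qed

lemma gf_class_eq_Image:
  assumes "open U" "f \<in> moderate_nets U"
  shows "gf_class U f = gf_rel U `` {f}"
  using assms
  by (auto simp: gf_class_def gf_rel_def negligible_nets_def smooth_nets_def moderate_nets_def
      intro!: smooth_on_diff)

definition c_bounded ::
  "'a::euclidean_space set \<Rightarrow> 'b::real_normed_vector set \<Rightarrow> (real \<Rightarrow> 'a \<Rightarrow> 'b) \<Rightarrow> bool" where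
  "c_bounded U V u \<longleftrightarrow> u \<in> moderate_nets U \<and>
     (\<exists>\<epsilon>0\<in>{0<..1}. \<forall>\<epsilon>\<in>{0<..\<epsilon>0}. u \<epsilon> ` U \<subseteq> V) \<and>
     (\<forall>K. compactly_in K U \<longrightarrow>
        (\<exists>L. compactly_in L V \<and> (\<exists>\<epsilon>0\<in>{0<..1}. \<forall>\<epsilon>\<in>{0<..\<epsilon>0}. u \<epsilon> ` K \<subseteq> L)))"

text \<open>\<open>\<G>[U,V]\<close>\<close>
definition gfuns_into ::
  "'a::euclidean_space set \<Rightarrow> 'b::real_normed_vector set \<Rightarrow> (real \<Rightarrow> 'a \<Rightarrow> 'b) set set" where
  "gfuns_into U V = {u \<in> gfuns U. \<exists>w\<in>u. c_bounded U V w}"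

text \<open>
  Operations on classes are unions over representatives; since the operations are well
  defined, all members of such a union coincide.
\<close>

definition gf_comp ::
  "'a::euclidean_space set \<Rightarrow> 'b::real_normed_vector set \<Rightarrow>
   (real \<Rightarrow> 'b \<Rightarrow> 'c::real_normed_vector) set \<Rightarrow> (real \<Rightarrow> 'a \<Rightarrow> 'b) set \<Rightarrow>
   (real \<Rightarrow> 'a \<Rightarrow> 'c) set" where
  "gf_comp U V v u =
     (\<Union>v'\<in>v. \<Union>u'\<in>{u' \<in> u. c_bounded U V u'}. gf_class U (\<lambda>\<epsilon> x. v' \<epsilon> (u' \<epsilon> x)))"

text \<open>\<open>(id, u)\<close>\<close>
definition gf_id_pair ::
  "'a::euclidean_space set \<Rightarrow> (real \<Rightarrow> 'a \<Rightarrow> 'b::real_normed_vector) set \<Rightarrow>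
   (real \<Rightarrow> 'a \<Rightarrow> 'a \<times> 'b) set" where
  "gf_id_pair U u = (\<Union>u'\<in>u. gf_class U (\<lambda>\<epsilon> x. (x, u' \<epsilon> x)))"

definition gf_deriv ::
  "real set \<Rightarrow> (real \<Rightarrow> real \<Rightarrow> 'b::real_normed_vector) set \<Rightarrow> (real \<Rightarrow> real \<Rightarrow> 'b) set" where
  "gf_deriv J u = (\<Union>u'\<in>u. gf_class J (\<lambda>\<epsilon> t. vector_derivative (u' \<epsilon>) (at t)))"


section \<open>Generalized points\<close>

definition point_nets :: "'a::real_normed_vector set \<Rightarrow> (real \<Rightarrow> 'a) set" where
  "point_nets U = {x. (\<forall>\<epsilon>\<in>{0<..1}. x \<epsilon> \<in> U) \<and>
     (\<exists>N::nat. (\<lambda>\<epsilon>. norm (x \<epsilon>)) \<in> O[at_right 0](\<lambda>\<epsilon>. 1 / \<epsilon> ^ N))}"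

definition point_equiv :: "(real \<Rightarrow> 'a::real_normed_vector) \<Rightarrow> (real \<Rightarrow> 'a) \<Rightarrow> bool" where
  "point_equiv x y \<longleftrightarrow> (\<forall>m::nat. (\<lambda>\<epsilon>. norm (x \<epsilon> - y \<epsilon>)) \<in> O[at_right 0](\<lambda>\<epsilon>. \<epsilon> ^ m))"

definition gpoints :: "'a::real_normed_vector set \<Rightarrow> (real \<Rightarrow> 'a) set set" where
  "gpoints U = point_nets U // {(x, y). x \<in> point_nets U \<and> y \<in> point_nets U \<and> point_equiv x y}"

text \<open>\<open>U\<^sub>c\<close>, the compactly supported generalized points of \<open>U\<close>\<close>
definition gpoints_c :: "'a::real_normed_vector set \<Rightarrow> (real \<Rightarrow> 'a) set set" where
  "gpoints_c U = {X \<in> gpoints U. \<exists>x\<in>X. \<exists>K. compactly_in K U \<and>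
     (\<exists>\<epsilon>0\<in>{0<..1}. \<forall>\<epsilon>\<in>{0<..\<epsilon>0}. x \<epsilon> \<in> K)}"

definition near_standard :: "'a::real_normed_vector set \<Rightarrow> (real \<Rightarrow> 'a) set \<Rightarrow> 'a \<Rightarrow> bool" where
  "near_standard U X a \<longleftrightarrow> X \<in> gpoints_c U \<and> a \<in> U \<and> (\<exists>x\<in>X. (x \<longlongrightarrow> a) (at_right 0))"

text \<open>
  The class in \<open>gpoints U\<close> of a net \<open>y\<close> which need only be \<open>U\<close>-valued for small \<open>\<epsilon>\<close>.
\<close>
definition point_class :: "'a::real_normed_vector set \<Rightarrow> (real \<Rightarrow> 'a) \<Rightarrow> (real \<Rightarrow> 'a) set" where
  "point_class U y = {z \<in> point_nets U. point_equiv z y}"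

text \<open>
  For \<open>V \<subseteq> U\<close>, the canonical map from \<open>gpoints V\<close> to \<open>gpoints U\<close>. It is needed because a
  class in \<open>gpoints V\<close> contains \<open>V\<close>-valued nets only.
\<close>
definition point_embed :: "'a::real_normed_vector set \<Rightarrow> (real \<Rightarrow> 'a) set \<Rightarrow> (real \<Rightarrow> 'a) set" where
  "point_embed U X = (\<Union>x\<in>X. point_class U x)"

text \<open>The point value \<open>u(X)\<close>, as a generalized point of \<open>V\<close>, for \<open>u\<close> with values in \<open>V\<close>.\<close>
definition point_value ::
  "'b::real_normed_vector set \<Rightarrow> (real \<Rightarrow> 'a \<Rightarrow> 'b) set \<Rightarrow> (real \<Rightarrow> 'a) set \<Rightarrow> (real \<Rightarrow> 'b) set" where
  "point_value V u X = (\<Union>u'\<in>u. \<Union>x\<in>X. point_class V (\<lambda>\<epsilon>. u' \<epsilon> (x \<epsilon>)))"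

text \<open>\<open>F(\<cdot>,\<cdot>,p)\<close> on \<open>I \<times> U\<close>\<close>
definition insert_param ::
  "('t::euclidean_space \<times> 'a::euclidean_space) set \<Rightarrow>
   (real \<Rightarrow> 't \<times> 'a \<times> 'p \<Rightarrow> 'b::real_normed_vector) set \<Rightarrow> (real \<Rightarrow> 'p) set \<Rightarrow>
   (real \<Rightarrow> 't \<times> 'a \<Rightarrow> 'b) set" where
  "insert_param S F p = (\<Union>F'\<in>F. \<Union>p'\<in>p. gf_class S (\<lambda>\<epsilon> (t, x). F' \<epsilon> (t, x, p' \<epsilon>)))"

text \<open>\<open>u(t1,x1,p,\<cdot>)\<close> on \<open>J\<close>\<close>
definition insert_data ::
  "real set \<Rightarrow> (real \<Rightarrow> real \<times> 'a \<times> 'p \<times> real \<Rightarrow> 'b::real_normed_vector) set \<Rightarrow>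
   (real \<Rightarrow> real) set \<Rightarrow> (real \<Rightarrow> 'a) set \<Rightarrow> (real \<Rightarrow> 'p) set \<Rightarrow> (real \<Rightarrow> real \<Rightarrow> 'b) set" where
  "insert_data J u t1 x1 p = (\<Union>u'\<in>u. \<Union>t'\<in>t1. \<Union>x'\<in>x1. \<Union>p'\<in>p.
     gf_class J (\<lambda>\<epsilon> t. u' \<epsilon> (t' \<epsilon>, x' \<epsilon>, p' \<epsilon>, t)))"

text \<open>
  \<open>u\<close> is a solution on \<open>J \<subseteq> I\<close> of \<open>u'(t) = G(t,u(t))\<close>, \<open>u(t1) = x1\<close>, where \<open>G \<in> \<G>(I \<times> U)\<close>,
  \<open>t1 \<in> gpoints_c J\<close> and \<open>x1 \<in> gpoints_c U\<close>.
\<close>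
definition ivp_solution ::
  "real set \<Rightarrow> 'a::euclidean_space set \<Rightarrow> real set \<Rightarrow> (real \<Rightarrow> real \<times> 'a \<Rightarrow> 'a) set \<Rightarrow>
   (real \<Rightarrow> real) set \<Rightarrow> (real \<Rightarrow> 'a) set \<Rightarrow> (real \<Rightarrow> real \<Rightarrow> 'a) set \<Rightarrow> bool" where
  "ivp_solution I U J G t1 x1 u \<longleftrightarrow>
     u \<in> gfuns_into J U \<and>
     gf_deriv J u = gf_comp J (I \<times> U) G (gf_id_pair J u) \<and>
     point_value U u t1 = x1"

end

theory Submission
  imports Defs
begin

text \<open>
  For a fixed small \<open>\<epsilon>\<close> the equation is a classical one. A solution which starts within \<open>d\<close> of
  \<open>(t0, x0)\<close> has speed at most \<open>a\<close> and exists for a time span of at most \<open>h + d\<close>, hence it stays in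
  a ball of radius \<open>r < \<beta>\<close> around \<open>x0\<close> if \<open>d + a (h + d) \<le> r\<close>; this is possible because \<open>a h < \<beta>\<close>.
  The classical solutions form the net which represents \<open>u\<close>, and everything else is a matter of
  estimates in \<open>\<epsilon>\<close>.

  All these estimates come from Gronwall's inequality. For \<open>p\<close> in a compact set, the Lipschitz constant
  of \<open>F\<^sub>\<epsilon>\<close> in \<open>x\<close> is \<open>O(|log \<epsilon>|)\<close>, so that the growth factor is \<open>e\<^bsup>C |log \<epsilon>|\<^esup> = \<epsilon>\<^bsup>-C\<^esup>\<close>, which is moderate
  (\<open>moderate_bound_exp_log\<close>). Derivatives of the solution with respect to initial data and
  parameters solve linear equations whose coefficient is \<open>\<partial>\<^sub>2F\<^sub>\<epsilon>\<close> along the solution, up to a bounded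
  factor which comes from the substitution below; derivatives of higher order change the inhomogeneity,
  but never this coefficient. By induction on the order, all of
  them exist and are moderate (\<open>ode_differentiable_dependence\<close>, \<open>linear_ode_moderate_Ck\<close>,
  \<open>ode_moderate_Ck\<close>).

  Two devices keep the induction simple. Writing \<open>v(s) = u(t1, x1, p, t1 + s (t - t1))\<close> turns the
  problem into \<open>v' = (t - t1) F\<^sub>\<epsilon>(t1 + s (t - t1), v, p)\<close>, \<open>v(0) = x1\<close> on \<open>[0, 1]\<close>, so that
  initial time, initial value, parameter and final time are parameters alike, and no derivative in
  the time \<open>s\<close> is ever needed. And \<open>moderate_Ck\<close> expresses differentiability and moderate bounds
  of a net by a single recursive predicate, so that sums, products and compositions need to be treated only
  once.

  On the Colombeau side, a moderate net is negligible as soon as it is negligible in order zero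
  (\<open>null_on_compacts_imp_negligible\<close>), and moderate nets are Lipschitz on compact sets with moderate
  constants (\<open>eventually_moderate_lipschitz\<close>). Hence the operations on classes can be computed on
  arbitrary representatives, and being a solution means solving the problem up to negligible errors
  (\<open>ivp_solution_iff\<close>).

  For uniqueness, let the points \<open>z\<^sub>\<epsilon>\<close> maximize the distance of two representatives over a compact
  set. They define compactly supported generalized points, for which both functions are solutions, and
  Gronwall's inequality for nets (\<open>null_net_solution_difference\<close>) shows that the two representatives
  differ at \<open>z\<^sub>\<epsilon>\<close>, and hence on the whole compact set, by a negligible amount.
\<close>

section \<open>Moderate and negligible bounds\<close>

text \<open>
  The estimates \<open>O(\<epsilon>\<^bsup>-N\<^esup>)\<close> for some \<open>N\<close>, and \<open>O(\<epsilon>\<^sup>m)\<close> for all \<open>m\<close>, without constants: a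
  constant is absorbed by one more power of \<open>\<epsilon>\<close>.
\<close>
definition moderate_bound :: "'a set \<Rightarrow> (real \<Rightarrow> 'a \<Rightarrow> 'b::real_normed_vector) \<Rightarrow> bool" where
  "moderate_bound K f \<longleftrightarrow>
     (\<exists>N::nat. \<forall>\<^sub>F \<epsilon> in at_right 0. \<forall>x\<in>K. norm (f \<epsilon> x) \<le> (1 / \<epsilon>) ^ N)"

definition null_bound :: "'a set \<Rightarrow> (real \<Rightarrow> 'a \<Rightarrow> 'b::real_normed_vector) \<Rightarrow> bool" where
  "null_bound K f \<longleftrightarrow> (\<forall>m::nat. \<forall>\<^sub>F \<epsilon> in at_right 0. \<forall>x\<in>K. norm (f \<epsilon> x) \<le> \<epsilon> ^ m)"

lemma eventually_at_right_small:
  assumes "0 < (c::real)"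
  shows "\<forall>\<^sub>F \<epsilon> in at_right 0. 0 < \<epsilon> \<and> \<epsilon> \<le> c"
  using eventually_at_right_real[OF assms] by eventually_elim auto

text \<open>
  The right-hand side is the way in which \<open>c\<close>-boundedness and compact support of points refer to small
  \<open>\<epsilon>\<close>.
\<close>
lemma eventually_at_right_iff_le:
  "(\<forall>\<^sub>F \<epsilon> in at_right (0::real). P \<epsilon>) \<longleftrightarrow> (\<exists>e\<in>{0<..1}. \<forall>\<epsilon>\<in>{0<..e}. P \<epsilon>)"
proof
  assume "\<forall>\<^sub>F \<epsilon> in at_right (0::real). P \<epsilon>"
  then obtain b where b: "b > 0" "\<And>y. 0 < y \<Longrightarrow> y < b \<Longrightarrow> P y"
    by (auto simp: eventually_at_right_field)
  then show "\<exists>e\<in>{0<..1}. \<forall>\<epsilon>\<in>{0<..e}. P \<epsilon>"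
    by (intro bexI[of _ "min 1 (b/2)"]) (auto simp: min_def split: if_splits)
next
  assume "\<exists>e\<in>{0<..1}. \<forall>\<epsilon>\<in>{0<..e}. P \<epsilon>"
  then show "\<forall>\<^sub>F \<epsilon> in at_right (0::real). P \<epsilon>"
    by (force simp: eventually_at_right_field)
qed

lemma const_le_inverse_eps: "\<forall>\<^sub>F \<epsilon> in at_right (0::real). C \<le> 1 / \<epsilon>"
proof -
  have "0 < 1 / (\<bar>C\<bar> + 1)" by (simp add: add_nonneg_pos)
  from eventually_at_right_small[OF this] show ?thesis
  proof eventually_elim
    case (elim \<epsilon>)
    then have "\<epsilon> * (\<bar>C\<bar> + 1) \<le> 1" by (simp add: field_simps)
    moreover have "\<epsilon> * C \<le> \<epsilon> * (\<bar>C\<bar> + 1)" using elim by (intro mult_left_mono) auto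
    ultimately show ?case using elim by (simp add: field_simps)
  qed
qed

lemma moderate_boundI:
  assumes "\<forall>\<^sub>F \<epsilon> in at_right 0. \<forall>x\<in>K. norm (f \<epsilon> x) \<le> C * (1 / \<epsilon>) ^ N"
  shows "moderate_bound K f"
  unfolding moderate_bound_def
proof (intro exI[of _ "Suc N"])
  show "\<forall>\<^sub>F \<epsilon> in at_right 0. \<forall>x\<in>K. norm (f \<epsilon> x) \<le> (1 / \<epsilon>) ^ Suc N"
    using assms const_le_inverse_eps[of C] eventually_at_right_small[OF zero_less_one]
  proof eventually_elim
    case (elim \<epsilon>)
    have "C * (1 / \<epsilon>) ^ N \<le> (1 / \<epsilon>) * (1 / \<epsilon>) ^ N"
      using elim by (intro mult_right_mono) auto
    then have "C * (1 / \<epsilon>) ^ N \<le> (1 / \<epsilon>) ^ Suc N" by simp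
    then show ?case using elim(1) by (meson order_trans)
  qed
qed

lemma moderate_boundE:
  assumes "moderate_bound K f"
  obtains N where "\<forall>\<^sub>F \<epsilon> in at_right 0. \<forall>x\<in>K. norm (f \<epsilon> x) \<le> (1 / \<epsilon>) ^ N"
  using assms by (auto simp: moderate_bound_def)

lemma sup_bigo_moderate_iff: "(\<exists>N::nat. sup_bigo K f (\<lambda>\<epsilon>. 1 / \<epsilon> ^ N)) \<longleftrightarrow> moderate_bound K f"
proof
  assume "\<exists>N::nat. sup_bigo K f (\<lambda>\<epsilon>. 1 / \<epsilon> ^ N)"
  then obtain N C where "\<forall>\<^sub>F \<epsilon> in at_right 0. \<forall>x\<in>K. norm (f \<epsilon> x) \<le> C * (1 / \<epsilon> ^ N)"
    by (auto simp: sup_bigo_def)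
  then show "moderate_bound K f"
    by (intro moderate_boundI[where C = C and N = N]) (simp add: power_divide)
next
  assume "moderate_bound K f"
  then show "\<exists>N::nat. sup_bigo K f (\<lambda>\<epsilon>. 1 / \<epsilon> ^ N)"
    unfolding sup_bigo_def moderate_bound_def
    by (elim exE) (intro exI[of _ 1] exI, simp add: power_divide)
qed

lemma null_boundI:
  assumes "\<And>m. \<exists>C. \<forall>\<^sub>F \<epsilon> in at_right 0. \<forall>x\<in>K. norm (f \<epsilon> x) \<le> C * \<epsilon> ^ m"
  shows "null_bound K f"
  unfolding null_bound_def
proof
  fix m
  obtain C where "\<forall>\<^sub>F \<epsilon> in at_right 0. \<forall>x\<in>K. norm (f \<epsilon> x) \<le> C * \<epsilon> ^ Suc m"
    using assms by blast
  then show "\<forall>\<^sub>F \<epsilon> in at_right 0. \<forall>x\<in>K. norm (f \<epsilon> x) \<le> \<epsilon> ^ m"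
    using const_le_inverse_eps[of C] eventually_at_right_small[OF zero_less_one]
  proof eventually_elim
    case (elim \<epsilon>)
    have "C * \<epsilon> \<le> 1" using elim by (simp add: field_simps)
    then have "(C * \<epsilon>) * \<epsilon> ^ m \<le> 1 * \<epsilon> ^ m"
      using elim by (intro mult_right_mono) auto
    then have "C * \<epsilon> ^ Suc m \<le> \<epsilon> ^ m" by (simp add: mult.assoc)
    then show ?case using elim(1) by (meson order_trans)
  qed
qed

lemma null_boundD:
  "null_bound K f \<Longrightarrow> \<forall>\<^sub>F \<epsilon> in at_right 0. \<forall>x\<in>K. norm (f \<epsilon> x) \<le> \<epsilon> ^ m"
  by (auto simp: null_bound_def)

lemma sup_bigo_null_iff: "(\<forall>m::nat. sup_bigo K f (\<lambda>\<epsilon>. \<epsilon> ^ m)) \<longleftrightarrow> null_bound K f"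
proof
  assume "\<forall>m::nat. sup_bigo K f (\<lambda>\<epsilon>. \<epsilon> ^ m)"
  then show "null_bound K f"
    by (intro null_boundI) (auto simp: sup_bigo_def)
next
  assume "null_bound K f"
  then show "\<forall>m::nat. sup_bigo K f (\<lambda>\<epsilon>. \<epsilon> ^ m)"
    unfolding sup_bigo_def null_bound_def by (intro allI exI[of _ 1]) simp
qed

text \<open>
  The substitution \<open>\<phi>\<close> may depend on \<open>\<epsilon>\<close> and need respect the sets for small \<open>\<epsilon>\<close> only; this
  is how bounds are pulled back along \<open>c\<close>-bounded nets.
\<close>
lemma moderate_bound_pullback:
  assumes "moderate_bound K f" "\<forall>\<^sub>F \<epsilon> in at_right 0. \<forall>x\<in>L. \<phi> \<epsilon> x \<in> K"
  shows "moderate_bound L (\<lambda>\<epsilon> x. f \<epsilon> (\<phi> \<epsilon> x))"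
proof -
  obtain N where "\<forall>\<^sub>F \<epsilon> in at_right 0. \<forall>x\<in>K. norm (f \<epsilon> x) \<le> (1 / \<epsilon>) ^ N"
    using assms(1) by (rule moderate_boundE)
  then have "\<forall>\<^sub>F \<epsilon> in at_right 0. \<forall>x\<in>L. norm (f \<epsilon> (\<phi> \<epsilon> x)) \<le> (1 / \<epsilon>) ^ N"
    using assms(2) by eventually_elim auto
  then show ?thesis by (auto simp: moderate_bound_def)
qed

lemma null_bound_pullback:
  assumes "null_bound K f" "\<forall>\<^sub>F \<epsilon> in at_right 0. \<forall>x\<in>L. \<phi> \<epsilon> x \<in> K"
  shows "null_bound L (\<lambda>\<epsilon> x. f \<epsilon> (\<phi> \<epsilon> x))"
  unfolding null_bound_def
proof
  fix m
  show "\<forall>\<^sub>F \<epsilon> in at_right 0. \<forall>x\<in>L. norm (f \<epsilon> (\<phi> \<epsilon> x)) \<le> \<epsilon> ^ m"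
    using null_boundD[OF assms(1), of m] assms(2) by eventually_elim auto
qed

lemma moderate_bound_dominated:
  assumes "moderate_bound K g" "\<forall>\<^sub>F \<epsilon> in at_right 0. \<forall>x\<in>K. norm (f \<epsilon> x) \<le> C * norm (g \<epsilon> x)"
  shows "moderate_bound K f"
proof -
  obtain N where "\<forall>\<^sub>F \<epsilon> in at_right 0. \<forall>x\<in>K. norm (g \<epsilon> x) \<le> (1 / \<epsilon>) ^ N"
    using assms(1) by (rule moderate_boundE)
  then have "\<forall>\<^sub>F \<epsilon> in at_right 0. \<forall>x\<in>K. norm (f \<epsilon> x) \<le> \<bar>C\<bar> * (1 / \<epsilon>) ^ N"
    using assms(2)
  proof eventually_elim
    case (elim \<epsilon>)
    have "norm (f \<epsilon> x) \<le> \<bar>C\<bar> * (1 / \<epsilon>) ^ N" if "x \<in> K" for x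
    proof -
      have "norm (f \<epsilon> x) \<le> C * norm (g \<epsilon> x)" using elim that by auto
      also have "\<dots> \<le> \<bar>C\<bar> * norm (g \<epsilon> x)" by (intro mult_right_mono) auto
      also have "\<dots> \<le> \<bar>C\<bar> * (1 / \<epsilon>) ^ N" using elim that by (intro mult_left_mono) auto
      finally show ?thesis .
    qed
    then show ?case by blast
  qed
  then show ?thesis by (rule moderate_boundI)
qed

lemma moderate_bound_const:
  assumes "\<And>x. x \<in> K \<Longrightarrow> norm (f x) \<le> C"
  shows "moderate_bound K (\<lambda>_. f)"
  by (rule moderate_boundI[where C = C and N = 0]) (use assms in auto)

lemma inverse_power_mono:
  assumes "0 < \<epsilon>" "\<epsilon> \<le> (1::real)" "m \<le> n"
  shows "(1 / \<epsilon>) ^ m \<le> (1 / \<epsilon>) ^ n"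
  by (rule power_increasing) (use assms in \<open>auto simp: field_simps\<close>)

lemma moderate_bound_prod:
  assumes "bounded_bilinear prd" "moderate_bound K f" "moderate_bound K g"
  shows "moderate_bound K (\<lambda>\<epsilon> x. prd (f \<epsilon> x) (g \<epsilon> x))"
proof -
  interpret bounded_bilinear prd by fact
  obtain C where C: "C > 0" "\<And>a b. norm (prd a b) \<le> norm a * norm b * C"
    using pos_bounded by auto
  obtain N where N: "\<forall>\<^sub>F \<epsilon> in at_right 0. \<forall>x\<in>K. norm (f \<epsilon> x) \<le> (1 / \<epsilon>) ^ N"
    using assms(2) by (rule moderate_boundE)
  obtain M where M: "\<forall>\<^sub>F \<epsilon> in at_right 0. \<forall>x\<in>K. norm (g \<epsilon> x) \<le> (1 / \<epsilon>) ^ M"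
    using assms(3) by (rule moderate_boundE)
  have "\<forall>\<^sub>F \<epsilon> in at_right 0. \<forall>x\<in>K. norm (prd (f \<epsilon> x) (g \<epsilon> x)) \<le> C * (1 / \<epsilon>) ^ (N + M)"
    using N M eventually_at_right_small[OF zero_less_one]
  proof eventually_elim
    case (elim \<epsilon>)
    have "norm (prd (f \<epsilon> x) (g \<epsilon> x)) \<le> C * (1 / \<epsilon>) ^ (N + M)" if "x \<in> K" for x
    proof -
      have "norm (f \<epsilon> x) * norm (g \<epsilon> x) * C \<le> (1 / \<epsilon>) ^ N * (1 / \<epsilon>) ^ M * C"
        using elim that C(1) by (intro mult_right_mono mult_mono) auto
      then show ?thesis using C(2)[of "f \<epsilon> x" "g \<epsilon> x"] by (simp add: power_add mult_ac)
    qed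
    then show ?case by blast
  qed
  then show ?thesis by (rule moderate_boundI)
qed

lemma moderate_bound_add:
  assumes "moderate_bound K f" "moderate_bound K g"
  shows "moderate_bound K (\<lambda>\<epsilon> x. f \<epsilon> x + g \<epsilon> x)"
proof -
  obtain N where N: "\<forall>\<^sub>F \<epsilon> in at_right 0. \<forall>x\<in>K. norm (f \<epsilon> x) \<le> (1 / \<epsilon>) ^ N"
    using assms(1) by (rule moderate_boundE)
  obtain M where M: "\<forall>\<^sub>F \<epsilon> in at_right 0. \<forall>x\<in>K. norm (g \<epsilon> x) \<le> (1 / \<epsilon>) ^ M"
    using assms(2) by (rule moderate_boundE)
  have "\<forall>\<^sub>F \<epsilon> in at_right 0. \<forall>x\<in>K. norm (f \<epsilon> x + g \<epsilon> x) \<le> 2 * (1 / \<epsilon>) ^ (N + M)"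
    using N M eventually_at_right_small[OF zero_less_one]
  proof eventually_elim
    case (elim \<epsilon>)
    have "norm (f \<epsilon> x + g \<epsilon> x) \<le> 2 * (1 / \<epsilon>) ^ (N + M)" if "x \<in> K" for x
    proof -
      have "norm (f \<epsilon> x + g \<epsilon> x) \<le> norm (f \<epsilon> x) + norm (g \<epsilon> x)" by (rule norm_triangle_ineq)
      moreover have "norm (f \<epsilon> x) \<le> (1 / \<epsilon>) ^ N" "norm (g \<epsilon> x) \<le> (1 / \<epsilon>) ^ M" using elim that by auto
      moreover have "(1 / \<epsilon>) ^ N \<le> (1 / \<epsilon>) ^ (N + M)" "(1 / \<epsilon>) ^ M \<le> (1 / \<epsilon>) ^ (N + M)"
        using elim by (intro inverse_power_mono; simp)+
      ultimately show ?thesis by linarith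
    qed
    then show ?case by blast
  qed
  then show ?thesis by (rule moderate_boundI)
qed

lemma moderate_bound_sum:
  assumes "finite I" "\<And>i. i \<in> I \<Longrightarrow> moderate_bound K (f i)"
  shows "moderate_bound K (\<lambda>\<epsilon> x. \<Sum>i\<in>I. f i \<epsilon> x)"
  using assms
proof (induction I rule: finite_induct)
  case empty
  then show ?case by (simp add: moderate_bound_const[where C = 0])
next
  case (insert i I)
  then show ?case by (simp add: moderate_bound_add)
qed

lemma null_bound_add:
  assumes "null_bound K f" "null_bound K g"
  shows "null_bound K (\<lambda>\<epsilon> x. f \<epsilon> x + g \<epsilon> x)"
proof (rule null_boundI)
  fix m
  have "\<forall>\<^sub>F \<epsilon> in at_right 0. \<forall>x\<in>K. norm (f \<epsilon> x + g \<epsilon> x) \<le> 2 * \<epsilon> ^ m"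
    using null_boundD[OF assms(1), of m] null_boundD[OF assms(2), of m]
  proof eventually_elim
    case (elim \<epsilon>)
    then show ?case by (smt (verit) norm_triangle_ineq)
  qed
  then show "\<exists>C. \<forall>\<^sub>F \<epsilon> in at_right 0. \<forall>x\<in>K. norm (f \<epsilon> x + g \<epsilon> x) \<le> C * \<epsilon> ^ m" by blast
qed

text \<open>
  Negligible nets absorb moderate factors.
\<close>
lemma null_bound_dominated:
  assumes "null_bound K f" "moderate_bound K g"
    "\<forall>\<^sub>F \<epsilon> in at_right 0. \<forall>x\<in>K. norm (h \<epsilon> x) \<le> norm (g \<epsilon> x) * norm (f \<epsilon> x)"
  shows "null_bound K h"
  unfolding null_bound_def
proof
  fix m
  obtain N where N: "\<forall>\<^sub>F \<epsilon> in at_right 0. \<forall>x\<in>K. norm (g \<epsilon> x) \<le> (1 / \<epsilon>) ^ N"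
    using assms(2) by (rule moderate_boundE)
  show "\<forall>\<^sub>F \<epsilon> in at_right 0. \<forall>x\<in>K. norm (h \<epsilon> x) \<le> \<epsilon> ^ m"
    using N null_boundD[OF assms(1), of "N + m"] assms(3) eventually_at_right_small[OF zero_less_one]
  proof eventually_elim
    case (elim \<epsilon>)
    have "norm (h \<epsilon> x) \<le> \<epsilon> ^ m" if "x \<in> K" for x
    proof -
      have "norm (h \<epsilon> x) \<le> norm (g \<epsilon> x) * norm (f \<epsilon> x)" using elim that by auto
      also have "\<dots> \<le> (1 / \<epsilon>) ^ N * \<epsilon> ^ (N + m)"
        using elim that by (intro mult_mono) auto
      also have "\<dots> = \<epsilon> ^ m" using elim by (simp add: power_add power_divide)
      finally show ?thesis .
    qed
    then show ?case by blast
  qed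
qed

text \<open>This is where the logarithmic growth condition enters: \<open>e\<^bsup>C |log \<epsilon>|\<^esup> = \<epsilon>\<^bsup>-C\<^esup>\<close>.\<close>
lemma moderate_bound_exp_log:
  "moderate_bound K (\<lambda>\<epsilon> x. exp (C * \<bar>ln \<epsilon>\<bar> + D))"
proof (rule moderate_boundI[where C = "exp D" and N = "nat \<lceil>\<bar>C\<bar>\<rceil>"])
  show "\<forall>\<^sub>F \<epsilon> in at_right 0. \<forall>x\<in>K. norm (exp (C * \<bar>ln \<epsilon>\<bar> + D)) \<le> exp D * (1 / \<epsilon>) ^ nat \<lceil>\<bar>C\<bar>\<rceil>"
    using eventually_at_right_small[OF zero_less_one]
  proof eventually_elim
    case (elim \<epsilon>)
    let ?n = "nat \<lceil>\<bar>C\<bar>\<rceil>"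
    have "C * \<bar>ln \<epsilon>\<bar> \<le> real ?n * \<bar>ln \<epsilon>\<bar>"
      by (intro mult_right_mono) (auto, linarith)
    moreover have "\<bar>ln \<epsilon>\<bar> = ln (1 / \<epsilon>)" using elim by (simp add: ln_div)
    ultimately have "exp (C * \<bar>ln \<epsilon>\<bar>) \<le> exp (real ?n * ln (1 / \<epsilon>))"
      by (metis exp_le_cancel_iff)
    also have "\<dots> = (1 / \<epsilon>) ^ ?n" unfolding exp_of_nat_mult using elim by simp
    finally show ?case by (simp add: exp_add mult.commute)
  qed
qed

section \<open>Moderate nets of \<open>C\<^sup>k\<close> maps with a passive time variable\<close>

definition moderate_C0 ::
  "real \<Rightarrow> 'z::euclidean_space set \<Rightarrow> (real \<Rightarrow> real \<times> 'z \<Rightarrow> 'x::real_normed_vector) \<Rightarrow> bool" where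
  "moderate_C0 e Z f \<longleftrightarrow> (\<forall>\<epsilon>\<in>{0<..e}. continuous_on ({0..1} \<times> Z) (f \<epsilon>)) \<and>
     (\<forall>K. compact K \<longrightarrow> K \<subseteq> Z \<longrightarrow> moderate_bound ({0..1} \<times> K) f)"

text \<open>
  The arguments are pairs \<open>(s, z)\<close> of a time \<open>s \<in> [0, 1]\<close>, in which nothing is differentiated, and an
  active variable \<open>z\<close>. With a constant net the predicate says that a map is \<open>C\<^sup>k\<close> in \<open>z\<close>, with derivatives
  which are continuous in \<open>(s, z)\<close>. The bound \<open>e\<close> is needed because
  equations and compositions make sense for small \<open>\<epsilon>\<close> only.
\<close>
primrec moderate_Ck ::
  "nat \<Rightarrow> real \<Rightarrow> 'z::euclidean_space set \<Rightarrow> (real \<Rightarrow> real \<times> 'z \<Rightarrow> 'x::real_normed_vector) \<Rightarrow> bool" where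
  "moderate_Ck 0 e Z f \<longleftrightarrow> moderate_C0 e Z f"
| "moderate_Ck (Suc k) e Z f \<longleftrightarrow> moderate_C0 e Z f \<and>
     (\<exists>f'. (\<forall>\<epsilon>\<in>{0<..e}. \<forall>s\<in>{0..1}. \<forall>z\<in>Z. ((\<lambda>z. f \<epsilon> (s, z)) has_derivative f' \<epsilon> (s, z)) (at z)) \<and>
       (\<forall>b\<in>Basis. moderate_Ck k e Z (\<lambda>\<epsilon> q. f' \<epsilon> q b)))"

lemma moderate_C0_continuous_on:
  "moderate_C0 e Z f \<Longrightarrow> \<epsilon> \<in> {0<..e} \<Longrightarrow> continuous_on ({0..1} \<times> Z) (f \<epsilon>)"
  by (simp add: moderate_C0_def)

lemma moderate_C0_bound:
  "moderate_C0 e Z f \<Longrightarrow> compact K \<Longrightarrow> K \<subseteq> Z \<Longrightarrow> moderate_bound ({0..1} \<times> K) f"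
  by (simp add: moderate_C0_def)

lemma moderate_CkI:
  assumes "moderate_C0 e Z f"
    "\<And>\<epsilon> s z. \<epsilon> \<in> {0<..e} \<Longrightarrow> s \<in> {0..1} \<Longrightarrow> z \<in> Z \<Longrightarrow>
       ((\<lambda>z. f \<epsilon> (s, z)) has_derivative f' \<epsilon> (s, z)) (at z)"
    "\<And>b. b \<in> Basis \<Longrightarrow> moderate_Ck k e Z (\<lambda>\<epsilon> q. f' \<epsilon> q b)"
  shows "moderate_Ck (Suc k) e Z f"
  unfolding moderate_Ck.simps by (intro conjI exI[of _ f'] ballI) (use assms in blast)+

lemma moderate_CkE:
  assumes "moderate_Ck (Suc k) e Z f"
  obtains f' where
    "\<And>\<epsilon> s z. \<epsilon> \<in> {0<..e} \<Longrightarrow> s \<in> {0..1} \<Longrightarrow> z \<in> Z \<Longrightarrow>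
       ((\<lambda>z. f \<epsilon> (s, z)) has_derivative f' \<epsilon> (s, z)) (at z)"
    "\<And>b. b \<in> Basis \<Longrightarrow> moderate_Ck k e Z (\<lambda>\<epsilon> q. f' \<epsilon> q b)"
  using assms unfolding moderate_Ck.simps by blast

lemma moderate_Ck_C0: "moderate_Ck k e Z f \<Longrightarrow> moderate_C0 e Z f"
  by (cases k) auto

lemma moderate_Ck_Suc_D: "moderate_Ck (Suc k) e Z f \<Longrightarrow> moderate_Ck k e Z f"
proof (induction k arbitrary: f)
  case 0
  then show ?case by simp
next
  case (Suc k)
  from Suc.prems obtain f' where f':
    "\<And>\<epsilon> s z. \<epsilon> \<in> {0<..e} \<Longrightarrow> s \<in> {0..1} \<Longrightarrow> z \<in> Z \<Longrightarrow>
       ((\<lambda>z. f \<epsilon> (s, z)) has_derivative f' \<epsilon> (s, z)) (at z)"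
    "\<And>b. b \<in> Basis \<Longrightarrow> moderate_Ck (Suc k) e Z (\<lambda>\<epsilon> q. f' \<epsilon> q b)"
    by (rule moderate_CkE) blast
  show ?case
    by (rule moderate_CkI[OF moderate_Ck_C0[OF Suc.prems] f'(1) Suc.IH[OF f'(2)]])
qed

lemma moderate_C0_subset:
  "moderate_C0 e Z f \<Longrightarrow> e' \<le> e \<Longrightarrow> Y \<subseteq> Z \<Longrightarrow> moderate_C0 e' Y f"
  unfolding moderate_C0_def
  by (auto intro: continuous_on_subset[where s = "{0..1} \<times> Z"])

lemma moderate_Ck_subset:
  assumes "moderate_Ck k e Z f" "e' \<le> e" "Y \<subseteq> Z"
  shows "moderate_Ck k e' Y f"
  using assms(1)
proof (induction k arbitrary: f)
  case 0
  then show ?case using moderate_C0_subset assms by auto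
next
  case (Suc k)
  from Suc.prems(1) obtain f' where f':
    "\<And>\<epsilon> s z. \<epsilon> \<in> {0<..e} \<Longrightarrow> s \<in> {0..1} \<Longrightarrow> z \<in> Z \<Longrightarrow>
       ((\<lambda>z. f \<epsilon> (s, z)) has_derivative f' \<epsilon> (s, z)) (at z)"
    "\<And>b. b \<in> Basis \<Longrightarrow> moderate_Ck k e Z (\<lambda>\<epsilon> q. f' \<epsilon> q b)"
    by (rule moderate_CkE) blast
  show ?case
  proof (rule moderate_CkI[OF moderate_C0_subset[OF moderate_Ck_C0[OF Suc.prems] assms(2,3)] _ Suc.IH[OF f'(2)]])
    show "((\<lambda>z. f \<epsilon> (s, z)) has_derivative f' \<epsilon> (s, z)) (at z)"
      if "\<epsilon> \<in> {0<..e'}" "s \<in> {0..1}" "z \<in> Y" for \<epsilon> s z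
      using f'(1)[of \<epsilon> s z] that assms by auto
  qed
qed

lemma moderate_C0_slice:
  assumes "moderate_C0 e Z f" "s0 \<in> {0..1}"
  shows "moderate_C0 e Z (\<lambda>\<epsilon> q. f \<epsilon> (s0, snd q))"
  unfolding moderate_C0_def
proof (intro conjI ballI allI impI)
  fix \<epsilon> assume "\<epsilon> \<in> {0<..e}"
  then have "continuous_on ({0..1} \<times> Z) (f \<epsilon>)" using assms(1) by (simp add: moderate_C0_def)
  then show "continuous_on ({0..1} \<times> Z) (\<lambda>q. f \<epsilon> (s0, snd q))"
    by (rule continuous_on_compose2) (use assms(2) in \<open>auto intro!: continuous_intros\<close>)
next
  fix K assume "compact K" "K \<subseteq> Z"
  then have "moderate_bound ({0..1} \<times> K) f" using assms(1) by (simp add: moderate_C0_def)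
  then show "moderate_bound ({0..1} \<times> K) (\<lambda>\<epsilon> q. f \<epsilon> (s0, snd q))"
    by (rule moderate_bound_pullback) (use assms(2) in auto)
qed

lemma moderate_Ck_slice:
  assumes "moderate_Ck k e Z f" "s0 \<in> {0..1}"
  shows "moderate_Ck k e Z (\<lambda>\<epsilon> q. f \<epsilon> (s0, snd q))"
  using assms(1)
proof (induction k arbitrary: f)
  case 0
  then show ?case using moderate_C0_slice[OF _ assms(2)] by simp
next
  case (Suc k)
  obtain f' where f': "\<And>\<epsilon> s z. \<epsilon> \<in> {0<..e} \<Longrightarrow> s \<in> {0..1} \<Longrightarrow> z \<in> Z \<Longrightarrow>
       ((\<lambda>z. f \<epsilon> (s, z)) has_derivative f' \<epsilon> (s, z)) (at z)"
    "\<And>b. b \<in> Basis \<Longrightarrow> moderate_Ck k e Z (\<lambda>\<epsilon> q. f' \<epsilon> q b)"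
    using Suc.prems(1) by (rule moderate_CkE) blast
  show ?case
    by (rule moderate_CkI[where f' = "\<lambda>\<epsilon> q. f' \<epsilon> (s0, snd q)",
          OF moderate_C0_slice[OF moderate_Ck_C0[OF Suc.prems] assms(2)] _ Suc.IH[OF f'(2)]])
      (use f'(1) assms(2) in simp_all)
qed

lemma moderate_C0_cong:
  assumes "moderate_C0 e Z f" "e > 0"
    "\<And>\<epsilon> s z. \<epsilon> \<in> {0<..e} \<Longrightarrow> s \<in> {0..1} \<Longrightarrow> z \<in> Z \<Longrightarrow> f \<epsilon> (s, z) = g \<epsilon> (s, z)"
  shows "moderate_C0 e Z g"
  unfolding moderate_C0_def
proof (intro conjI ballI allI impI)
  fix \<epsilon> assume "\<epsilon> \<in> {0<..e}"
  then show "continuous_on ({0..1} \<times> Z) (g \<epsilon>)"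
    using assms by (subst continuous_on_cong[OF refl, where g = "f \<epsilon>"]) (auto simp: moderate_C0_def)
next
  fix K assume "compact K" "K \<subseteq> Z"
  then have "moderate_bound ({0..1} \<times> K) f" using assms by (auto simp: moderate_C0_def)
  then show "moderate_bound ({0..1} \<times> K) g"
  proof (rule moderate_bound_dominated)
    show "\<forall>\<^sub>F \<epsilon> in at_right 0. \<forall>x\<in>{0..1} \<times> K. norm (g \<epsilon> x) \<le> 1 * norm (f \<epsilon> x)"
      using eventually_at_right_small[OF assms(2)]
      by eventually_elim (use assms(3) \<open>K \<subseteq> Z\<close> in auto)
  qed
qed

lemma moderate_Ck_cong:
  assumes "open Z" "moderate_Ck k e Z f" "e > 0"
    "\<And>\<epsilon> s z. \<epsilon> \<in> {0<..e} \<Longrightarrow> s \<in> {0..1} \<Longrightarrow> z \<in> Z \<Longrightarrow> f \<epsilon> (s, z) = g \<epsilon> (s, z)"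
  shows "moderate_Ck k e Z g"
proof (cases k)
  case 0
  then show ?thesis using moderate_C0_cong[of e Z f g] assms(2-4) by simp
next
  case (Suc k')
  from assms(2) obtain f' where f':
    "\<And>\<epsilon> s z. \<epsilon> \<in> {0<..e} \<Longrightarrow> s \<in> {0..1} \<Longrightarrow> z \<in> Z \<Longrightarrow>
       ((\<lambda>z. f \<epsilon> (s, z)) has_derivative f' \<epsilon> (s, z)) (at z)"
    "\<And>b. b \<in> Basis \<Longrightarrow> moderate_Ck k' e Z (\<lambda>\<epsilon> q. f' \<epsilon> q b)"
    unfolding Suc by (rule moderate_CkE) blast
  show ?thesis unfolding Suc
  proof (rule moderate_CkI[where f' = f'])
    show "moderate_C0 e Z g"
      using moderate_C0_cong[of e Z f g] moderate_Ck_C0[OF assms(2)] assms(3,4) by simp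
    show "((\<lambda>z. g \<epsilon> (s, z)) has_derivative f' \<epsilon> (s, z)) (at z)"
      if "\<epsilon> \<in> {0<..e}" "s \<in> {0..1}" "z \<in> Z" for \<epsilon> s z
      by (rule has_derivative_transform_within_open[OF f'(1)[OF that] assms(1) that(3)])
        (use assms(4) that in auto)
  qed (use f'(2) in auto)
qed

text \<open>
  The derivatives whose existence the definition requires are unique, so that one canonical choice
  serves for all orders \<open>k\<close> at once.
\<close>
lemma moderate_Ck_frechet_derivative:
  fixes f :: "real \<Rightarrow> real \<times> 'z::euclidean_space \<Rightarrow> 'x::real_normed_vector"
  assumes "open Z" "e > 0" "moderate_Ck (Suc k) e Z f"
  defines "f' \<equiv> \<lambda>\<epsilon> q. frechet_derivative (\<lambda>z. f \<epsilon> (fst q, z)) (at (snd q))"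
  shows "\<And>\<epsilon> s z. \<epsilon> \<in> {0<..e} \<Longrightarrow> s \<in> {0..1} \<Longrightarrow> z \<in> Z \<Longrightarrow>
       ((\<lambda>z. f \<epsilon> (s, z)) has_derivative f' \<epsilon> (s, z)) (at z)" (is "PROP ?der")
    and "\<And>b. b \<in> Basis \<Longrightarrow> moderate_Ck k e Z (\<lambda>\<epsilon> q. f' \<epsilon> q b)"
proof -
  obtain D where D: "\<And>\<epsilon> s z. \<epsilon> \<in> {0<..e} \<Longrightarrow> s \<in> {0..1} \<Longrightarrow> z \<in> Z \<Longrightarrow>
       ((\<lambda>z. f \<epsilon> (s, z)) has_derivative D \<epsilon> (s, z)) (at z)"
    "\<And>b. b \<in> Basis \<Longrightarrow> moderate_Ck k e Z (\<lambda>\<epsilon> q. D \<epsilon> q b)"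
    using assms(3) by (rule moderate_CkE) blast
  have eq: "D \<epsilon> (s, z) = f' \<epsilon> (s, z)" if "\<epsilon> \<in> {0<..e}" "s \<in> {0..1}" "z \<in> Z" for \<epsilon> s z
    unfolding f'_def using frechet_derivative_at[OF D(1)[OF that]] by simp
  show "PROP ?der" using D(1) eq by simp
  show "moderate_Ck k e Z (\<lambda>\<epsilon> q. f' \<epsilon> q b)" if "b \<in> Basis" for b
    by (rule moderate_Ck_cong[OF assms(1) D(2)[OF that] assms(2)]) (simp add: eq)
qed

lemma continuous_imp_moderate_C0:
  assumes "continuous_on ({0..1} \<times> Z) f"
  shows "moderate_C0 e Z (\<lambda>_. f)"
  unfolding moderate_C0_def
proof (intro conjI ballI allI impI assms)
  fix K assume K: "compact K" "K \<subseteq> Z"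
  have "compact (f ` ({0..1} \<times> K))"
    using K assms by (intro compact_continuous_image compact_Times continuous_on_subset[OF assms]) auto
  then obtain C where "\<And>x. x \<in> {0..1} \<times> K \<Longrightarrow> norm (f x) \<le> C"
    by (meson compact_imp_bounded bounded_iff imageI)
  then show "moderate_bound ({0..1} \<times> K) (\<lambda>_. f)" by (rule moderate_bound_const)
qed

lemma moderate_Ck_zero: "moderate_Ck k e Z (\<lambda>\<epsilon> q. 0)"
proof (induction k)
  case (Suc k)
  show ?case by (rule moderate_CkI[where f' = "\<lambda>\<epsilon> q h. 0"]) (use Suc moderate_Ck_C0 in auto)
qed (simp add: continuous_imp_moderate_C0)

lemma moderate_Ck_time:
  assumes "continuous_on {0..1} f"
  shows "moderate_Ck k e Z (\<lambda>\<epsilon> q. f (fst q))"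
proof -
  have "continuous_on ({0..1} \<times> Z) (\<lambda>q. f (fst q))"
    by (intro continuous_on_compose2[OF assms] continuous_intros) auto
  then have C0: "moderate_C0 e Z (\<lambda>\<epsilon> q. f (fst q))" by (rule continuous_imp_moderate_C0)
  show ?thesis
  proof (cases k)
    case 0
    then show ?thesis using C0 by simp
  next
    case (Suc j)
    show ?thesis unfolding Suc
      by (rule moderate_CkI[where f' = "\<lambda>\<epsilon> q h. 0"]) (use C0 moderate_Ck_zero in auto)
  qed
qed

lemma moderate_Ck_const: "moderate_Ck k e Z (\<lambda>\<epsilon> q. c)"
  using moderate_Ck_time[of "\<lambda>_. c" k e Z] by auto

lemma moderate_Ck_linear:
  assumes "bounded_linear f"
  shows "moderate_Ck k e Z (\<lambda>\<epsilon> q. f (snd q))"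
proof -
  have C0: "moderate_C0 e Z (\<lambda>\<epsilon> q. f (snd q))"
    by (intro continuous_imp_moderate_C0 continuous_on_compose2[OF linear_continuous_on[OF assms]]
        continuous_intros) auto
  show ?thesis
  proof (cases k)
    case 0
    then show ?thesis using C0 by auto
  next
    case (Suc j)
    show ?thesis unfolding Suc
      by (rule moderate_CkI[where f' = "\<lambda>\<epsilon> q. f"])
        (use C0 bounded_linear_imp_has_derivative[OF assms] moderate_Ck_const in auto)
  qed
qed

lemma moderate_C0_prod:
  assumes "bounded_bilinear prd" "moderate_C0 e Z f" "moderate_C0 e Z g"
  shows "moderate_C0 e Z (\<lambda>\<epsilon> q. prd (f \<epsilon> q) (g \<epsilon> q))"
  unfolding moderate_C0_def
proof (intro conjI ballI allI impI)
  show "continuous_on ({0..1} \<times> Z) (\<lambda>q. prd (f \<epsilon> q) (g \<epsilon> q))" if "\<epsilon> \<in> {0<..e}" for \<epsilon>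
    using assms(2,3) that by (intro bounded_bilinear.continuous_on[OF assms(1)]) (simp_all add: moderate_C0_def)
  show "moderate_bound ({0..1} \<times> K) (\<lambda>\<epsilon> q. prd (f \<epsilon> q) (g \<epsilon> q))" if "compact K" "K \<subseteq> Z" for K
    using assms(2,3) that by (intro moderate_bound_prod[OF assms(1)]) (simp_all add: moderate_C0_def)
qed

lemma moderate_C0_add:
  assumes "moderate_C0 e Z f" "moderate_C0 e Z g"
  shows "moderate_C0 e Z (\<lambda>\<epsilon> q. f \<epsilon> q + g \<epsilon> q)"
  unfolding moderate_C0_def
proof (intro conjI ballI allI impI)
  show "continuous_on ({0..1} \<times> Z) (\<lambda>q. f \<epsilon> q + g \<epsilon> q)" if "\<epsilon> \<in> {0<..e}" for \<epsilon>
    using assms that by (intro continuous_on_add) (simp_all add: moderate_C0_def)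
  show "moderate_bound ({0..1} \<times> K) (\<lambda>\<epsilon> q. f \<epsilon> q + g \<epsilon> q)" if "compact K" "K \<subseteq> Z" for K
    using assms that by (intro moderate_bound_add) (simp_all add: moderate_C0_def)
qed

lemma moderate_Ck_add:
  assumes "moderate_Ck k e Z f" "moderate_Ck k e Z g"
  shows "moderate_Ck k e Z (\<lambda>\<epsilon> q. f \<epsilon> q + g \<epsilon> q)"
  using assms
proof (induction k arbitrary: f g)
  case 0
  then show ?case by (simp add: moderate_C0_add)
next
  case (Suc k)
  obtain f' where f': "\<And>\<epsilon> s z. \<epsilon> \<in> {0<..e} \<Longrightarrow> s \<in> {0..1} \<Longrightarrow> z \<in> Z \<Longrightarrow>
       ((\<lambda>z. f \<epsilon> (s, z)) has_derivative f' \<epsilon> (s, z)) (at z)"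
    "\<And>b. b \<in> Basis \<Longrightarrow> moderate_Ck k e Z (\<lambda>\<epsilon> q. f' \<epsilon> q b)"
    using Suc.prems(1) by (rule moderate_CkE) blast
  obtain g' where g': "\<And>\<epsilon> s z. \<epsilon> \<in> {0<..e} \<Longrightarrow> s \<in> {0..1} \<Longrightarrow> z \<in> Z \<Longrightarrow>
       ((\<lambda>z. g \<epsilon> (s, z)) has_derivative g' \<epsilon> (s, z)) (at z)"
    "\<And>b. b \<in> Basis \<Longrightarrow> moderate_Ck k e Z (\<lambda>\<epsilon> q. g' \<epsilon> q b)"
    using Suc.prems(2) by (rule moderate_CkE) blast
  show ?case
    by (rule moderate_CkI[where f' = "\<lambda>\<epsilon> q h. f' \<epsilon> q h + g' \<epsilon> q h"])
      (simp_all add: moderate_C0_add Suc.prems[THEN moderate_Ck_C0] has_derivative_add f' g' Suc.IH)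
qed

lemma moderate_Ck_sum:
  assumes "finite I" "\<And>i. i \<in> I \<Longrightarrow> moderate_Ck k e Z (f i)"
  shows "moderate_Ck k e Z (\<lambda>\<epsilon> q. \<Sum>i\<in>I. f i \<epsilon> q)"
  using assms
proof (induction I rule: finite_induct)
  case empty
  then show ?case by (simp add: moderate_Ck_const)
next
  case (insert i I)
  then show ?case by (simp add: moderate_Ck_add)
qed

lemma moderate_Ck_prod:
  assumes "bounded_bilinear prd" "moderate_Ck k e Z f" "moderate_Ck k e Z g"
  shows "moderate_Ck k e Z (\<lambda>\<epsilon> q. prd (f \<epsilon> q) (g \<epsilon> q))"
  using assms(2,3)
proof (induction k arbitrary: f g)
  case 0
  then show ?case by (simp add: moderate_C0_prod[OF assms(1)])
next
  case (Suc k)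
  obtain f' where f': "\<And>\<epsilon> s z. \<epsilon> \<in> {0<..e} \<Longrightarrow> s \<in> {0..1} \<Longrightarrow> z \<in> Z \<Longrightarrow>
       ((\<lambda>z. f \<epsilon> (s, z)) has_derivative f' \<epsilon> (s, z)) (at z)"
    "\<And>b. b \<in> Basis \<Longrightarrow> moderate_Ck k e Z (\<lambda>\<epsilon> q. f' \<epsilon> q b)"
    using Suc.prems(1) by (rule moderate_CkE) blast
  obtain g' where g': "\<And>\<epsilon> s z. \<epsilon> \<in> {0<..e} \<Longrightarrow> s \<in> {0..1} \<Longrightarrow> z \<in> Z \<Longrightarrow>
       ((\<lambda>z. g \<epsilon> (s, z)) has_derivative g' \<epsilon> (s, z)) (at z)"
    "\<And>b. b \<in> Basis \<Longrightarrow> moderate_Ck k e Z (\<lambda>\<epsilon> q. g' \<epsilon> q b)"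
    using Suc.prems(2) by (rule moderate_CkE) blast
  show ?case
  proof (rule moderate_CkI[where f' = "\<lambda>\<epsilon> q h. prd (f \<epsilon> q) (g' \<epsilon> q h) + prd (f' \<epsilon> q h) (g \<epsilon> q)"])
    show "moderate_C0 e Z (\<lambda>\<epsilon> q. prd (f \<epsilon> q) (g \<epsilon> q))"
      by (rule moderate_C0_prod[OF assms(1) Suc.prems[THEN moderate_Ck_C0]])
    show "((\<lambda>z. prd (f \<epsilon> (s, z)) (g \<epsilon> (s, z))) has_derivative
        (\<lambda>h. prd (f \<epsilon> (s, z)) (g' \<epsilon> (s, z) h) + prd (f' \<epsilon> (s, z) h) (g \<epsilon> (s, z)))) (at z)"
      if "\<epsilon> \<in> {0<..e}" "s \<in> {0..1}" "z \<in> Z" for \<epsilon> s z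
      by (rule bounded_bilinear.FDERIV[OF assms(1) f'(1)[OF that] g'(1)[OF that]])
    show "moderate_Ck k e Z (\<lambda>\<epsilon> q. prd (f \<epsilon> q) (g' \<epsilon> q b) + prd (f' \<epsilon> q b) (g \<epsilon> q))"
      if "b \<in> Basis" for b
      by (intro moderate_Ck_add Suc.IH f' g' Suc.prems[THEN moderate_Ck_Suc_D] that)
  qed
qed

lemma moderate_Ck_bounded_linear:
  assumes "bounded_linear L" "moderate_Ck k e Z f"
  shows "moderate_Ck k e Z (\<lambda>\<epsilon> q. L (f \<epsilon> q))"
proof -
  interpret L: bounded_linear L by fact
  have "bounded_bilinear (\<lambda>r x. r *\<^sub>R L x)"
    by (rule bounded_bilinear.comp[OF bounded_bilinear_scaleR bounded_linear_ident assms(1)])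
  from moderate_Ck_prod[OF this moderate_Ck_const[where c = 1] assms(2)] show ?thesis by simp
qed

lemma moderate_Ck_Pair:
  assumes "moderate_Ck k e Z f" "moderate_Ck k e Z g"
  shows "moderate_Ck k e Z (\<lambda>\<epsilon> q. (f \<epsilon> q, g \<epsilon> q))"
proof -
  have "bounded_linear (\<lambda>x::'b. (x, 0::'c))" "bounded_linear (\<lambda>y::'c. (0::'b, y))"
    by (intro bounded_linear_Pair bounded_linear_ident bounded_linear_zero)+
  from moderate_Ck_add[OF moderate_Ck_bounded_linear[OF this(1) assms(1)]
      moderate_Ck_bounded_linear[OF this(2) assms(2)]]
  show ?thesis by simp
qed

text \<open>
  The chain rule. The inner net must keep compact sets in compact subsets of the domain of the
  outer one, uniformly for small \<open>\<epsilon>\<close>: moderateness gives no bound near the boundary.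
\<close>
lemma moderate_Ck_compose:
  assumes "moderate_Ck k e Y G" "moderate_Ck k e Z f" "e > 0"
    and "\<And>\<epsilon> s z. \<epsilon> \<in> {0<..e} \<Longrightarrow> s \<in> {0..1} \<Longrightarrow> z \<in> Z \<Longrightarrow> f \<epsilon> (s, z) \<in> Y"
    and "\<And>K. compact K \<Longrightarrow> K \<subseteq> Z \<Longrightarrow>
       \<exists>L. compact L \<and> L \<subseteq> Y \<and> (\<forall>\<^sub>F \<epsilon> in at_right 0. \<forall>q\<in>{0..1} \<times> K. f \<epsilon> q \<in> L)"
  shows "moderate_Ck k e Z (\<lambda>\<epsilon> q. G \<epsilon> (fst q, f \<epsilon> q))"
proof -
  have base: "moderate_C0 e Z (\<lambda>\<epsilon> q. G \<epsilon> (fst q, f \<epsilon> q))"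
    if G: "moderate_C0 e Y G" and f: "moderate_C0 e Z f" for G :: "real \<Rightarrow> real \<times> 'a \<Rightarrow> 'b"
    unfolding moderate_C0_def
  proof (intro conjI ballI allI impI)
    fix \<epsilon> assume \<epsilon>: "\<epsilon> \<in> {0<..e}"
    show "continuous_on ({0..1} \<times> Z) (\<lambda>q. G \<epsilon> (fst q, f \<epsilon> q))"
      by (rule continuous_on_compose2[where t = "{0..1} \<times> Y" and g = "G \<epsilon>"])
        (use G f \<epsilon> assms(4) in \<open>auto simp: moderate_C0_def intro!: continuous_intros\<close>)
  next
    fix K assume K: "compact K" "K \<subseteq> Z"
    then obtain L where L: "compact L" "L \<subseteq> Y" "\<forall>\<^sub>F \<epsilon> in at_right 0. \<forall>q\<in>{0..1} \<times> K. f \<epsilon> q \<in> L"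
      using assms(5) by blast
    show "moderate_bound ({0..1} \<times> K) (\<lambda>\<epsilon> q. G \<epsilon> (fst q, f \<epsilon> q))"
    proof (rule moderate_bound_pullback[where \<phi> = "\<lambda>\<epsilon> q. (fst q, f \<epsilon> q)"])
      show "moderate_bound ({0..1} \<times> L) G" using G L by (auto simp: moderate_C0_def)
      show "\<forall>\<^sub>F \<epsilon> in at_right 0. \<forall>x\<in>{0..1} \<times> K. (fst x, f \<epsilon> x) \<in> {0..1} \<times> L"
        using L(3) by eventually_elim auto
    qed
  qed
  show ?thesis
    using assms(1,2)
  proof (induction k arbitrary: G)
    case 0
    then show ?case using base by simp
  next
    case (Suc k)
    obtain G' where G': "\<And>\<epsilon> s y. \<epsilon> \<in> {0<..e} \<Longrightarrow> s \<in> {0..1} \<Longrightarrow> y \<in> Y \<Longrightarrow>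
         ((\<lambda>y. G \<epsilon> (s, y)) has_derivative G' \<epsilon> (s, y)) (at y)"
      "\<And>b. b \<in> Basis \<Longrightarrow> moderate_Ck k e Y (\<lambda>\<epsilon> q. G' \<epsilon> q b)"
      using Suc.prems(1) by (rule moderate_CkE) blast
    obtain f' where f': "\<And>\<epsilon> s z. \<epsilon> \<in> {0<..e} \<Longrightarrow> s \<in> {0..1} \<Longrightarrow> z \<in> Z \<Longrightarrow>
         ((\<lambda>z. f \<epsilon> (s, z)) has_derivative f' \<epsilon> (s, z)) (at z)"
      "\<And>b. b \<in> Basis \<Longrightarrow> moderate_Ck k e Z (\<lambda>\<epsilon> q. f' \<epsilon> q b)"
      using Suc.prems(2) by (rule moderate_CkE) blast
    define h' where "h' = (\<lambda>\<epsilon> q h. \<Sum>c\<in>Basis. (f' \<epsilon> q h \<bullet> c) *\<^sub>R G' \<epsilon> (fst q, f \<epsilon> q) c)"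
    show ?case
    proof (rule moderate_CkI[where f' = h'])
      show "moderate_C0 e Z (\<lambda>\<epsilon> q. G \<epsilon> (fst q, f \<epsilon> q))"
        by (rule base[OF Suc.prems[THEN moderate_Ck_C0]])
    next
      fix \<epsilon> s z assume *: "\<epsilon> \<in> {0<..e}" "s \<in> {0..1::real}" "z \<in> Z"
      have G'': "((\<lambda>y. G \<epsilon> (s, y)) has_derivative G' \<epsilon> (s, f \<epsilon> (s, z))) (at (f \<epsilon> (s, z)))"
        using G'(1) * assms(4) by blast
      interpret G': bounded_linear "G' \<epsilon> (s, f \<epsilon> (s, z))"
        using G'' by (rule has_derivative_bounded_linear)
      have "((\<lambda>z. G \<epsilon> (s, f \<epsilon> (s, z))) has_derivative
          (\<lambda>h. G' \<epsilon> (s, f \<epsilon> (s, z)) (f' \<epsilon> (s, z) h))) (at z)"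
        using has_derivative_compose[OF f'(1)[OF *] G''] .
      also have "(\<lambda>h. G' \<epsilon> (s, f \<epsilon> (s, z)) (f' \<epsilon> (s, z) h)) = h' \<epsilon> (s, z)"
      proof
        fix h
        have "G' \<epsilon> (s, f \<epsilon> (s, z)) (f' \<epsilon> (s, z) h) =
            G' \<epsilon> (s, f \<epsilon> (s, z)) (\<Sum>c\<in>Basis. (f' \<epsilon> (s, z) h \<bullet> c) *\<^sub>R c)"
          by (simp add: euclidean_representation)
        then show "G' \<epsilon> (s, f \<epsilon> (s, z)) (f' \<epsilon> (s, z) h) = h' \<epsilon> (s, z) h"
          by (simp add: h'_def G'.sum G'.scaleR)
      qed
      finally show "((\<lambda>z. G \<epsilon> (fst (s, z), f \<epsilon> (s, z))) has_derivative h' \<epsilon> (s, z)) (at z)"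
        by simp
    next
      fix b :: 'c assume b: "b \<in> Basis"
      show "moderate_Ck k e Z (\<lambda>\<epsilon> q. h' \<epsilon> q b)"
        unfolding h'_def
      proof (intro moderate_Ck_sum finite_Basis moderate_Ck_prod[OF bounded_bilinear_scaleR])
        fix c :: 'a assume c: "c \<in> Basis"
        show "moderate_Ck k e Z (\<lambda>\<epsilon> q. f' \<epsilon> q b \<bullet> c)"
          using moderate_Ck_bounded_linear[OF bounded_linear_inner_left f'(2)[OF b]] .
        show "moderate_Ck k e Z (\<lambda>\<epsilon> q. G' \<epsilon> (fst q, f \<epsilon> q) c)"
          by (rule Suc.IH[OF G'(2)[OF c] moderate_Ck_Suc_D[OF Suc.prems(2)]])
      qed
    qed
  qed
qed

section \<open>Ordinary differential equations on the unit interval\<close>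

text \<open>
  Differentiating \<open>|r|\<^sup>2\<close> instead of \<open>|r|\<close> avoids the zeros of \<open>r\<close>: from
  \<open>2 |r| \<eta> \<le> |r|\<^sup>2 + \<eta>\<^sup>2\<close> one gets \<open>(|r|\<^sup>2)' \<le> (2 L + 1) |r|\<^sup>2 + \<eta>\<^sup>2\<close>, a scalar linear inequality.
\<close>
lemma gronwall_unit_interval:
  fixes r :: "real \<Rightarrow> 'x::real_inner"
  assumes der: "\<And>s. s \<in> {0..1} \<Longrightarrow> (r has_vector_derivative r' s) (at s within {0..1})"
    and bd: "\<And>s. s \<in> {0..1} \<Longrightarrow> norm (r' s) \<le> L * norm (r s) + \<eta>"
    and "0 \<le> L" "0 \<le> \<eta>" "s \<in> {0..1}"
  shows "norm (r s) \<le> exp (L + 1) * (norm (r 0) + \<eta>)"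
proof -
  define M where "M = 2 * L + 1"
  define \<phi> where "\<phi> = (\<lambda>s. exp (- M * s) * (r s \<bullet> r s) - \<eta>\<^sup>2 * s)"
  define \<phi>' where "\<phi>' = (\<lambda>s. exp (- M * s) * (2 * (r s \<bullet> r' s) - M * (r s \<bullet> r s)) - \<eta>\<^sup>2)"
  have der\<phi>: "(\<phi> has_real_derivative \<phi>' t) (at t within {0..1})" if "t \<in> {0..1}" for t
  proof -
    have "((\<lambda>s. r s \<bullet> r s) has_real_derivative (r t \<bullet> r' t + r' t \<bullet> r t)) (at t within {0..1})"
      using bounded_bilinear.has_vector_derivative[OF bounded_bilinear_inner der[OF that] der[OF that]]
      by (simp add: has_real_derivative_iff_has_vector_derivative)
    then show ?thesis
      unfolding \<phi>_def \<phi>'_def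
      by (auto intro!: derivative_eq_intros simp: inner_commute algebra_simps)
  qed
  have "\<phi>' t \<le> 0" if t: "t \<in> {0..1}" for t
  proof -
    have "r t \<bullet> r' t \<le> norm (r t) * norm (r' t)" by (rule norm_cauchy_schwarz)
    also have "\<dots> \<le> norm (r t) * (L * norm (r t) + \<eta>)" by (intro mult_left_mono bd t) auto
    finally have "2 * (r t \<bullet> r' t) - M * (r t \<bullet> r t) \<le> 2 * norm (r t) * \<eta> - (norm (r t))\<^sup>2"
      by (simp add: M_def power2_norm_eq_inner[symmetric] algebra_simps power2_eq_square)
    also have "\<dots> \<le> \<eta>\<^sup>2" using zero_le_power2[of "norm (r t) - \<eta>"] by (simp add: power2_diff algebra_simps)
    finally have "exp (- M * t) * (2 * (r t \<bullet> r' t) - M * (r t \<bullet> r t)) \<le> exp (- M * t) * \<eta>\<^sup>2"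
      by (intro mult_left_mono) auto
    also have "\<dots> \<le> 1 * \<eta>\<^sup>2"
      using t assms(3) by (intro mult_right_mono) (auto simp: M_def intro!: mult_nonpos_nonneg)
    finally show ?thesis by (simp add: \<phi>'_def)
  qed
  moreover have "continuous_on {0..1} \<phi>"
    using der\<phi> by (meson DERIV_continuous continuous_on_eq_continuous_within)
  then have "continuous_on {0..s} \<phi>" by (rule continuous_on_subset) (use \<open>s \<in> {0..1}\<close> in auto)
  moreover have "(\<phi> has_real_derivative \<phi>' t) (at t)" if "0 < t" "t < s" for t
    using der\<phi>[of t] that \<open>s \<in> {0..1}\<close> by (simp add: at_within_Icc_at)
  ultimately have "\<exists>y. (\<phi> has_real_derivative y) (at t) \<and> y \<le> 0" if "0 < t" "t < s" for t
    using that \<open>s \<in> {0..1}\<close> by (metis atLeastAtMost_iff less_imp_le order_trans)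
  then have "\<phi> s \<le> \<phi> 0"
    using DERIV_nonpos_imp_decreasing_open[of 0 s \<phi>] \<open>s \<in> {0..1}\<close> \<open>continuous_on {0..s} \<phi>\<close> by simp
  then have *: "exp (- M * s) * (norm (r s))\<^sup>2 \<le> (norm (r 0))\<^sup>2 + \<eta>\<^sup>2 * s"
    by (simp add: \<phi>_def power2_norm_eq_inner)
  have "(norm (r s))\<^sup>2 = exp (M * s) * (exp (- M * s) * (norm (r s))\<^sup>2)"
    by (simp add: mult.assoc[symmetric] exp_add[symmetric])
  also have "\<dots> \<le> exp (M * s) * ((norm (r 0))\<^sup>2 + \<eta>\<^sup>2 * s)"
    by (intro mult_left_mono *) auto
  also have "\<dots> \<le> exp (2 * (L + 1)) * (norm (r 0) + \<eta>)\<^sup>2"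
  proof (intro mult_mono)
    have "M * s \<le> M * 1" using assms(3,5) by (intro mult_left_mono) (auto simp: M_def)
    also have "M * 1 \<le> 2 * (L + 1)" using assms(3) by (simp add: M_def)
    finally have "M * s \<le> 2 * (L + 1)" .
    then show "exp (M * s) \<le> exp (2 * (L + 1))" by simp
    have "\<eta>\<^sup>2 * s \<le> \<eta>\<^sup>2 * 1" using assms(5) by (intro mult_left_mono) auto
    moreover have "0 \<le> norm (r 0) * \<eta>" using assms(4) by simp
    ultimately show "(norm (r 0))\<^sup>2 + \<eta>\<^sup>2 * s \<le> (norm (r 0) + \<eta>)\<^sup>2" by (simp add: power2_sum)
  qed (use assms(5) in auto)
  also have "\<dots> = (exp (L + 1) * (norm (r 0) + \<eta>))\<^sup>2"
    unfolding exp_double power_mult_distrib ..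
  finally show ?thesis
    by (rule power2_le_imp_le) (use assms(4) in auto)
qed

lemma integral_exp_bound:
  fixes f :: "real \<Rightarrow> 'x::euclidean_space"
  assumes "K > 0" "0 \<le> c" "0 \<le> s" "continuous_on {0..s} f"
    and "\<And>t. t \<in> {0..s} \<Longrightarrow> norm (f t) \<le> c * exp (K * t)"
  shows "norm (integral {0..s} f) \<le> c / K * exp (K * s)"
proof -
  have "((\<lambda>t. c * exp (K * t)) has_integral (c / K * exp (K * s) - c / K * exp (K * 0))) {0..s}"
    by (rule fundamental_theorem_of_calculus)
      (use assms(1,3) in \<open>auto intro!: derivative_eq_intros simp: has_real_derivative_iff_has_vector_derivative[symmetric]\<close>)
  then have g: "(\<lambda>t. c * exp (K * t)) integrable_on {0..s}"
    "integral {0..s} (\<lambda>t. c * exp (K * t)) = c / K * exp (K * s) - c / K"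
    by (auto simp: has_integral_iff)
  have "norm (integral {0..s} f) \<le> integral {0..s} (\<lambda>t. c * exp (K * t))"
    by (rule Henstock_Kurzweil_Integration.integral_norm_bound_integral)
      (use assms g in \<open>auto intro!: integrable_continuous_real\<close>)
  then show ?thesis using g(2) assms(1,2) by (smt (verit) divide_nonneg_pos)
qed

lemma compact_continuous_norm_bounded:
  assumes "compact S" "continuous_on S f"
  obtains C where "C \<ge> 0" "\<And>x. x \<in> S \<Longrightarrow> norm (f x) \<le> C"
proof -
  have "bounded (f ` S)" using assms by (intro compact_imp_bounded compact_continuous_image)
  then obtain C where "\<And>x. x \<in> S \<Longrightarrow> norm (f x) \<le> C" by (auto simp: bounded_iff)
  then show ?thesis by (intro that[of "max 0 C"]) (auto simp: le_max_iff_disj)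
qed

text \<open>
  The weight \<open>e\<^bsup>-Ks\<^esup>\<close> makes the Picard operator a contraction on the whole interval.
\<close>
lemma picard_lindelof_unit_interval:
  fixes H :: "real \<times> 'x::euclidean_space \<Rightarrow> 'x"
  assumes cont: "continuous_on ({0..1} \<times> UNIV) H"
    and lip: "\<And>s x y. s \<in> {0..1} \<Longrightarrow> norm (H (s, x) - H (s, y)) \<le> L * norm (x - y)"
  obtains v where "v 0 = g"
    "\<And>s. s \<in> {0..1} \<Longrightarrow> (v has_vector_derivative H (s, v s)) (at s within {0..1})"
proof -
  define M where "M = \<bar>L\<bar> + 1"
  define K where "K = 2 * M"
  have M: "M > 0" "K > 0" by (auto simp: M_def K_def add_nonneg_pos)
  have lipM: "norm (H (s, x) - H (s, y)) \<le> M * norm (x - y)" if "s \<in> {0..1}" for s x y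
    by (rule order_trans[OF lip[OF that] mult_right_mono]) (auto simp: M_def)
  define I where "I = (\<lambda>(\<phi>::real \<Rightarrow>\<^sub>C 'x) s. integral {0..s} (\<lambda>t. H (t, exp (K * t) *\<^sub>R \<phi> t)))"
  have cH: "continuous_on {0..1} (\<lambda>t. H (t, exp (K * t) *\<^sub>R apply_bcontfun \<phi> t))" for \<phi>
    by (rule continuous_on_compose2[OF cont]) (auto intro!: continuous_intros)
  have I_der: "(I \<phi> has_vector_derivative H (s, exp (K * s) *\<^sub>R \<phi> s)) (at s within {0..1})"
    if "s \<in> {0..1}" for \<phi> s
    unfolding I_def by (rule integral_has_vector_derivative[OF cH that])
  define \<Psi> where "\<Psi> = (\<lambda>\<phi> s. exp (- K * s) *\<^sub>R (g + I \<phi> s))"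
  have cont\<Psi>: "continuous_on (cbox 0 1) (\<Psi> \<phi>)" for \<phi>
  proof -
    have "continuous_on {0..1} (I \<phi>)"
      using I_der by (meson has_vector_derivative_continuous continuous_on_eq_continuous_within)
    then show ?thesis unfolding \<Psi>_def by (auto intro!: continuous_intros)
  qed
  have "\<exists>h :: real \<Rightarrow>\<^sub>C 'x. \<forall>x. h x = \<Psi> \<phi> (clamp 0 1 x)" for \<phi>
    by (metis continuous_on_cbox_bcontfunE[OF cont\<Psi>])
  then obtain T where T: "\<And>\<phi> x. apply_bcontfun (T \<phi>) x = \<Psi> \<phi> (clamp 0 1 x)" by metis
  have "dist (T \<phi>) (T \<psi>) \<le> 1 / 2 * dist \<phi> \<psi>" for \<phi> \<psi>
  proof (rule dist_bound)
    fix x :: real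
    define s where "s = clamp 0 1 x"
    have s: "s \<in> {0..1}" using clamp_in_interval[of 0 1 x] by (simp add: s_def)
    have cH': "continuous_on {0..s} (\<lambda>t. H (t, exp (K * t) *\<^sub>R apply_bcontfun \<phi> t))" for \<phi>
      using cH by (rule continuous_on_subset) (use s in auto)
    have "norm (integral {0..s} (\<lambda>t. H (t, exp (K * t) *\<^sub>R \<phi> t) - H (t, exp (K * t) *\<^sub>R \<psi> t)))
        \<le> (M * dist \<phi> \<psi>) / K * exp (K * s)"
    proof (rule integral_exp_bound)
      fix t assume t: "t \<in> {0..s}"
      have "norm (H (t, exp (K * t) *\<^sub>R \<phi> t) - H (t, exp (K * t) *\<^sub>R \<psi> t))
          \<le> M * norm (exp (K * t) *\<^sub>R \<phi> t - exp (K * t) *\<^sub>R \<psi> t)"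
        by (rule lipM) (use t s in auto)
      also have "\<dots> = M * (exp (K * t) * dist (\<phi> t) (\<psi> t))"
        by (simp add: scaleR_diff_right[symmetric] dist_norm)
      also have "\<dots> \<le> M * (exp (K * t) * dist \<phi> \<psi>)"
        using M by (intro mult_left_mono dist_bounded) auto
      finally show "norm (H (t, exp (K * t) *\<^sub>R \<phi> t) - H (t, exp (K * t) *\<^sub>R \<psi> t))
          \<le> M * dist \<phi> \<psi> * exp (K * t)" by (simp add: mult_ac)
    qed (use M s cH' in \<open>auto intro!: continuous_intros\<close>)
    moreover have "I \<phi> s - I \<psi> s =
        integral {0..s} (\<lambda>t. H (t, exp (K * t) *\<^sub>R \<phi> t) - H (t, exp (K * t) *\<^sub>R \<psi> t))"
      unfolding I_def
      by (rule Henstock_Kurzweil_Integration.integral_diff[symmetric]; rule integrable_continuous_real[OF cH'])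
    ultimately have *: "norm (I \<phi> s - I \<psi> s) \<le> dist \<phi> \<psi> / 2 * exp (K * s)"
      using M by (simp add: K_def)
    have "dist (T \<phi> x) (T \<psi> x) = exp (- K * s) * norm (I \<phi> s - I \<psi> s)"
      unfolding T s_def[symmetric] by (simp add: \<Psi>_def dist_norm scaleR_diff_right[symmetric])
    also have "\<dots> \<le> exp (- K * s) * (dist \<phi> \<psi> / 2 * exp (K * s))"
      by (intro mult_left_mono *) auto
    also have "\<dots> = 1 / 2 * dist \<phi> \<psi>" by (simp add: exp_minus)
    finally show "dist (T \<phi> x) (T \<psi> x) \<le> 1 / 2 * dist \<phi> \<psi>" .
  qed
  then have "\<exists>!\<phi>. T \<phi> = \<phi>" by (intro banach_fix_type[where c = "1/2"]) auto
  then obtain \<phi> where \<phi>: "T \<phi> = \<phi>" by blast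
  have fixp: "exp (K * s) *\<^sub>R \<phi> s = g + I \<phi> s" if "s \<in> {0..1}" for s
  proof -
    have "\<phi> s = \<Psi> \<phi> (clamp 0 1 s)" using T[of \<phi> s] \<phi> by simp
    also have "clamp 0 1 s = s" using that by (simp add: clamp_cancel_cbox)
    finally show ?thesis by (simp add: \<Psi>_def exp_minus)
  qed
  show ?thesis
  proof (rule that[of "\<lambda>s. g + I \<phi> s"])
    show "g + I \<phi> 0 = g" by (simp add: I_def)
    show "((\<lambda>s. g + I \<phi> s) has_vector_derivative H (s, g + I \<phi> s)) (at s within {0..1})"
      if "s \<in> {0..1}" for s
      using I_der[OF that, of \<phi>] fixp[OF that] by (auto intro!: derivative_eq_intros)
  qed
qed

text \<open>
  The variational equations along a solution have this form; \<open>a c\<close> is the image of the basis vector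
  \<open>c\<close> under the linear coefficient.
\<close>
lemma linear_ode_exists:
  fixes a :: "'x::euclidean_space \<Rightarrow> real \<Rightarrow> 'x"
  assumes "\<And>c. c \<in> Basis \<Longrightarrow> continuous_on {0..1} (a c)" "continuous_on {0..1} b"
  obtains y where "y 0 = \<xi>" "\<And>s. s \<in> {0..1} \<Longrightarrow>
    (y has_vector_derivative (\<Sum>c\<in>Basis. (y s \<bullet> c) *\<^sub>R a c s) + b s) (at s within {0..1})"
proof -
  define H where "H = (\<lambda>(s, x). (\<Sum>c\<in>Basis. (x \<bullet> c) *\<^sub>R a c s) + b s)"
  have "\<exists>C\<ge>0. \<forall>s\<in>{0..1}. norm (a c s) \<le> C" if "c \<in> Basis" for c
    by (metis compact_continuous_norm_bounded[OF compact_Icc assms(1)[OF that]])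
  then obtain C where C: "\<And>c. c \<in> Basis \<Longrightarrow> C c \<ge> 0" "\<And>c s. c \<in> Basis \<Longrightarrow> s \<in> {0..1} \<Longrightarrow> norm (a c s) \<le> C c"
    by metis
  have cont: "continuous_on ({0..1} \<times> UNIV) H"
    unfolding H_def split_beta
    by (intro continuous_intros continuous_on_compose2[OF assms(1)] continuous_on_compose2[OF assms(2)]) auto
  have lip: "norm (H (s, x) - H (s, y)) \<le> (\<Sum>c\<in>Basis. C c) * norm (x - y)" if s: "s \<in> {0..1}" for s x y
  proof -
    have "H (s, x) - H (s, y) = (\<Sum>c\<in>Basis. ((x - y) \<bullet> c) *\<^sub>R a c s)"
      by (simp add: H_def sum_subtractf[symmetric] inner_diff_left scaleR_diff_left)
    also have "norm \<dots> \<le> (\<Sum>c\<in>Basis. C c * norm (x - y))"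
      by (rule sum_norm_le) (use C s in \<open>auto intro!: mult_mono simp: mult.commute[of "C _"] Basis_le_norm\<close>)
    finally show ?thesis by (simp add: sum_distrib_right)
  qed
  show ?thesis
  proof (rule picard_lindelof_unit_interval[OF cont lip, where g = \<xi>])
    fix y assume "y 0 = \<xi>" "\<And>s. s \<in> {0..1} \<Longrightarrow> (y has_vector_derivative H (s, y s)) (at s within {0..1})"
    then show thesis by (intro that[of y]) (simp_all add: H_def)
  qed
qed

text \<open>
  A solution cannot leave a ball if its speed is too small to reach the boundary in unit time.
  The equation is first extended to the whole space through the nearest point projection.
\<close>
lemma ode_solution_in_ball:
  fixes H :: "real \<times> 'x::euclidean_space \<Rightarrow> 'x"
  assumes cont: "continuous_on ({0..1} \<times> cball c R) H"
    and lip: "\<And>s x y. s \<in> {0..1} \<Longrightarrow> x \<in> cball c R \<Longrightarrow> y \<in> cball c R \<Longrightarrow> norm (H (s, x) - H (s, y)) \<le> L * norm (x - y)"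
    and bd: "\<And>s x. s \<in> {0..1} \<Longrightarrow> x \<in> cball c R \<Longrightarrow> norm (H (s, x)) \<le> M"
    and "dist c g + M \<le> R" "M \<ge> 0"
  obtains v where "v 0 = g" "\<And>s. s \<in> {0..1} \<Longrightarrow> v s \<in> cball c R"
    "\<And>s. s \<in> {0..1} \<Longrightarrow> (v has_vector_derivative H (s, v s)) (at s within {0..1})"
proof -
  have "c \<in> cball c R" using assms(4,5) zero_le_dist[of c g] by (simp del: zero_le_dist)
  then have ne: "cball c R \<noteq> {}" by blast
  define \<pi> where "\<pi> = closest_point (cball c R)"
  have \<pi>_in: "\<pi> x \<in> cball c R" for x unfolding \<pi>_def by (rule closest_point_in_set[OF closed_cball ne])
  have c_ext: "continuous_on ({0..1} \<times> UNIV) (\<lambda>q. H (fst q, \<pi> (snd q)))"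
  proof (rule continuous_on_compose2[OF cont])
    show "continuous_on ({0..1} \<times> UNIV) (\<lambda>q. (fst q, \<pi> (snd q)))"
      unfolding \<pi>_def
      by (intro continuous_intros continuous_on_compose2[OF continuous_on_closest_point[OF convex_cball closed_cball ne]]) auto
  qed (use \<pi>_in in auto)
  have l_ext: "norm (H (fst (s, x), \<pi> (snd (s, x))) - H (fst (s, y), \<pi> (snd (s, y)))) \<le> \<bar>L\<bar> * norm (x - y)"
    if "s \<in> {0..1}" for s x y
  proof -
    have "norm (H (s, \<pi> x) - H (s, \<pi> y)) \<le> L * norm (\<pi> x - \<pi> y)" by (rule lip[OF that \<pi>_in \<pi>_in])
    also have "\<dots> \<le> \<bar>L\<bar> * norm (\<pi> x - \<pi> y)" by (intro mult_right_mono) auto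
    also have "\<dots> \<le> \<bar>L\<bar> * norm (x - y)"
      using closest_point_lipschitz[OF convex_cball closed_cball ne] by (intro mult_left_mono) (auto simp: \<pi>_def dist_norm)
    finally show ?thesis by simp
  qed
  show ?thesis
  proof (rule picard_lindelof_unit_interval[OF c_ext l_ext, where g = g])
    fix v assume v: "v 0 = g" "\<And>s. s \<in> {0..1} \<Longrightarrow>
      (v has_vector_derivative H (fst (s, v s), \<pi> (snd (s, v s)))) (at s within {0..1})"
    have v_in: "v s \<in> cball c R" if s: "s \<in> {0..1}" for s
    proof -
      have "norm (v s - v 0) \<le> M * norm (s - 0)"
      proof (rule differentiable_bound[OF convex_real_interval(5)])
        fix t :: real assume t: "t \<in> {0..1}"
        show "(v has_derivative (\<lambda>h. h *\<^sub>R H (t, \<pi> (v t)))) (at t within {0..1})"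
          using v(2)[OF t] by (simp add: has_vector_derivative_def)
        show "onorm (\<lambda>h. h *\<^sub>R H (t, \<pi> (v t))) \<le> M"
          by (rule onorm_le) (simp add: mult.commute[of M] mult_left_mono bd[OF t \<pi>_in])
      qed (use s in auto)
      also have "\<dots> \<le> M" using s assms(5) mult_left_mono[of s 1 M] by simp
      finally have "dist g (v s) \<le> M" using v(1) by (simp add: dist_norm norm_minus_commute)
      then show ?thesis using dist_triangle[of c "v s" g] assms(4) by simp
    qed
    then have "\<pi> (v s) = v s" if "s \<in> {0..1}" for s
      unfolding \<pi>_def using that by (intro closest_point_self)
    then show thesis using v v_in by (intro that[of v]) auto
  qed
qed

text \<open>
  Gronwall's inequality for the difference of the solutions at \<open>z'\<close> and at \<open>z\<close>: the defect
  \<open>H(s, v(s,z), z') - H(s, v(s,z), z)\<close> tends to \<open>0\<close> as \<open>z' \<rightarrow> z\<close>, uniformly in \<open>s\<close>, by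
  compactness of \<open>[0, 1]\<close>.
\<close>
lemma ode_continuous_dependence:
  fixes H :: "real \<times> 'x::euclidean_space \<times> 'z::euclidean_space \<Rightarrow> 'x" and v :: "real \<times> 'z \<Rightarrow> 'x"
  assumes "open Z" and cont: "continuous_on ({0..1} \<times> D \<times> Z) H"
    and v: "\<And>s z. s \<in> {0..1} \<Longrightarrow> z \<in> Z \<Longrightarrow> v (s, z) \<in> D"
      "\<And>s z. s \<in> {0..1} \<Longrightarrow> z \<in> Z \<Longrightarrow>
         ((\<lambda>s. v (s, z)) has_vector_derivative H (s, v (s, z), z)) (at s within {0..1})"
    and init: "continuous_on Z (\<lambda>z. v (0, z))"
    and lip: "\<And>z. z \<in> Z \<Longrightarrow> \<exists>\<delta>>0. \<exists>L. \<forall>z'\<in>ball z \<delta> \<inter> Z. \<forall>s\<in>{0..1}. \<forall>x\<in>D. \<forall>y\<in>D.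
       norm (H (s, x, z') - H (s, y, z')) \<le> L * norm (x - y)"
  shows "continuous_on ({0..1} \<times> Z) v"
proof -
  have unif: "\<exists>\<delta>>0. \<forall>z'\<in>ball z \<delta>. \<forall>s\<in>{0..1}. dist (v (s, z')) (v (s, z)) < e"
    if z: "z \<in> Z" and e: "e > 0" for z e
  proof -
    obtain \<delta>1 L where \<delta>1: "\<delta>1 > 0" and L: "\<And>z' s x y. z' \<in> ball z \<delta>1 \<inter> Z \<Longrightarrow> s \<in> {0..1} \<Longrightarrow> x \<in> D \<Longrightarrow> y \<in> D
       \<Longrightarrow> norm (H (s, x, z') - H (s, y, z')) \<le> L * norm (x - y)"
      using lip[OF z] by metis
    define E where "E = exp (\<bar>L\<bar> + 1)"
    have E: "E > 0" by (simp add: E_def)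
    have cv: "continuous_on {0..1} (\<lambda>s. v (s, z))"
      using v(2) z by (meson has_vector_derivative_continuous continuous_on_eq_continuous_within)
    have cHz: "continuous_on (Z \<times> {0..1}) (\<lambda>q. H (snd q, v (snd q, z), fst q))"
      by (rule continuous_on_compose2[OF cont])
        (use v(1) z in \<open>auto intro!: continuous_intros continuous_on_compose2[OF cv]\<close>)
    have pos: "e / (4 * E) > 0" using e E by simp
    obtain X0 where X0: "z \<in> X0" "open X0" "\<forall>z'\<in>X0 \<inter> Z. \<forall>s\<in>{0..1}.
        dist (H (snd (z', s), v (snd (z', s), z), fst (z', s)))
             (H (snd (z, s), v (snd (z, s), z), fst (z, s))) \<le> e / (4 * E)"
      by (rule continuous_on_prod_compactE[OF cHz compact_Icc z pos])
    then have X0': "\<And>z' s. z' \<in> X0 \<inter> Z \<Longrightarrow> s \<in> {0..1} \<Longrightarrow>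
        dist (H (s, v (s, z), z')) (H (s, v (s, z), z)) \<le> e / (4 * E)"
      by simp
    obtain \<delta>2 where \<delta>2: "\<delta>2 > 0" "ball z \<delta>2 \<subseteq> X0 \<inter> Z"
      using open_Int[OF X0(2) \<open>open Z\<close>] X0(1) z openE by blast
    obtain \<delta>3 where \<delta>3: "\<delta>3 > 0" "\<And>z'. z' \<in> Z \<Longrightarrow> dist z' z < \<delta>3 \<Longrightarrow> dist (v (0, z')) (v (0, z)) < e / (4 * E)"
      using init z e E unfolding continuous_on_iff by (metis pos)
    define \<delta> where "\<delta> = min \<delta>1 (min \<delta>2 \<delta>3)"
    have "dist (v (s, z')) (v (s, z)) < e" if z': "z' \<in> ball z \<delta>" and s: "s \<in> {0..1}" for z' s
    proof -
      have zZ: "z' \<in> X0 \<inter> Z" "z' \<in> ball z \<delta>1 \<inter> Z" "dist z' z < \<delta>3"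
        using z' \<delta>2 by (auto simp: \<delta>_def dist_commute)
      define r where "r = (\<lambda>s. v (s, z') - v (s, z))"
      have "norm (r s) \<le> exp (\<bar>L\<bar> + 1) * (norm (r 0) + e / (4 * E))"
      proof (rule gronwall_unit_interval[where r' = "\<lambda>s. H (s, v (s, z'), z') - H (s, v (s, z), z)"])
        fix s :: real assume s: "s \<in> {0..1}"
        show "(r has_vector_derivative H (s, v (s, z'), z') - H (s, v (s, z), z)) (at s within {0..1})"
          unfolding r_def using v(2) s z zZ by (auto intro!: has_vector_derivative_diff)
        have "norm (H (s, v (s, z'), z') - H (s, v (s, z), z')) \<le> L * norm (r s)"
          unfolding r_def using zZ s v(1) z by (intro L) auto
        also have "\<dots> \<le> \<bar>L\<bar> * norm (r s)" by (intro mult_right_mono) auto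
        finally have "norm (H (s, v (s, z'), z') - H (s, v (s, z), z')) \<le> \<bar>L\<bar> * norm (r s)" .
        moreover have "norm (H (s, v (s, z), z') - H (s, v (s, z), z)) \<le> e / (4 * E)"
          using X0'[OF zZ(1) s] by (simp add: dist_norm)
        ultimately show "norm (H (s, v (s, z'), z') - H (s, v (s, z), z)) \<le> \<bar>L\<bar> * norm (r s) + e / (4 * E)"
          by (rule norm_diff_triangle_le)
      qed (use s e E in auto)
      also have "\<dots> \<le> E * (e / (4 * E) + e / (4 * E))"
        unfolding E_def[symmetric] using \<delta>3(2)[of z'] zZ E
        by (intro mult_left_mono add_right_mono) (auto simp: r_def dist_norm)
      also have "\<dots> < e" using E e by (simp add: field_simps)
      finally show ?thesis by (simp add: r_def dist_norm)
    qed
    then show ?thesis using \<delta>1 \<delta>2 \<delta>3 by (intro exI[of _ \<delta>]) (auto simp: \<delta>_def)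
  qed
  show ?thesis
    unfolding continuous_on_iff
  proof (intro ballI allI impI)
    fix q :: "real \<times> 'z" and e :: real assume q: "q \<in> {0..1} \<times> Z" and e: "e > 0"
    obtain s z where [simp]: "q = (s, z)" by force
    have s: "s \<in> {0..1}" and z: "z \<in> Z" using q by auto
    obtain \<delta>1 where \<delta>1: "\<delta>1 > 0" "\<And>z' s. z' \<in> ball z \<delta>1 \<Longrightarrow> s \<in> {0..1} \<Longrightarrow> dist (v (s, z')) (v (s, z)) < e / 2"
      using unif[OF z, of "e/2"] e by auto
    have "continuous_on {0..1} (\<lambda>s. v (s, z))"
      using v(2) z by (meson has_vector_derivative_continuous continuous_on_eq_continuous_within)
    then obtain \<delta>2 where \<delta>2: "\<delta>2 > 0" "\<And>s'. s' \<in> {0..1} \<Longrightarrow> dist s' s < \<delta>2 \<Longrightarrow> dist (v (s', z)) (v (s, z)) < e / 2"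
      using s e unfolding continuous_on_iff by (metis half_gt_zero)
    have "dist (v q') (v q) < e" if q': "q' \<in> {0..1} \<times> Z" "dist q' q < min \<delta>1 \<delta>2" for q'
    proof -
      obtain s' z' where [simp]: "q' = (s', z')" by force
      have "dist s' s \<le> dist q' q" "dist z' z \<le> dist q' q"
        using dist_fst_le[of q' q] dist_snd_le[of q' q] by auto
      then have "dist (v (s', z')) (v (s', z)) < e / 2" "dist (v (s', z)) (v (s, z)) < e / 2"
        using q' \<delta>1(2)[of z' s'] \<delta>2(2)[of s'] by (auto simp: dist_commute)
      then show ?thesis
        using dist_triangle[of "v (s', z')" "v (s, z)" "v (s', z)"] by simp
    qed
    then show "\<exists>d>0. \<forall>x'\<in>{0..1} \<times> Z. dist x' q < d \<longrightarrow> dist (v x') (v q) < e"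
      using \<delta>1 \<delta>2 by (intro exI[of _ "min \<delta>1 \<delta>2"]) auto
  qed
qed

section \<open>Differentiable dependence on parameters\<close>

lemma le_sum_abs:
  fixes f :: "'i \<Rightarrow> real"
  assumes "finite S" "i \<in> S"
  shows "f i \<le> (\<Sum>j\<in>S. \<bar>f j\<bar>)"
  using abs_ge_self[of "f i"] member_le_sum[of i S "\<lambda>j. \<bar>f j\<bar>"] assms by simp

lemma linear_norm_le_Basis_sum:
  fixes f :: "'a::euclidean_space \<Rightarrow> 'b::real_normed_vector"
  assumes "linear f" "\<And>b. b \<in> Basis \<Longrightarrow> norm (f b) \<le> C"
  shows "norm (f x) \<le> real DIM('a) * C * norm x"
proof -
  interpret linear f by fact
  have "f x = f (\<Sum>b\<in>Basis. (x \<bullet> b) *\<^sub>R b)" by (simp add: euclidean_representation)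
  also have "\<dots> = (\<Sum>b\<in>Basis. (x \<bullet> b) *\<^sub>R f b)" by (simp add: sum scaleR)
  also have "norm \<dots> \<le> (\<Sum>b\<in>(Basis::'a set). norm x * C)"
    by (rule sum_norm_le) (auto intro!: mult_mono assms simp: Basis_le_norm)
  finally show ?thesis by (simp add: mult_ac)
qed

lemma lipschitz_by_partial_derivatives:
  fixes f :: "'a::euclidean_space \<Rightarrow> 'b::real_normed_vector"
  assumes "convex S" "\<And>x. x \<in> S \<Longrightarrow> (f has_derivative f' x) (at x)"
    and "\<And>x c. x \<in> S \<Longrightarrow> c \<in> Basis \<Longrightarrow> norm (f' x c) \<le> C"
    and "x \<in> S" "y \<in> S"
  shows "norm (f x - f y) \<le> real DIM('a) * C * norm (x - y)"
proof (rule differentiable_bound[OF assms(1) _ _ assms(4,5)])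
  fix x assume x: "x \<in> S"
  show "(f has_derivative f' x) (at x within S)" using assms(2)[OF x] by (rule has_derivative_at_withinI)
  show "onorm (f' x) \<le> real DIM('a) * C"
    by (rule onorm_le, rule linear_norm_le_Basis_sum)
      (use assms x in \<open>auto intro: bounded_linear.linear has_derivative_bounded_linear\<close>)
qed

text \<open>
  Compactness bounds the partial derivatives, and convexity turns this into a Lipschitz constant.
\<close>
lemma lipschitz_first_slot:
  fixes H :: "real \<times> 'x::euclidean_space \<times> 'z::euclidean_space \<Rightarrow> 'b::real_normed_vector"
  assumes "compact D" "convex D" "compact K"
    and der: "\<And>s q. s \<in> {0..1} \<Longrightarrow> q \<in> D \<times> K \<Longrightarrow> ((\<lambda>q. H (s, q)) has_derivative H' (s, q)) (at q)"
    and cont: "\<And>b. b \<in> Basis \<Longrightarrow> continuous_on ({0..1} \<times> D \<times> K) (\<lambda>q. H' q b)"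
  obtains L where "\<And>s z x y. s \<in> {0..1} \<Longrightarrow> z \<in> K \<Longrightarrow> x \<in> D \<Longrightarrow> y \<in> D \<Longrightarrow>
    norm (H (s, x, z) - H (s, y, z)) \<le> L * norm (x - y)"
proof -
  have "\<exists>C. \<forall>q\<in>{0..1} \<times> D \<times> K. norm (H' q (c, 0)) \<le> C" if "c \<in> Basis" for c
  proof -
    have "continuous_on ({0..1} \<times> D \<times> K) (\<lambda>q. H' q (c, 0))"
      by (rule cont) (use that in \<open>simp add: Basis_prod_def\<close>)
    then show ?thesis
      by (metis compact_continuous_norm_bounded compact_Times compact_Icc assms(1,3))
  qed
  then obtain C where C: "\<And>c q. c \<in> Basis \<Longrightarrow> q \<in> {0..1} \<times> D \<times> K \<Longrightarrow> norm (H' q (c, 0)) \<le> C c"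
    by metis
  define C' where "C' = (\<Sum>c\<in>Basis. \<bar>C c\<bar>)"
  have "norm (H (s, x, z) - H (s, y, z)) \<le> real DIM('x) * C' * norm (x - y)"
    if "s \<in> {0..1}" "z \<in> K" "x \<in> D" "y \<in> D" for s z x y
  proof (rule lipschitz_by_partial_derivatives[OF assms(2) _ _ that(3,4)])
    fix x assume x: "x \<in> D"
    show "((\<lambda>x. H (s, x, z)) has_derivative (\<lambda>h. H' (s, x, z) (h, 0))) (at x)"
      by (rule has_derivative_compose[OF has_derivative_Pair[OF has_derivative_ident has_derivative_const]
            der[OF that(1)]]) (use x that(2) in auto)
    fix c :: 'x assume c: "c \<in> Basis"
    have "norm (H' (s, x, z) (c, 0)) \<le> C c" using C[OF c] x that by auto
    also have "\<dots> \<le> C'" unfolding C'_def by (rule le_sum_abs[OF finite_Basis c])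
    finally show "norm (H' (s, x, z) (c, 0)) \<le> C'" .
  qed
  then show ?thesis by (rule that)
qed

lemma continuous_on_linear_family:
  fixes f' :: "'q::topological_space \<Rightarrow> 'a::euclidean_space \<Rightarrow> 'b::real_normed_vector"
  assumes "\<And>q. q \<in> S \<Longrightarrow> linear (f' q)" "\<And>b. b \<in> Basis \<Longrightarrow> continuous_on S (\<lambda>q. f' q b)"
  shows "continuous_on S (\<lambda>q. f' q h)"
proof -
  have "continuous_on S (\<lambda>q. \<Sum>b\<in>Basis. (h \<bullet> b) *\<^sub>R f' q b)"
    by (intro continuous_intros assms(2))
  moreover have "(\<Sum>b\<in>Basis. (h \<bullet> b) *\<^sub>R f' q b) = f' q h" if "q \<in> S" for q
  proof -
    interpret linear "f' q" by (rule assms(1)[OF that])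
    have "f' q h = f' q (\<Sum>b\<in>Basis. (h \<bullet> b) *\<^sub>R b)" by (simp add: euclidean_representation)
    then show ?thesis by (simp only: sum scaleR)
  qed
  ultimately show ?thesis by (rule continuous_on_eq)
qed

text \<open>
  Differentiability of \<open>H s\<close> at the points \<open>c s\<close> of a compact curve is uniform in \<open>s\<close>: the
  derivative is uniformly continuous near the curve, and the mean value theorem transfers this to
  the remainder.
\<close>
lemma uniformly_differentiable_along_curve:
  fixes H :: "real \<times> 'a::euclidean_space \<Rightarrow> 'x::real_normed_vector" and c :: "real \<Rightarrow> 'a"
  assumes "open W" and c: "continuous_on {0..1} c" "\<And>s. s \<in> {0..1} \<Longrightarrow> c s \<in> W"
    and der: "\<And>s q. s \<in> {0..1} \<Longrightarrow> q \<in> W \<Longrightarrow> ((\<lambda>q. H (s, q)) has_derivative H' (s, q)) (at q)"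
    and cont: "\<And>b. b \<in> Basis \<Longrightarrow> continuous_on ({0..1} \<times> W) (\<lambda>q. H' q b)"
    and "\<eta> > 0"
  obtains \<delta> where "\<delta> > 0"
    "\<And>s q. s \<in> {0..1} \<Longrightarrow> norm (q - c s) < \<delta> \<Longrightarrow>
       norm (H (s, q) - H (s, c s) - H' (s, c s) (q - c s)) \<le> \<eta> * norm (q - c s)"
proof -
  have "compact (c ` {0..1})" "c ` {0..1} \<subseteq> W" using c by (auto intro: compact_continuous_image)
  then obtain \<rho> where \<rho>: "\<rho> > 0" "(\<Union>x\<in>c ` {0..1}. ball x \<rho>) \<subseteq> W"
    using compact_subset_open_imp_ball_epsilon_subset[OF _ \<open>open W\<close>] by metis
  have inW: "c s + d \<in> W" if "s \<in> {0..1}" "norm d < \<rho>" for s d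
    using \<rho>(2) that by (force simp: dist_norm)
  define \<eta>' where "\<eta>' = \<eta> / real DIM('a)"
  have \<eta>': "\<eta>' > 0" using \<open>\<eta> > 0\<close> by (simp add: \<eta>'_def)
  have "\<exists>\<delta>>0. \<forall>d. norm d < \<delta> \<longrightarrow> (\<forall>s\<in>{0..1}. norm (H' (s, c s + d) b - H' (s, c s) b) \<le> \<eta>')"
    if b: "b \<in> Basis" for b
  proof -
    have "continuous_on (ball 0 \<rho> \<times> {0..1}) (\<lambda>q. H' (snd q, c (snd q) + fst q) b)"
      by (rule continuous_on_compose2[OF cont[OF b]])
        (use inW in \<open>auto intro!: continuous_intros continuous_on_compose2[OF c(1)]\<close>)
    moreover have "(0::'a) \<in> ball 0 \<rho>" using \<rho> by simp
    ultimately obtain X0 where X0: "(0::'a) \<in> X0" "open X0" "\<forall>d\<in>X0 \<inter> ball 0 \<rho>. \<forall>s\<in>{0..1}.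
        dist (H' (snd (d, s), c (snd (d, s)) + fst (d, s)) b)
             (H' (snd (0::'a, s), c (snd (0::'a, s)) + fst (0, s)) b) \<le> \<eta>'"
      by (rule continuous_on_prod_compactE[OF _ compact_Icc _ \<eta>'])
    obtain \<delta> where \<delta>: "\<delta> > 0" "ball 0 \<delta> \<subseteq> X0" using X0 openE by blast
    have "norm (H' (s, c s + d) b - H' (s, c s) b) \<le> \<eta>'" if "norm d < min \<delta> \<rho>" "s \<in> {0..1}" for d s
    proof -
      have "d \<in> X0 \<inter> ball 0 \<rho>" using \<delta>(2) that by auto
      then show ?thesis using X0(3) that(2) by (fastforce simp: dist_norm)
    qed
    then show ?thesis using \<delta> \<rho> by (intro exI[of _ "min \<delta> \<rho>"]) auto
  qed
  then obtain \<delta> where \<delta>: "\<And>b. b \<in> Basis \<Longrightarrow> \<delta> b > 0"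
    "\<And>b d s. b \<in> Basis \<Longrightarrow> norm d < \<delta> b \<Longrightarrow> s \<in> {0..1} \<Longrightarrow> norm (H' (s, c s + d) b - H' (s, c s) b) \<le> \<eta>'"
    by metis
  define \<delta>' where "\<delta>' = min \<rho> (Min (\<delta> ` Basis))"
  have \<delta>': "\<delta>' > 0" using \<delta>(1) \<rho>(1) by (simp add: \<delta>'_def)
  have \<delta>'_le: "\<delta>' \<le> \<delta> b" if "b \<in> Basis" for b
    unfolding \<delta>'_def by (rule min.coboundedI2) (use that in auto)
  show ?thesis
  proof (rule that[OF \<delta>'])
    fix s q assume s: "s \<in> {0..1::real}" and q: "norm (q - c s) < \<delta>'"
    define f where "f = (\<lambda>q. H (s, q) - H' (s, c s) q)"
    define f' where "f' = (\<lambda>q h. H' (s, q) h - H' (s, c s) h)"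
    have lin: "bounded_linear (H' (s, q))" if "q \<in> W" for q
      using der[OF s that] by (rule has_derivative_bounded_linear)
    have ballW: "y \<in> W" if "y \<in> ball (c s) \<delta>'" for y
      using inW[OF s, of "y - c s"] that by (auto simp: \<delta>'_def dist_norm norm_minus_commute)
    have "norm (f q - f (c s)) \<le> \<eta> * norm (q - c s)"
    proof (rule differentiable_bound)
      show "convex (ball (c s) \<delta>')" by simp
      fix y assume y: "y \<in> ball (c s) \<delta>'"
      show "(f has_derivative f' y) (at y within ball (c s) \<delta>')"
        unfolding f_def f'_def
        by (intro has_derivative_diff bounded_linear_imp_has_derivative lin c s
            has_derivative_at_withinI[OF der[OF s ballW[OF y]]])
      have lf: "linear (f' y)"
        unfolding f'_def using lin[OF ballW[OF y]] lin[OF c(2)[OF s]]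
        by (intro bounded_linear.linear bounded_linear_sub)
      have "norm (f' y h) \<le> real DIM('a) * \<eta>' * norm h" for h
      proof (rule linear_norm_le_Basis_sum[OF lf])
        fix b :: 'a assume b: "b \<in> Basis"
        have "norm (y - c s) < \<delta> b" using y \<delta>'_le[OF b] by (auto simp: dist_norm norm_minus_commute)
        from \<delta>(2)[OF b this s] show "norm (f' y b) \<le> \<eta>'" by (simp add: f'_def)
      qed
      then show "onorm (f' y) \<le> \<eta>" by (intro onorm_le) (simp add: \<eta>'_def)
    qed (use q \<delta>' in \<open>auto simp: dist_norm norm_minus_commute\<close>)
    also have "f q - f (c s) = H (s, q) - H (s, c s) - H' (s, c s) (q - c s)"
      using bounded_linear.linear[OF lin[OF c(2)[OF s]]] by (simp add: f_def linear_diff)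
    finally show "norm (H (s, q) - H (s, c s) - H' (s, c s) (q - c s)) \<le> \<eta> * norm (q - c s)" .
  qed
qed

text \<open>
  Differentiable dependence on parameters. The derivative of the solution solves the variational
  equation; it suffices to have solutions \<open>y\<close> of the latter for the coordinate directions. By
  Gronwall's inequality, the difference quotient of the solution is first bounded and then
  close to \<open>y\<close>.
\<close>
lemma ode_differentiable_dependence:
  fixes H :: "real \<times> 'x::euclidean_space \<times> 'z::euclidean_space \<Rightarrow> 'x" and v :: "real \<times> 'z \<Rightarrow> 'x"
  assumes "open D" "open Z"
    and der: "\<And>s q. s \<in> {0..1} \<Longrightarrow> q \<in> D \<times> Z \<Longrightarrow> ((\<lambda>q. H (s, q)) has_derivative H' (s, q)) (at q)"
    and cont: "\<And>b. b \<in> Basis \<Longrightarrow> continuous_on ({0..1} \<times> D \<times> Z) (\<lambda>q. H' q b)"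
    and v: "\<And>s z. s \<in> {0..1} \<Longrightarrow> z \<in> Z \<Longrightarrow> v (s, z) \<in> D"
      "\<And>s z. s \<in> {0..1} \<Longrightarrow> z \<in> Z \<Longrightarrow>
         ((\<lambda>s. v (s, z)) has_vector_derivative H (s, v (s, z), z)) (at s within {0..1})"
      "continuous_on ({0..1} \<times> Z) v"
    and init: "\<And>z. z \<in> Z \<Longrightarrow> ((\<lambda>z. v (0, z)) has_derivative g' z) (at z)"
    and y: "\<And>z b. z \<in> Z \<Longrightarrow> b \<in> Basis \<Longrightarrow> y (0, z) b = g' z b"
      "\<And>s z b. s \<in> {0..1} \<Longrightarrow> z \<in> Z \<Longrightarrow> b \<in> Basis \<Longrightarrow>
         ((\<lambda>s. y (s, z) b) has_vector_derivative H' (s, v (s, z), z) (y (s, z) b, b)) (at s within {0..1})"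
    and s: "s \<in> {0..1}" and z: "z \<in> Z"
  shows "((\<lambda>z. v (s, z)) has_derivative (\<lambda>h. \<Sum>b\<in>Basis. (h \<bullet> b) *\<^sub>R y (s, z) b)) (at z)"
proof -
  define Y where "Y = (\<lambda>s h. \<Sum>b\<in>Basis. (h \<bullet> b) *\<^sub>R y (s, z) b)"
  define c where "c = (\<lambda>s. (v (s, z), z))"
  have c: "continuous_on {0..1} c" "\<And>s. s \<in> {0..1} \<Longrightarrow> c s \<in> D \<times> Z"
    unfolding c_def using z v(1) by (auto intro!: continuous_intros continuous_on_compose2[OF v(3)])
  note unif = uniformly_differentiable_along_curve[OF open_Times[OF \<open>open D\<close> \<open>open Z\<close>] c der cont]
  have lin: "bounded_linear (H' (s, c s))" if "s \<in> {0..1}" for s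
    using der[OF that c(2)[OF that]] by (rule has_derivative_bounded_linear)
  have Y0: "Y 0 h = g' z h" for h
  proof -
    interpret g': bounded_linear "g' z" using init[OF z] by (rule has_derivative_bounded_linear)
    have "g' z h = g' z (\<Sum>b\<in>Basis. (h \<bullet> b) *\<^sub>R b)" by (simp add: euclidean_representation)
    then show ?thesis using y(1)[OF z] by (simp add: Y_def g'.sum g'.scaleR)
  qed
  have Y_der: "((\<lambda>s. Y s h) has_vector_derivative H' (s, c s) (Y s h, h)) (at s within {0..1})"
    if s: "s \<in> {0..1}" for s h
  proof -
    interpret H': bounded_linear "H' (s, c s)" by (rule lin[OF s])
    have "(Y s h, h) = (\<Sum>b\<in>Basis. (h \<bullet> b) *\<^sub>R (y (s, z) b, b))"
      unfolding Y_def by (simp add: prod_eq_iff fst_sum snd_sum euclidean_representation)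
    then have "H' (s, c s) (Y s h, h) = (\<Sum>b\<in>Basis. (h \<bullet> b) *\<^sub>R H' (s, c s) (y (s, z) b, b))"
      by (simp only: H'.sum H'.scaleR)
    moreover have "((\<lambda>s. Y s h) has_vector_derivative
        (\<Sum>b\<in>Basis. (h \<bullet> b) *\<^sub>R H' (s, c s) (y (s, z) b, b))) (at s within {0..1})"
      unfolding Y_def c_def
      by (intro has_vector_derivative_sum bounded_linear.has_vector_derivative[OF bounded_linear_scaleR_right] y(2) s z)
    ultimately show ?thesis by simp
  qed
  obtain L where L: "L \<ge> 0" "\<And>s h. s \<in> {0..1} \<Longrightarrow> norm (H' (s, c s) h) \<le> L * norm h"
  proof -
    have "\<exists>C. \<forall>s\<in>{0..1}. norm (H' (s, c s) b) \<le> C" if b: "b \<in> Basis" for b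
    proof -
      have "(\<lambda>s. (s, c s)) ` {0..1} \<subseteq> {0..1} \<times> D \<times> Z"
        by (intro image_subsetI SigmaI c(2))
      then have "continuous_on {0..1} (\<lambda>s. H' (s, c s) b)"
        by (intro continuous_on_compose2[OF cont[OF b]] continuous_intros c(1))
      then have "compact ((\<lambda>s. H' (s, c s) b) ` {0..1})" by (rule compact_continuous_image) simp
      then show ?thesis by (auto dest!: compact_imp_bounded simp: bounded_iff)
    qed
    then obtain C where C: "\<And>b s. b \<in> Basis \<Longrightarrow> s \<in> {0..1} \<Longrightarrow> norm (H' (s, c s) b) \<le> C b" by metis
    define C' where "C' = (\<Sum>b\<in>Basis. \<bar>C b\<bar>)"
    have "C b \<le> C'" if "b \<in> Basis" for b
      unfolding C'_def by (rule le_sum_abs[OF finite_Basis that])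
    then have "norm (H' (s, c s) h) \<le> real DIM('x \<times> 'z) * C' * norm h" if "s \<in> {0..1}" for s h
      using linear_norm_le_Basis_sum[OF bounded_linear.linear[OF lin[OF that]]] C that
      by (meson order_trans)
    then show ?thesis
      by (intro that[of "real DIM('x \<times> 'z) * C'"]) (auto simp: C'_def sum_nonneg)
  qed
  define E where "E = exp (L + 2)"
  have E: "E > 0" by (simp add: E_def)
  obtain G where G: "G \<ge> 0" "\<And>h. norm (g' z h) \<le> G * norm h"
    using bounded_linear.nonneg_bounded[OF has_derivative_bounded_linear[OF init[OF z]]]
    by (metis mult.commute)
  define C where "C = E * (G + 1 + (L + 1))"
  have C: "C \<ge> 0" using E G(1) L(1) by (simp add: C_def)
  \<comment> \<open>a neighbourhood of \<open>z\<close> in which the solution curves stay close to the one at \<open>z\<close>\<close>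
  have near: "\<exists>\<delta>'>0. \<forall>z'. norm (z' - z) < \<delta>' \<longrightarrow> z' \<in> Z \<and> (\<forall>s\<in>{0..1}. norm ((v (s, z'), z') - c s) < \<delta>)"
    if \<delta>: "\<delta> > 0" for \<delta>
  proof -
    have "continuous_on (Z \<times> {0..1}) (\<lambda>q. v (snd q, fst q))"
      by (rule continuous_on_compose2[OF v(3)]) (auto intro!: continuous_intros)
    moreover have "\<delta> / 4 > 0" using \<delta> by simp
    ultimately obtain X0 where X0: "z \<in> X0" "open X0" "\<forall>z'\<in>X0 \<inter> Z. \<forall>s\<in>{0..1}.
        dist (v (snd (z', s), fst (z', s))) (v (snd (z, s), fst (z, s))) \<le> \<delta> / 4"
      by (rule continuous_on_prod_compactE[OF _ compact_Icc z])
    obtain r where r: "r > 0" "ball z r \<subseteq> X0 \<inter> Z"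
      using open_Int[OF X0(2) \<open>open Z\<close>] X0(1) z openE by blast
    have "z' \<in> Z \<and> (\<forall>s\<in>{0..1}. norm ((v (s, z'), z') - c s) < \<delta>)" if "norm (z' - z) < min r (\<delta> / 2)" for z'
    proof -
      have zX: "z' \<in> X0 \<inter> Z" using r(2) that by (auto simp: subset_iff dist_norm norm_minus_commute)
      have "norm ((v (s, z'), z') - c s) < \<delta>" if s: "s \<in> {0..1}" for s
      proof -
        have "norm (v (s, z') - v (s, z)) \<le> \<delta> / 4" using X0(3) zX s by (auto simp: dist_norm)
        moreover have "norm ((v (s, z'), z') - c s) \<le> norm (v (s, z') - v (s, z)) + norm (z' - z)"
          unfolding c_def by (simp add: norm_Pair_le)
        ultimately show ?thesis using \<open>norm (z' - z) < min r (\<delta> / 2)\<close> \<delta> by linarith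
      qed
      then show ?thesis using zX by auto
    qed
    then show ?thesis using r \<delta> by (intro exI[of _ "min r (\<delta> / 2)"]) auto
  qed
  have "bounded_linear (Y s)"
    unfolding Y_def by (intro bounded_linear_sum bounded_linear_scaleR_const bounded_linear_inner_left)
  moreover have "\<exists>d>0. \<forall>z'. norm (z' - z) < d \<longrightarrow>
      norm (v (s, z') - v (s, z) - Y s (z' - z)) \<le> e * norm (z' - z)" if e: "e > 0" for e
  proof -
    define \<eta> where "\<eta> = min 1 (e / (E * (C + 2)))"
    have \<eta>: "0 < \<eta>" "\<eta> \<le> 1" "E * (C + 2) * \<eta> \<le> e"
    proof -
      have "E * (C + 2) > 0" using E C by (simp add: add_nonneg_pos)
      moreover have "\<eta> \<le> e / (E * (C + 2))" by (simp add: \<eta>_def)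
      ultimately have "\<eta> * (E * (C + 2)) \<le> e" by (simp only: pos_le_divide_eq)
      then show "E * (C + 2) * \<eta> \<le> e" by (simp only: mult.commute)
      show "0 < \<eta>" "\<eta> \<le> 1" using e \<open>E * (C + 2) > 0\<close> by (simp_all add: \<eta>_def)
    qed
    obtain \<delta> where \<delta>: "\<delta> > 0" "\<And>s q. s \<in> {0..1} \<Longrightarrow> norm (q - c s) < \<delta> \<Longrightarrow>
       norm (H (s, q) - H (s, c s) - H' (s, c s) (q - c s)) \<le> \<eta> * norm (q - c s)"
      using unif[OF _ _ _ _ \<eta>(1)] by blast
    obtain \<delta>' where \<delta>': "\<delta>' > 0" "\<And>z'. norm (z' - z) < \<delta>' \<Longrightarrow> z' \<in> Z"
      "\<And>z' s. norm (z' - z) < \<delta>' \<Longrightarrow> s \<in> {0..1} \<Longrightarrow> norm ((v (s, z'), z') - c s) < \<delta>"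
      using near[OF \<delta>(1)] by blast
    obtain \<delta>2 where \<delta>2: "\<delta>2 > 0" "\<And>z'. norm (z' - z) < \<delta>2 \<Longrightarrow>
       norm (v (0, z') - v (0, z) - g' z (z' - z)) \<le> \<eta> * norm (z' - z)"
      using init[OF z] \<eta>(1) unfolding has_derivative_at_alt by blast
    have "norm (v (s, z') - v (s, z) - Y s (z' - z)) \<le> e * norm (z' - z)"
      if z': "norm (z' - z) < min \<delta>' \<delta>2" for z'
    proof -
      define d where "d = z' - z"
      have zZ: "z' \<in> Z" using \<delta>'(2) z' by auto
      define r where "r = (\<lambda>s. v (s, z') - v (s, z))"
      \<comment> \<open>the error of linearization, to be estimated by \<open>\<eta>\<close> times the increments\<close>
      define err where "err = (\<lambda>s. H (s, v (s, z'), z') - H (s, c s) - H' (s, c s) (r s, d))"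
      have rd: "(v (s, z'), z') - c s = (r s, d)" for s by (simp add: c_def r_def d_def)
      have err: "norm (err s) \<le> \<eta> * (norm (r s) + norm d)" if s: "s \<in> {0..1}" for s
      proof -
        have "norm (err s) \<le> \<eta> * norm (r s, d)"
          using \<delta>(2)[OF s \<delta>'(3)[of z', OF _ s]] z' unfolding rd err_def by simp
        also have "\<dots> \<le> \<eta> * (norm (r s) + norm d)"
          using \<eta> by (intro mult_left_mono norm_Pair_le) auto
        finally show ?thesis .
      qed
      have r_der: "(r has_vector_derivative H' (s, c s) (r s, d) + err s) (at s within {0..1})"
        if "s \<in> {0..1}" for s
        unfolding r_def err_def c_def using v(2)[OF that zZ] v(2)[OF that z]
        by (auto intro!: derivative_eq_intros)
      have init0: "norm (r 0 - g' z d) \<le> \<eta> * norm d"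
        using \<delta>2(2) z' by (simp add: r_def d_def)
      have r0: "norm (r 0) \<le> (G + 1) * norm d"
      proof -
        have "norm (r 0) \<le> norm (r 0 - g' z d) + norm (g' z d)"
          using norm_triangle_ineq[of "r 0 - g' z d" "g' z d"] by simp
        also have "\<dots> \<le> \<eta> * norm d + G * norm d" using init0 G(2) by (intro add_mono)
        also have "\<dots> \<le> 1 * norm d + G * norm d" using \<eta> by (intro add_right_mono mult_right_mono) auto
        finally show ?thesis by (simp add: algebra_simps)
      qed
      \<comment> \<open>first, the increment of the solution is at most proportional to \<open>d\<close>\<close>
      have r_le: "norm (r s) \<le> C * norm d" if s: "s \<in> {0..1}" for s
      proof -
        have "norm (r s) \<le> exp ((L + 1) + 1) * (norm (r 0) + (L + 1) * norm d)"
        proof (rule gronwall_unit_interval[OF r_der _ _ _ s])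
          fix s :: real assume s: "s \<in> {0..1}"
          have "norm (H' (s, c s) (r s, d)) \<le> L * (norm (r s) + norm d)"
            using L(2)[OF s, of "(r s, d)"] norm_Pair_le[of "r s" d] L(1)
            by (meson mult_left_mono order_trans)
          moreover have "norm (err s) \<le> 1 * (norm (r s) + norm d)"
            using err[OF s] \<eta> by (meson mult_right_mono order_trans add_nonneg_nonneg norm_ge_zero)
          moreover have "norm (H' (s, c s) (r s, d) + err s) \<le> norm (H' (s, c s) (r s, d)) + norm (err s)"
            by (rule norm_triangle_ineq)
          ultimately show "norm (H' (s, c s) (r s, d) + err s) \<le> (L + 1) * norm (r s) + (L + 1) * norm d"
            by (simp add: algebra_simps)
        qed (use L in auto)
        also have "\<dots> \<le> E * ((G + 1) * norm d + (L + 1) * norm d)"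
          unfolding E_def using r0 by (intro mult_mono) (auto simp: add_ac intro!: add_nonneg_nonneg mult_nonneg_nonneg L G)
        also have "\<dots> = C * norm d" by (simp add: C_def algebra_simps)
        finally show ?thesis .
      qed
      \<comment> \<open>second, it is close to the solution \<open>Y\<close> of the variational equation\<close>
      define \<rho> where "\<rho> = (\<lambda>s. r s - Y s d)"
      have "norm (\<rho> s) \<le> exp (L + 1) * (norm (\<rho> 0) + \<eta> * ((C + 1) * norm d))"
      proof (rule gronwall_unit_interval[where r' = "\<lambda>s. H' (s, c s) (\<rho> s, 0) + err s"])
        fix s :: real assume s: "s \<in> {0..1}"
        interpret H': bounded_linear "H' (s, c s)" by (rule lin[OF s])
        have eq: "(H' (s, c s) (r s, d) + err s) - H' (s, c s) (Y s d, d) = H' (s, c s) (\<rho> s, 0) + err s"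
          using H'.diff[of "(r s, d)" "(Y s d, d)"] by (simp add: \<rho>_def)
        show "(\<rho> has_vector_derivative H' (s, c s) (\<rho> s, 0) + err s) (at s within {0..1})"
          using has_vector_derivative_diff[OF r_der[OF s] Y_der[OF s, of d]] unfolding eq \<rho>_def .
        have "norm (H' (s, c s) (\<rho> s, 0)) \<le> L * norm (\<rho> s)"
          using L(2)[OF s, of "(\<rho> s, 0)"] by simp
        moreover have "norm (err s) \<le> \<eta> * ((C + 1) * norm d)"
        proof -
          have "\<eta> * (norm (r s) + norm d) \<le> \<eta> * ((C + 1) * norm d)"
            using r_le[OF s] \<eta>(1) by (intro mult_left_mono) (auto simp: algebra_simps)
          then show ?thesis using err[OF s] by linarith
        qed
        ultimately show "norm (H' (s, c s) (\<rho> s, 0) + err s) \<le> L * norm (\<rho> s) + \<eta> * ((C + 1) * norm d)"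
          using norm_triangle_ineq[of "H' (s, c s) (\<rho> s, 0)" "err s"] by linarith
      qed (use L \<eta> C s in auto)
      also have "\<dots> \<le> E * (\<eta> * norm d + \<eta> * ((C + 1) * norm d))"
        unfolding E_def using init0 \<eta>(1) C
        by (intro mult_mono add_right_mono) (auto simp: \<rho>_def Y0)
      also have "\<dots> = (E * (C + 2) * \<eta>) * norm d" by (simp add: algebra_simps)
      also have "\<dots> \<le> e * norm d" using \<eta>(3) by (intro mult_right_mono) auto
      finally show ?thesis by (simp add: \<rho>_def r_def d_def)
    qed
    then show ?thesis using \<delta>'(1) \<delta>2(1) by (intro exI[of _ "min \<delta>' \<delta>2"]) auto
  qed
  ultimately have "((\<lambda>z. v (s, z)) has_derivative Y s) (at z)"
    unfolding has_derivative_at_alt by blast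
  then show ?thesis by (simp add: Y_def[abs_def])
qed

section \<open>Moderate nets of solutions\<close>

text \<open>
  The logarithmic bound on the coefficients \<open>A c\<close> makes the Gronwall factor moderate.
\<close>
lemma linear_ode_moderate_C0:
  fixes A :: "'x::euclidean_space \<Rightarrow> real \<Rightarrow> real \<times> 'z::euclidean_space \<Rightarrow> 'x"
  assumes "open Z" "e > 0"
    and A: "\<And>c. c \<in> Basis \<Longrightarrow> moderate_C0 e Z (A c)"
    and A_log: "\<And>K. compact K \<Longrightarrow> K \<subseteq> Z \<Longrightarrow>
       \<exists>C. \<forall>\<^sub>F \<epsilon> in at_right 0. \<forall>q\<in>{0..1} \<times> K. \<forall>c\<in>Basis. norm (A c \<epsilon> q) \<le> C * \<bar>ln \<epsilon>\<bar>"
    and B: "moderate_C0 e Z B"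
    and init: "moderate_C0 e Z (\<lambda>\<epsilon> q. w \<epsilon> (0, snd q))"
    and ode: "\<And>\<epsilon> s z. \<epsilon> \<in> {0<..e} \<Longrightarrow> s \<in> {0..1} \<Longrightarrow> z \<in> Z \<Longrightarrow>
       ((\<lambda>s. w \<epsilon> (s, z)) has_vector_derivative
         (\<Sum>c\<in>Basis. (w \<epsilon> (s, z) \<bullet> c) *\<^sub>R A c \<epsilon> (s, z)) + B \<epsilon> (s, z)) (at s within {0..1})"
  shows "moderate_C0 e Z w"
proof -
  have lin_le: "norm (\<Sum>c\<in>Basis. (x \<bullet> c) *\<^sub>R a c) \<le> real DIM('x) * C * norm x"
    if "\<And>c. c \<in> Basis \<Longrightarrow> norm (a c) \<le> C" for x :: 'x and a :: "'x \<Rightarrow> 'x" and C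
  proof -
    have "norm (\<Sum>c\<in>Basis. (x \<bullet> c) *\<^sub>R a c) \<le> (\<Sum>c\<in>(Basis::'x set). norm x * C)"
      by (rule sum_norm_le) (auto intro!: mult_mono that simp: Basis_le_norm)
    then show ?thesis by (simp add: mult_ac)
  qed
  have "continuous_on ({0..1} \<times> Z) (w \<epsilon>)" if \<epsilon>: "\<epsilon> \<in> {0<..e}" for \<epsilon>
  proof -
    have cA: "continuous_on ({0..1} \<times> Z) (A c \<epsilon>)" if "c \<in> Basis" for c
      using A[OF that] \<epsilon> by (simp add: moderate_C0_def)
    have cB: "continuous_on ({0..1} \<times> Z) (B \<epsilon>)" using B \<epsilon> by (simp add: moderate_C0_def)
    define H where "H = (\<lambda>(s, x, z). (\<Sum>c\<in>Basis. (x \<bullet> c) *\<^sub>R A c \<epsilon> (s, z)) + B \<epsilon> (s, z))"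
    show ?thesis
    proof (rule ode_continuous_dependence[where D = UNIV and H = H])
      show "continuous_on ({0..1} \<times> UNIV \<times> Z) H"
        unfolding H_def split_beta
        by (intro continuous_intros continuous_on_compose2[OF cA] continuous_on_compose2[OF cB]) auto
      show "((\<lambda>s. w \<epsilon> (s, z)) has_vector_derivative H (s, w \<epsilon> (s, z), z)) (at s within {0..1})"
        if "s \<in> {0..1}" "z \<in> Z" for s z
        using ode[OF \<epsilon> that] by (simp add: H_def)
      have "continuous_on ({0..1::real} \<times> Z) (\<lambda>q. w \<epsilon> (0, snd q))"
        using init \<epsilon> by (simp add: moderate_C0_def)
      then have "continuous_on Z (\<lambda>z. (\<lambda>q. w \<epsilon> (0, snd q)) (0::real, z))"
        by (rule continuous_on_compose2) (auto intro!: continuous_intros)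
      then show "continuous_on Z (\<lambda>z. w \<epsilon> (0, z))" by simp
      fix z assume "z \<in> Z"
      then obtain \<delta> where \<delta>: "\<delta> > 0" "cball z \<delta> \<subseteq> Z" using \<open>open Z\<close> open_contains_cball by blast
      have "\<exists>C. \<forall>q\<in>{0..1} \<times> cball z \<delta>. norm (A c \<epsilon> q) \<le> C" if "c \<in> Basis" for c
      proof -
        have "continuous_on ({0..1} \<times> cball z \<delta>) (A c \<epsilon>)"
          using cA[OF that] by (rule continuous_on_subset) (use \<delta> in auto)
        then show ?thesis by (metis compact_continuous_norm_bounded compact_Times compact_Icc compact_cball)
      qed
      then obtain C where C: "\<And>c q. c \<in> Basis \<Longrightarrow> q \<in> {0..1} \<times> cball z \<delta> \<Longrightarrow> norm (A c \<epsilon> q) \<le> C c"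
        by metis
      define C' where "C' = (\<Sum>c\<in>Basis. \<bar>C c\<bar>)"
      have C': "norm (A c \<epsilon> q) \<le> C'" if "c \<in> Basis" "q \<in> {0..1} \<times> cball z \<delta>" for c q
      proof -
        have "C c \<le> C'" unfolding C'_def by (rule le_sum_abs[OF finite_Basis that(1)])
        then show ?thesis using C[OF that] by linarith
      qed
      have "norm (H (s, x, z') - H (s, y, z')) \<le> real DIM('x) * C' * norm (x - y)"
        if "z' \<in> ball z \<delta>" "s \<in> {0..1}" for z' s x y
      proof -
        have "H (s, x, z') - H (s, y, z') = (\<Sum>c\<in>Basis. ((x - y) \<bullet> c) *\<^sub>R A c \<epsilon> (s, z'))"
          by (simp add: H_def sum_subtractf[symmetric] inner_diff_left scaleR_diff_left)
        then show ?thesis using lin_le[of "\<lambda>c. A c \<epsilon> (s, z')" C' "x - y"] C' that by auto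
      qed
      then show "\<exists>\<delta>>0. \<exists>L. \<forall>z'\<in>ball z \<delta> \<inter> Z. \<forall>s\<in>{0..1}. \<forall>x\<in>UNIV. \<forall>y\<in>UNIV.
          norm (H (s, x, z') - H (s, y, z')) \<le> L * norm (x - y)"
        using \<delta> by blast
    qed (use \<open>open Z\<close> in auto)
  qed
  moreover have "moderate_bound ({0..1} \<times> K) w" if K: "compact K" "K \<subseteq> Z" for K
  proof -
    obtain C where C: "\<forall>\<^sub>F \<epsilon> in at_right 0. \<forall>q\<in>{0..1} \<times> K. \<forall>c\<in>Basis. norm (A c \<epsilon> q) \<le> C * \<bar>ln \<epsilon>\<bar>"
      using A_log[OF K] by blast
    obtain N where N: "\<forall>\<^sub>F \<epsilon> in at_right 0. \<forall>q\<in>{0..1} \<times> K. norm (B \<epsilon> q) \<le> (1 / \<epsilon>) ^ N"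
      using B K by (auto simp: moderate_C0_def elim!: moderate_boundE)
    have "moderate_bound ({0..1::real} \<times> K) (\<lambda>\<epsilon> q. w \<epsilon> (0, snd q))"
      using init K by (simp add: moderate_C0_def)
    then obtain M where "\<forall>\<^sub>F \<epsilon> in at_right 0. \<forall>q\<in>{0..1::real} \<times> K. norm (w \<epsilon> (0, snd q)) \<le> (1 / \<epsilon>) ^ M"
      by (rule moderate_boundE)
    then have M: "\<forall>\<^sub>F \<epsilon> in at_right 0. \<forall>z\<in>K. norm (w \<epsilon> (0, z)) \<le> (1 / \<epsilon>) ^ M"
      by (rule eventually_mono) force
    define L where "L = real DIM('x) * \<bar>C\<bar>"
    have "moderate_bound ({0..1} \<times> K) (\<lambda>\<epsilon> q. exp (L * \<bar>ln \<epsilon>\<bar> + 1))" by (rule moderate_bound_exp_log)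
    moreover have "moderate_bound ({0..1} \<times> K) (\<lambda>\<epsilon> q. (1 / \<epsilon>) ^ M + (1 / \<epsilon>) ^ N)"
      by (intro moderate_bound_add; rule moderate_boundI[where C = 1];
          rule eventually_mono[OF eventually_at_right_small[OF zero_less_one]]) auto
    ultimately have "moderate_bound ({0..1} \<times> K) (\<lambda>\<epsilon> q. exp (L * \<bar>ln \<epsilon>\<bar> + 1) * ((1 / \<epsilon>) ^ M + (1 / \<epsilon>) ^ N))"
      by (rule moderate_bound_prod[OF bounded_bilinear_mult])
    then show ?thesis
    proof (rule moderate_bound_dominated[where C = 1])
      show "\<forall>\<^sub>F \<epsilon> in at_right 0. \<forall>q\<in>{0..1} \<times> K.
          norm (w \<epsilon> q) \<le> 1 * norm (exp (L * \<bar>ln \<epsilon>\<bar> + 1) * ((1 / \<epsilon>) ^ M + (1 / \<epsilon>) ^ N))"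
        using C N M eventually_at_right_small[OF \<open>e > 0\<close>]
      proof eventually_elim
        case (elim \<epsilon>)
        then have \<epsilon>: "\<epsilon> \<in> {0<..e}" by auto
        have "norm (w \<epsilon> (s, z)) \<le> exp (L * \<bar>ln \<epsilon>\<bar> + 1) * ((1 / \<epsilon>) ^ M + (1 / \<epsilon>) ^ N)"
          if s: "s \<in> {0..1}" and z: "z \<in> K" for s z
        proof -
          have "norm (w \<epsilon> (s, z)) \<le> exp (L * \<bar>ln \<epsilon>\<bar> + 1) * (norm (w \<epsilon> (0, z)) + (1 / \<epsilon>) ^ N)"
          proof (rule gronwall_unit_interval[OF ode[OF \<epsilon>]])
            fix s :: real assume s: "s \<in> {0..1}"
            have "norm (\<Sum>c\<in>Basis. (w \<epsilon> (s, z) \<bullet> c) *\<^sub>R A c \<epsilon> (s, z))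
                \<le> real DIM('x) * (\<bar>C\<bar> * \<bar>ln \<epsilon>\<bar>) * norm (w \<epsilon> (s, z))"
            proof (rule lin_le)
              fix c :: 'x assume "c \<in> Basis"
              then have "norm (A c \<epsilon> (s, z)) \<le> C * \<bar>ln \<epsilon>\<bar>" using elim(1) s z by auto
              also have "\<dots> \<le> \<bar>C\<bar> * \<bar>ln \<epsilon>\<bar>" by (intro mult_right_mono) auto
              finally show "norm (A c \<epsilon> (s, z)) \<le> \<bar>C\<bar> * \<bar>ln \<epsilon>\<bar>" .
            qed
            moreover have "norm (B \<epsilon> (s, z)) \<le> (1 / \<epsilon>) ^ N" using elim(2) s z by auto
            ultimately show "norm ((\<Sum>c\<in>Basis. (w \<epsilon> (s, z) \<bullet> c) *\<^sub>R A c \<epsilon> (s, z)) + B \<epsilon> (s, z))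
                \<le> L * \<bar>ln \<epsilon>\<bar> * norm (w \<epsilon> (s, z)) + (1 / \<epsilon>) ^ N"
              unfolding L_def mult.assoc using norm_triangle_mono by blast
          qed (use s z K \<epsilon> in \<open>auto simp: L_def\<close>)
          also have "\<dots> \<le> exp (L * \<bar>ln \<epsilon>\<bar> + 1) * ((1 / \<epsilon>) ^ M + (1 / \<epsilon>) ^ N)"
            using elim(3) z by (intro mult_left_mono add_right_mono) auto
          finally show ?thesis .
        qed
        moreover have "exp (L * \<bar>ln \<epsilon>\<bar> + 1) * ((1 / \<epsilon>) ^ M + (1 / \<epsilon>) ^ N) \<ge> 0" using \<epsilon> by simp
        ultimately show ?case by auto
      qed
    qed
  qed
  ultimately show ?thesis by (simp add: moderate_C0_def)
qed

lemma sum_Basis_delta: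
  assumes "b \<in> Basis"
  shows "(\<Sum>b'\<in>Basis. (b \<bullet> b') *\<^sub>R (f b' :: 'b::real_vector)) = f b"
proof -
  have "(\<Sum>b'\<in>Basis. (b \<bullet> b') *\<^sub>R f b') = (\<Sum>b'\<in>Basis. if b' = b then f b' else 0)"
    by (rule sum.cong) (use assms in \<open>auto simp: inner_Basis\<close>)
  then show ?thesis using assms by simp
qed

text \<open>
  The induction step common to linear and nonlinear equations. A statement about all solutions of
  the variational equations (\<open>step\<close>) yields one more derivative of the solution itself.
\<close>
lemma moderate_Ck_Suc_variational:
  fixes H :: "real \<Rightarrow> real \<times> 'x::euclidean_space \<times> 'z::euclidean_space \<Rightarrow> 'x"
  assumes "open D" "open Z" "e > 0"
    and der: "\<And>\<epsilon> s q. \<epsilon> \<in> {0<..e} \<Longrightarrow> s \<in> {0..1} \<Longrightarrow> q \<in> D \<times> Z \<Longrightarrow>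
       ((\<lambda>q. H \<epsilon> (s, q)) has_derivative H' \<epsilon> (s, q)) (at q)"
    and cont: "\<And>\<epsilon> b. \<epsilon> \<in> {0<..e} \<Longrightarrow> b \<in> Basis \<Longrightarrow> continuous_on ({0..1} \<times> D \<times> Z) (\<lambda>q. H' \<epsilon> q b)"
    and v: "\<And>\<epsilon> s z. \<epsilon> \<in> {0<..e} \<Longrightarrow> s \<in> {0..1} \<Longrightarrow> z \<in> Z \<Longrightarrow> v \<epsilon> (s, z) \<in> D"
      "\<And>\<epsilon> s z. \<epsilon> \<in> {0<..e} \<Longrightarrow> s \<in> {0..1} \<Longrightarrow> z \<in> Z \<Longrightarrow>
         ((\<lambda>s. v \<epsilon> (s, z)) has_vector_derivative H \<epsilon> (s, v \<epsilon> (s, z), z)) (at s within {0..1})"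
    and v_C0: "moderate_C0 e Z v"
    and init: "moderate_Ck (Suc k) e Z (\<lambda>\<epsilon> q. v \<epsilon> (0, snd q))"
    and step: "\<And>b y. b \<in> Basis \<Longrightarrow> moderate_Ck k e Z (\<lambda>\<epsilon> q. y \<epsilon> (0, snd q)) \<Longrightarrow>
       (\<And>\<epsilon> s z. \<epsilon> \<in> {0<..e} \<Longrightarrow> s \<in> {0..1} \<Longrightarrow> z \<in> Z \<Longrightarrow>
         ((\<lambda>s. y \<epsilon> (s, z)) has_vector_derivative H' \<epsilon> (s, v \<epsilon> (s, z), z) (y \<epsilon> (s, z), b)) (at s within {0..1})) \<Longrightarrow>
       moderate_Ck k e Z y"
  shows "moderate_Ck (Suc k) e Z v"
proof -
  define g' where "g' = (\<lambda>\<epsilon> (q :: real \<times> 'z). frechet_derivative (\<lambda>z. v \<epsilon> (0, z)) (at (snd q)))"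
  have g': "((\<lambda>z. v \<epsilon> (0, z)) has_derivative g' \<epsilon> (s, z)) (at z)"
    if "\<epsilon> \<in> {0<..e}" "s \<in> {0..1}" "z \<in> Z" for \<epsilon> s z
    using moderate_Ck_frechet_derivative(1)[OF assms(2,3) init that] by (simp add: g'_def)
  have g'_k: "moderate_Ck k e Z (\<lambda>\<epsilon> q. g' \<epsilon> q b)" if "b \<in> Basis" for b
    using moderate_Ck_frechet_derivative(2)[OF assms(2,3) init that] by (simp add: g'_def)
  have cv: "continuous_on ({0..1} \<times> Z) (v \<epsilon>)" if "\<epsilon> \<in> {0<..e}" for \<epsilon>
    by (rule moderate_C0_continuous_on[OF v_C0 that])
  have lin: "linear (H' \<epsilon> (s, v \<epsilon> (s, z), z))" if "\<epsilon> \<in> {0<..e}" "s \<in> {0..1}" "z \<in> Z" for \<epsilon> s z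
    using der[OF that(1,2), of "(v \<epsilon> (s, z), z)"] v(1)[OF that] that(3)
    by (intro bounded_linear.linear) (auto intro: has_derivative_bounded_linear)
  have H'_split: "H' \<epsilon> (s, v \<epsilon> (s, z), z) (x, b) =
      (\<Sum>c\<in>Basis. (x \<bullet> c) *\<^sub>R H' \<epsilon> (s, v \<epsilon> (s, z), z) (c, 0)) + H' \<epsilon> (s, v \<epsilon> (s, z), z) (0, b)"
    if "\<epsilon> \<in> {0<..e}" "s \<in> {0..1}" "z \<in> Z" for \<epsilon> s z x b
  proof -
    interpret linear "H' \<epsilon> (s, v \<epsilon> (s, z), z)" by (rule lin[OF that])
    have "(x, b) = (\<Sum>c\<in>Basis. (x \<bullet> c) *\<^sub>R (c, 0)) + (0, b)"
      by (simp add: prod_eq_iff fst_sum snd_sum euclidean_representation)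
    then show ?thesis by (simp only: add sum scaleR)
  qed
  have c_curve: "continuous_on {0..1} (\<lambda>s. H' \<epsilon> (s, v \<epsilon> (s, z), z) d)"
    if "\<epsilon> \<in> {0<..e}" "z \<in> Z" for \<epsilon> z d
  proof (rule continuous_on_linear_family)
    have "continuous_on {0..1} (\<lambda>s. v \<epsilon> (s, z))"
      by (rule continuous_on_compose2[OF cv[OF that(1)]]) (use that(2) in \<open>auto intro!: continuous_intros\<close>)
    moreover have "(\<lambda>s. (s, v \<epsilon> (s, z), z)) ` {0..1} \<subseteq> {0..1} \<times> D \<times> Z"
      using v(1)[OF that(1) _ that(2)] that(2) by auto
    ultimately show "continuous_on {0..1} (\<lambda>s. H' \<epsilon> (s, v \<epsilon> (s, z), z) b)" if "b \<in> Basis" for b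
      by (intro continuous_on_compose2[OF cont[OF \<open>\<epsilon> \<in> {0<..e}\<close> that]] continuous_intros)
  qed (use lin that in auto)
  define sol where "sol = (\<lambda>\<epsilon> z b y. y 0 = g' \<epsilon> (0, z) b \<and> (\<forall>s\<in>{0..1}. (y has_vector_derivative
      H' \<epsilon> (s, v \<epsilon> (s, z), z) (y s, b)) (at s within {0..1})))"
  have "\<exists>y. sol \<epsilon> z b y" if "\<epsilon> \<in> {0<..e}" "z \<in> Z" for \<epsilon> z b
  proof (rule linear_ode_exists[OF c_curve[OF that] c_curve[OF that], where \<xi> = "g' \<epsilon> (0, z) b"])
    fix y assume y: "y 0 = g' \<epsilon> (0, z) b" "\<And>s. s \<in> {0..1} \<Longrightarrow> (y has_vector_derivative
      (\<Sum>c\<in>Basis. (y s \<bullet> c) *\<^sub>R H' \<epsilon> (s, v \<epsilon> (s, z), z) (c, 0)) + H' \<epsilon> (s, v \<epsilon> (s, z), z) (0, b))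
      (at s within {0..1})"
    have "(y has_vector_derivative H' \<epsilon> (s, v \<epsilon> (s, z), z) (y s, b)) (at s within {0..1})"
      if "s \<in> {0..1}" for s
      unfolding H'_split[OF \<open>\<epsilon> \<in> {0<..e}\<close> that \<open>z \<in> Z\<close>, of "y s" b] by (rule y(2)[OF that])
    then show ?thesis unfolding sol_def using y(1) by blast
  qed
  then obtain y where sol: "\<And>\<epsilon> z b. \<epsilon> \<in> {0<..e} \<Longrightarrow> z \<in> Z \<Longrightarrow> sol \<epsilon> z b (y \<epsilon> z b)" by metis
  define Y where "Y = (\<lambda>\<epsilon> q b. y \<epsilon> (snd q) b (fst q))"
  have Y0: "Y \<epsilon> (0, z) b = g' \<epsilon> (0, z) b" if "\<epsilon> \<in> {0<..e}" "z \<in> Z" for \<epsilon> z b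
    using sol[OF that] by (simp add: sol_def Y_def)
  have Y: "((\<lambda>s. Y \<epsilon> (s, z) b) has_vector_derivative H' \<epsilon> (s, v \<epsilon> (s, z), z) (Y \<epsilon> (s, z) b, b)) (at s within {0..1})"
    if "\<epsilon> \<in> {0<..e}" "s \<in> {0..1}" "z \<in> Z" for \<epsilon> s z b
    using sol[OF that(1,3)] that(2) by (simp add: sol_def Y_def)
  have Y_k: "moderate_Ck k e Z (\<lambda>\<epsilon> q. Y \<epsilon> q b)" if b: "b \<in> Basis" for b
  proof (rule step[OF b _ Y])
    show "moderate_Ck k e Z (\<lambda>\<epsilon> q. Y \<epsilon> (0, snd q) b)"
    proof (rule moderate_Ck_cong[OF assms(2) moderate_Ck_slice[OF g'_k[OF b], of 0] assms(3)])
      show "g' \<epsilon> (0, snd (s, z)) b = Y \<epsilon> (0, snd (s, z)) b" if "\<epsilon> \<in> {0<..e}" "z \<in> Z" for \<epsilon> s z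
        using Y0[OF that] by simp
    qed auto
  qed auto
  show ?thesis
  proof (rule moderate_CkI[where f' = "\<lambda>\<epsilon> q h. \<Sum>b\<in>Basis. (h \<bullet> b) *\<^sub>R Y \<epsilon> q b"])
    show "moderate_C0 e Z v" by (rule v_C0)
    show "moderate_Ck k e Z (\<lambda>\<epsilon> q. \<Sum>b'\<in>Basis. (b \<bullet> b') *\<^sub>R Y \<epsilon> q b')" if "b \<in> Basis" for b
      using Y_k[OF that] by (simp add: sum_Basis_delta[OF that])
    show "((\<lambda>z. v \<epsilon> (s, z)) has_derivative (\<lambda>h. \<Sum>b\<in>Basis. (h \<bullet> b) *\<^sub>R Y \<epsilon> (s, z) b)) (at z)"
      if \<epsilon>: "\<epsilon> \<in> {0<..e}" and s: "s \<in> {0..1}" and z: "z \<in> Z" for \<epsilon> s z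
      by (rule ode_differentiable_dependence[where g' = "\<lambda>z. g' \<epsilon> (0, z)",
            OF assms(1,2) der[OF \<epsilon>] cont[OF \<epsilon>] v(1)[OF \<epsilon>] v(2)[OF \<epsilon>] cv[OF \<epsilon>] g'[OF \<epsilon>] Y0[OF \<epsilon>] Y[OF \<epsilon>] s z])
        auto
  qed
qed

text \<open>
  The derivative of a solution in direction \<open>b\<close> solves an equation with the same coefficients \<open>A\<close>,
  whose inhomogeneity is made from the solution and first derivatives of \<open>A\<close> and \<open>B\<close>. As all these
  are moderate nets of \<open>C\<^sup>k\<close> maps if the data are of class \<open>C\<^sup>k\<^sup>+\<^sup>1\<close>, induction on \<open>k\<close> applies.
\<close>
lemma linear_ode_moderate_Ck:
  fixes A :: "'x::euclidean_space \<Rightarrow> real \<Rightarrow> real \<times> 'z::euclidean_space \<Rightarrow> 'x"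
  assumes "open Z" "e > 0"
    and A_log: "\<And>K. compact K \<Longrightarrow> K \<subseteq> Z \<Longrightarrow>
       \<exists>C. \<forall>\<^sub>F \<epsilon> in at_right 0. \<forall>q\<in>{0..1} \<times> K. \<forall>c\<in>Basis. norm (A c \<epsilon> q) \<le> C * \<bar>ln \<epsilon>\<bar>"
    and "\<And>c. c \<in> Basis \<Longrightarrow> moderate_Ck k e Z (A c)"
    and "moderate_Ck k e Z B"
    and "moderate_Ck k e Z (\<lambda>\<epsilon> q. w \<epsilon> (0, snd q))"
    and "\<And>\<epsilon> s z. \<epsilon> \<in> {0<..e} \<Longrightarrow> s \<in> {0..1} \<Longrightarrow> z \<in> Z \<Longrightarrow>
       ((\<lambda>s. w \<epsilon> (s, z)) has_vector_derivative
         (\<Sum>c\<in>Basis. (w \<epsilon> (s, z) \<bullet> c) *\<^sub>R A c \<epsilon> (s, z)) + B \<epsilon> (s, z)) (at s within {0..1})"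
  shows "moderate_Ck k e Z w"
  using assms(4-)
proof (induction k arbitrary: B w)
  case 0
  then show ?case using linear_ode_moderate_C0[OF assms(1,2) _ A_log, of B w] by simp
next
  case (Suc k)
  note A = Suc.prems(1) and B = Suc.prems(2) and init = Suc.prems(3) and ode = Suc.prems(4)
  have w_k: "moderate_Ck k e Z w"
    by (rule Suc.IH[OF A[THEN moderate_Ck_Suc_D] moderate_Ck_Suc_D[OF B] moderate_Ck_Suc_D[OF init] ode])
  define A' where "A' = (\<lambda>c \<epsilon> q. frechet_derivative (\<lambda>z. A c \<epsilon> (fst q, z)) (at (snd q)))"
  define B' where "B' = (\<lambda>\<epsilon> q. frechet_derivative (\<lambda>z. B \<epsilon> (fst q, z)) (at (snd q)))"
  have A': "\<And>c \<epsilon> s z. c \<in> Basis \<Longrightarrow> \<epsilon> \<in> {0<..e} \<Longrightarrow> s \<in> {0..1} \<Longrightarrow> z \<in> Z \<Longrightarrow>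
      ((\<lambda>z. A c \<epsilon> (s, z)) has_derivative A' c \<epsilon> (s, z)) (at z)"
    "\<And>c b. c \<in> Basis \<Longrightarrow> b \<in> Basis \<Longrightarrow> moderate_Ck k e Z (\<lambda>\<epsilon> q. A' c \<epsilon> q b)"
    using moderate_Ck_frechet_derivative[OF assms(1,2) A] by (simp_all add: A'_def)
  have B': "\<And>\<epsilon> s z. \<epsilon> \<in> {0<..e} \<Longrightarrow> s \<in> {0..1} \<Longrightarrow> z \<in> Z \<Longrightarrow>
      ((\<lambda>z. B \<epsilon> (s, z)) has_derivative B' \<epsilon> (s, z)) (at z)"
    "\<And>b. b \<in> Basis \<Longrightarrow> moderate_Ck k e Z (\<lambda>\<epsilon> q. B' \<epsilon> q b)"
    using moderate_Ck_frechet_derivative[OF assms(1,2) B] by (simp_all add: B'_def)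
  \<comment> \<open>the inhomogeneity of the equation for the derivative in direction \<open>b\<close>\<close>
  define R where "R = (\<lambda>b \<epsilon> q. (\<Sum>c\<in>Basis. (w \<epsilon> q \<bullet> c) *\<^sub>R A' c \<epsilon> q b) + B' \<epsilon> q b)"
  have R_k: "moderate_Ck k e Z (R b)" if "b \<in> Basis" for b
    unfolding R_def
    by (intro moderate_Ck_add moderate_Ck_sum finite_Basis moderate_Ck_prod[OF bounded_bilinear_scaleR]
        moderate_Ck_bounded_linear[OF bounded_linear_inner_left w_k] A'(2) B'(2) that)
  note C0 = moderate_Ck_C0[THEN moderate_C0_continuous_on]
  define H where "H = (\<lambda>\<epsilon> q. (\<Sum>c\<in>Basis. (fst (snd q) \<bullet> c) *\<^sub>R A c \<epsilon> (fst q, snd (snd q))) + B \<epsilon> (fst q, snd (snd q)))"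
  define H' where "H' = (\<lambda>\<epsilon> q d.
    (\<Sum>c\<in>Basis. (fst (snd q) \<bullet> c) *\<^sub>R A' c \<epsilon> (fst q, snd (snd q)) (snd d) + (fst d \<bullet> c) *\<^sub>R A c \<epsilon> (fst q, snd (snd q)))
      + B' \<epsilon> (fst q, snd (snd q)) (snd d))"
  show ?case
  proof (rule moderate_Ck_Suc_variational[where D = UNIV and H = H and H' = H'])
    fix \<epsilon> s :: real and q :: "'x \<times> 'z" assume \<epsilon>: "\<epsilon> \<in> {0<..e}" and s: "s \<in> {0..1}" and q: "q \<in> UNIV \<times> Z"
    then have z: "snd q \<in> Z" by auto
    have dA: "((\<lambda>q. A c \<epsilon> (s, snd q)) has_derivative (\<lambda>d. A' c \<epsilon> (s, snd q) (snd d))) (at q)"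
      if "c \<in> Basis" for c
      by (rule has_derivative_compose[OF has_derivative_snd[OF has_derivative_ident] A'(1)[OF that \<epsilon> s z]])
    have dB: "((\<lambda>q. B \<epsilon> (s, snd q)) has_derivative (\<lambda>d. B' \<epsilon> (s, snd q) (snd d))) (at q)"
      by (rule has_derivative_compose[OF has_derivative_snd[OF has_derivative_ident] B'(1)[OF \<epsilon> s z]])
    show "((\<lambda>q. H \<epsilon> (s, q)) has_derivative H' \<epsilon> (s, q)) (at q)"
      unfolding H_def H'_def fst_conv snd_conv
      by (intro has_derivative_add has_derivative_sum has_derivative_scaleR dA dB
          has_derivative_inner_left has_derivative_fst has_derivative_ident)
  next
    fix \<epsilon> and b :: "'x \<times> 'z" assume \<epsilon>: "\<epsilon> \<in> {0<..e}"
    have cA: "continuous_on ({0..1} \<times> Z) (A c \<epsilon>)" if "c \<in> Basis" for c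
      by (rule C0[OF A[OF that] \<epsilon>])
    have cA': "continuous_on ({0..1} \<times> Z) (\<lambda>q. A' c \<epsilon> q h)" if "c \<in> Basis" for c h
    proof (rule continuous_on_linear_family)
      fix q assume "q \<in> {0..1::real} \<times> Z"
      then show "linear (A' c \<epsilon> q)"
        using has_derivative_bounded_linear[OF A'(1)[OF that \<epsilon>, of "fst q" "snd q"]] bounded_linear.linear
        by fastforce
    qed (rule C0[OF A'(2)[OF that] \<epsilon>])
    have cB': "continuous_on ({0..1} \<times> Z) (\<lambda>q. B' \<epsilon> q h)" for h
    proof (rule continuous_on_linear_family)
      fix q assume "q \<in> {0..1::real} \<times> Z"
      then show "linear (B' \<epsilon> q)"
        using has_derivative_bounded_linear[OF B'(1)[OF \<epsilon>, of "fst q" "snd q"]] bounded_linear.linear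
        by fastforce
    qed (rule C0[OF B'(2) \<epsilon>])
    show "continuous_on ({0..1} \<times> UNIV \<times> Z) (\<lambda>q. H' \<epsilon> q b)"
      unfolding H'_def
      by (intro continuous_intros continuous_on_compose2[OF cA'] continuous_on_compose2[OF cB']
          continuous_on_compose2[OF cA]) auto
  next
    show "((\<lambda>s. w \<epsilon> (s, z)) has_vector_derivative H \<epsilon> (s, w \<epsilon> (s, z), z)) (at s within {0..1})"
      if "\<epsilon> \<in> {0<..e}" "s \<in> {0..1}" "z \<in> Z" for \<epsilon> s z
      using ode[OF that] by (simp add: H_def)
  next
    fix b :: 'z and y assume b: "b \<in> Basis"
      and y0: "moderate_Ck k e Z (\<lambda>\<epsilon> q. y \<epsilon> (0, snd q))"
      and y: "\<And>\<epsilon> s z. \<epsilon> \<in> {0<..e} \<Longrightarrow> s \<in> {0..1} \<Longrightarrow> z \<in> Z \<Longrightarrow>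
        ((\<lambda>s. y \<epsilon> (s, z)) has_vector_derivative H' \<epsilon> (s, w \<epsilon> (s, z), z) (y \<epsilon> (s, z), b)) (at s within {0..1})"
    have H'_eq: "H' \<epsilon> (s, w \<epsilon> (s, z), z) (x, b) = (\<Sum>c\<in>Basis. (x \<bullet> c) *\<^sub>R A c \<epsilon> (s, z)) + R b \<epsilon> (s, z)"
      for \<epsilon> s z x by (simp add: H'_def R_def sum.distrib)
    show "moderate_Ck k e Z y"
      by (rule Suc.IH[OF A[THEN moderate_Ck_Suc_D] R_k[OF b] y0 y[unfolded H'_eq]])
  qed (use assms(1,2) moderate_Ck_C0[OF w_k] init in simp_all)
qed

text \<open>
  Nonlinear equations whose solutions stay in a fixed compact set: once the solution is a
  moderate net of \<open>C\<^sup>k\<close> maps, so are the coefficients of the variational equation, by the chain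
  rule, and the linear theory gives one more derivative.
\<close>
lemma ode_moderate_Ck:
  fixes H :: "real \<Rightarrow> real \<times> 'x::euclidean_space \<times> 'z::euclidean_space \<Rightarrow> 'x"
  assumes "open D" "open Z" "e > 0"
    and H: "\<And>k. moderate_Ck k e (D \<times> Z) H"
    and D0: "compact D0" "convex D0" "D0 \<subseteq> D"
    and v: "\<And>\<epsilon> s z. \<epsilon> \<in> {0<..e} \<Longrightarrow> s \<in> {0..1} \<Longrightarrow> z \<in> Z \<Longrightarrow> v \<epsilon> (s, z) \<in> D0"
      "\<And>\<epsilon> s z. \<epsilon> \<in> {0<..e} \<Longrightarrow> s \<in> {0..1} \<Longrightarrow> z \<in> Z \<Longrightarrow>
         ((\<lambda>s. v \<epsilon> (s, z)) has_vector_derivative H \<epsilon> (s, v \<epsilon> (s, z), z)) (at s within {0..1})"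
    and init: "\<And>k. moderate_Ck k e Z (\<lambda>\<epsilon> q. v \<epsilon> (0, snd q))"
    and H_log: "\<And>K. compact K \<Longrightarrow> K \<subseteq> Z \<Longrightarrow> \<exists>C. \<forall>\<^sub>F \<epsilon> in at_right 0.
       \<forall>s\<in>{0..1}. \<forall>x\<in>D0. \<forall>z\<in>K. \<forall>c\<in>Basis.
         norm (frechet_derivative (\<lambda>q. H \<epsilon> (s, q)) (at (x, z)) (c, 0)) \<le> C * \<bar>ln \<epsilon>\<bar>"
  shows "moderate_Ck k e Z v"
proof (induction k)
  define H' where "H' = (\<lambda>\<epsilon> q. frechet_derivative (\<lambda>y. H \<epsilon> (fst q, y)) (at (snd q)))"
  have DZ: "open (D \<times> Z)" using assms(1,2) by (rule open_Times)
  have H': "\<And>\<epsilon> s q. \<epsilon> \<in> {0<..e} \<Longrightarrow> s \<in> {0..1} \<Longrightarrow> q \<in> D \<times> Z \<Longrightarrow>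
      ((\<lambda>q. H \<epsilon> (s, q)) has_derivative H' \<epsilon> (s, q)) (at q)"
    "\<And>b k. b \<in> Basis \<Longrightarrow> moderate_Ck k e (D \<times> Z) (\<lambda>\<epsilon> q. H' \<epsilon> q b)"
    using moderate_Ck_frechet_derivative[OF DZ assms(3) H] by (simp_all add: H'_def)
  note cH' = moderate_C0_continuous_on[OF moderate_Ck_C0[OF H'(2)]]
  {
    case 0
    have "continuous_on ({0..1} \<times> Z) (v \<epsilon>)" if \<epsilon>: "\<epsilon> \<in> {0<..e}" for \<epsilon>
    proof (rule ode_continuous_dependence[where D = D0 and H = "H \<epsilon>"])
      show "continuous_on ({0..1} \<times> D0 \<times> Z) (H \<epsilon>)"
        using moderate_C0_continuous_on[OF moderate_Ck_C0[OF H] \<epsilon>]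
        by (rule continuous_on_subset) (use D0 in auto)
      have "continuous_on ({0..1::real} \<times> Z) (\<lambda>q. v \<epsilon> (0, snd q))"
        by (rule moderate_C0_continuous_on[OF moderate_Ck_C0[OF init] \<epsilon>])
      then have "continuous_on Z (\<lambda>z. (\<lambda>q. v \<epsilon> (0, snd q)) (0::real, z))"
        by (rule continuous_on_compose2) (auto intro!: continuous_intros)
      then show "continuous_on Z (\<lambda>z. v \<epsilon> (0, z))" by simp
      fix z assume "z \<in> Z"
      then obtain \<delta> where \<delta>: "\<delta> > 0" "cball z \<delta> \<subseteq> Z" using \<open>open Z\<close> open_contains_cball by blast
      have sub: "D0 \<times> cball z \<delta> \<subseteq> D \<times> Z" using \<delta>(2) D0(3) by auto
      obtain L where "\<And>s z' x y. s \<in> {0..1} \<Longrightarrow> z' \<in> cball z \<delta> \<Longrightarrow> x \<in> D0 \<Longrightarrow> y \<in> D0 \<Longrightarrow>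
          norm (H \<epsilon> (s, x, z') - H \<epsilon> (s, y, z')) \<le> L * norm (x - y)"
      proof (rule lipschitz_first_slot[OF D0(1,2) compact_cball, of z \<delta> "H \<epsilon>" "H' \<epsilon>"])
        show "((\<lambda>q. H \<epsilon> (s, q)) has_derivative H' \<epsilon> (s, q)) (at q)"
          if "s \<in> {0..1}" "q \<in> D0 \<times> cball z \<delta>" for s q
          by (rule H'(1)[OF \<epsilon> that(1) subsetD[OF sub that(2)]])
        show "continuous_on ({0..1} \<times> D0 \<times> cball z \<delta>) (\<lambda>q. H' \<epsilon> q b)" if "b \<in> Basis" for b
          using cH'[OF that \<epsilon>] by (rule continuous_on_subset) (use sub in auto)
      qed blast
      then show "\<exists>\<delta>>0. \<exists>L. \<forall>z'\<in>ball z \<delta> \<inter> Z. \<forall>s\<in>{0..1}. \<forall>x\<in>D0. \<forall>y\<in>D0.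
          norm (H \<epsilon> (s, x, z') - H \<epsilon> (s, y, z')) \<le> L * norm (x - y)"
        using \<delta>(1) by (meson IntD1 ball_subset_cball subsetD)
    qed (use assms(2) v[OF \<epsilon>] in auto)
    moreover have "moderate_bound ({0..1} \<times> K) v" if "K \<subseteq> Z" for K
    proof -
      obtain C where "\<And>x. x \<in> D0 \<Longrightarrow> norm x \<le> C"
        using compact_imp_bounded[OF D0(1)] by (auto simp: bounded_iff)
      then have "\<forall>\<^sub>F \<epsilon> in at_right 0. \<forall>q\<in>{0..1} \<times> K. norm (v \<epsilon> q) \<le> C * (1 / \<epsilon>) ^ 0"
        using eventually_at_right_small[OF assms(3)]
        by (elim eventually_mono) (use v(1) that in auto)
      then show ?thesis by (rule moderate_boundI)
    qed
    ultimately show ?case by (simp add: moderate_C0_def)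
  next
    case (Suc k)
    have along: "moderate_Ck k e Z (\<lambda>\<epsilon> q. H' \<epsilon> (fst q, v \<epsilon> q, snd q) d)" if "d \<in> Basis" for d
    proof (rule moderate_Ck_compose[where f = "\<lambda>\<epsilon> q. (v \<epsilon> q, snd q)", OF H'(2)[OF that]])
      show "moderate_Ck k e Z (\<lambda>\<epsilon> q. (v \<epsilon> q, snd q))"
        by (intro moderate_Ck_Pair Suc.IH moderate_Ck_linear[of "\<lambda>z. z"] bounded_linear_ident)
      show "\<exists>L. compact L \<and> L \<subseteq> D \<times> Z \<and> (\<forall>\<^sub>F \<epsilon> in at_right 0. \<forall>q\<in>{0..1} \<times> K. (v \<epsilon> q, snd q) \<in> L)"
        if "compact K" "K \<subseteq> Z" for K
      proof (intro exI[of _ "D0 \<times> K"] conjI)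
        show "\<forall>\<^sub>F \<epsilon> in at_right 0. \<forall>q\<in>{0..1} \<times> K. (v \<epsilon> q, snd q) \<in> D0 \<times> K"
          using eventually_at_right_small[OF assms(3)]
          by (elim eventually_mono) (use v(1) that in auto)
      qed (use that D0 in \<open>auto intro: compact_Times\<close>)
    qed (use assms(3) v(1) D0(3) in auto)
    show ?case
    proof (rule moderate_Ck_Suc_variational[where D = D and H = H and H' = H'])
      fix b :: 'z and y assume b: "b \<in> Basis"
        and y0: "moderate_Ck k e Z (\<lambda>\<epsilon> q. y \<epsilon> (0, snd q))"
        and y: "\<And>\<epsilon> s z. \<epsilon> \<in> {0<..e} \<Longrightarrow> s \<in> {0..1} \<Longrightarrow> z \<in> Z \<Longrightarrow>
          ((\<lambda>s. y \<epsilon> (s, z)) has_vector_derivative H' \<epsilon> (s, v \<epsilon> (s, z), z) (y \<epsilon> (s, z), b)) (at s within {0..1})"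
      show "moderate_Ck k e Z y"
      proof (rule linear_ode_moderate_Ck[where A = "\<lambda>c \<epsilon> q. H' \<epsilon> (fst q, v \<epsilon> q, snd q) (c, 0)"
            and B = "\<lambda>\<epsilon> q. H' \<epsilon> (fst q, v \<epsilon> q, snd q) (0, b)", OF assms(2,3) _ along along y0])
        fix \<epsilon> s z assume *: "\<epsilon> \<in> {0<..e}" "s \<in> {0..1::real}" "z \<in> Z"
        have "((\<lambda>q. H \<epsilon> (s, q)) has_derivative H' \<epsilon> (s, v \<epsilon> (s, z), z)) (at (v \<epsilon> (s, z), z))"
          using H'(1)[OF *(1,2), of "(v \<epsilon> (s, z), z)"] v(1)[OF *] D0(3) *(3) by auto
        then interpret L: bounded_linear "H' \<epsilon> (s, v \<epsilon> (s, z), z)" by (rule has_derivative_bounded_linear)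
        have "(y \<epsilon> (s, z), b) = (\<Sum>c\<in>Basis. (y \<epsilon> (s, z) \<bullet> c) *\<^sub>R (c, 0)) + (0, b)"
          by (simp add: prod_eq_iff fst_sum snd_sum euclidean_representation)
        then have "H' \<epsilon> (s, v \<epsilon> (s, z), z) (y \<epsilon> (s, z), b) =
            (\<Sum>c\<in>Basis. (y \<epsilon> (s, z) \<bullet> c) *\<^sub>R H' \<epsilon> (s, v \<epsilon> (s, z), z) (c, 0)) + H' \<epsilon> (s, v \<epsilon> (s, z), z) (0, b)"
          by (simp only: L.add L.sum L.scaleR)
        then show "((\<lambda>s. y \<epsilon> (s, z)) has_vector_derivative
            (\<Sum>c\<in>Basis. (y \<epsilon> (s, z) \<bullet> c) *\<^sub>R H' \<epsilon> (fst (s, z), v \<epsilon> (s, z), snd (s, z)) (c, 0)) +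
              H' \<epsilon> (fst (s, z), v \<epsilon> (s, z), snd (s, z)) (0, b)) (at s within {0..1})"
          using y[OF *] by simp
      next
        fix K assume K: "compact K" "K \<subseteq> Z"
        obtain C where "\<forall>\<^sub>F \<epsilon> in at_right 0. \<forall>s\<in>{0..1}. \<forall>x\<in>D0. \<forall>z\<in>K. \<forall>c\<in>Basis.
            norm (frechet_derivative (\<lambda>q. H \<epsilon> (s, q)) (at (x, z)) (c, 0)) \<le> C * \<bar>ln \<epsilon>\<bar>"
          using H_log[OF K] by blast
        then have "\<forall>\<^sub>F \<epsilon> in at_right 0. \<forall>q\<in>{0..1} \<times> K. \<forall>c\<in>Basis.
            norm (H' \<epsilon> (fst q, v \<epsilon> q, snd q) (c, 0)) \<le> C * \<bar>ln \<epsilon>\<bar>"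
          using eventually_at_right_small[OF assms(3)]
          by eventually_elim (use v(1) K in \<open>auto simp: H'_def subset_iff\<close>)
        then show "\<exists>C. \<forall>\<^sub>F \<epsilon> in at_right 0. \<forall>q\<in>{0..1} \<times> K. \<forall>c\<in>Basis.
            norm (H' \<epsilon> (fst q, v \<epsilon> q, snd q) (c, 0)) \<le> C * \<bar>ln \<epsilon>\<bar>" by blast
      qed (use b in \<open>auto simp: Basis_prod_def\<close>)
    qed (use assms(1-3) H'(1) cH' v D0(3) init moderate_Ck_C0[OF Suc.IH] in blast)+
  }
qed

section \<open>Colombeau classes via zeroth order estimates\<close>

lemma compactly_in_open: "open U \<Longrightarrow> compactly_in K U \<longleftrightarrow> compact K \<and> K \<subseteq> U"
  by (simp add: compactly_in_def interior_open)

text \<open>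
  A composition with a \<open>c\<close>-bounded net is smooth for small \<open>\<epsilon>\<close> only, hence membership in
  \<^const>\<open>moderate_nets\<close>, which asks for smoothness for all \<open>\<epsilon> \<in> (0, 1]\<close>, is not preserved by the
  operations below. This weaker property is.
\<close>
definition eventually_moderate ::
  "'a::euclidean_space set \<Rightarrow> (real \<Rightarrow> 'a \<Rightarrow> 'b::real_normed_vector) \<Rightarrow> bool" where
  "eventually_moderate U f \<longleftrightarrow> (\<exists>e\<in>{0<..1}. \<forall>k. moderate_Ck k e U (\<lambda>\<epsilon> q. f \<epsilon> (snd q)))"

definition null_on_compacts ::
  "'a::euclidean_space set \<Rightarrow> (real \<Rightarrow> 'a \<Rightarrow> 'b::real_normed_vector) \<Rightarrow> bool" where
  "null_on_compacts U f \<longleftrightarrow> (\<forall>K. compact K \<longrightarrow> K \<subseteq> U \<longrightarrow> null_bound K f)"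

text \<open>
  The two conditions of \<^const>\<open>c_bounded\<close> apart from moderateness.
\<close>
definition maps_c_boundedly ::
  "'a::euclidean_space set \<Rightarrow> 'b::real_normed_vector set \<Rightarrow> (real \<Rightarrow> 'a \<Rightarrow> 'b) \<Rightarrow> bool" where
  "maps_c_boundedly U V f \<longleftrightarrow> (\<forall>\<^sub>F \<epsilon> in at_right 0. f \<epsilon> ` U \<subseteq> V) \<and>
     (\<forall>K. compact K \<longrightarrow> K \<subseteq> U \<longrightarrow> (\<exists>L. compact L \<and> L \<subseteq> V \<and> (\<forall>\<^sub>F \<epsilon> in at_right 0. f \<epsilon> ` K \<subseteq> L)))"

lemma null_on_compactsD: "null_on_compacts U f \<Longrightarrow> compact K \<Longrightarrow> K \<subseteq> U \<Longrightarrow> null_bound K f"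
  by (simp add: null_on_compacts_def)

lemma c_bounded_iff:
  assumes "open U" "open V"
  shows "c_bounded U V u \<longleftrightarrow> u \<in> moderate_nets U \<and> maps_c_boundedly U V u"
  unfolding c_bounded_def maps_c_boundedly_def eventually_at_right_iff_le
  by (auto simp: compactly_in_open[OF assms(1)] compactly_in_open[OF assms(2)])

lemma maps_c_boundedly_Pair:
  fixes f :: "real \<Rightarrow> 'z::euclidean_space \<Rightarrow> 'a::real_normed_vector"
    and g :: "real \<Rightarrow> 'z \<Rightarrow> 'b::real_normed_vector"
  assumes "maps_c_boundedly Z U f" "maps_c_boundedly Z V g"
  shows "maps_c_boundedly Z (U \<times> V) (\<lambda>\<epsilon> z. (f \<epsilon> z, g \<epsilon> z))"
  unfolding maps_c_boundedly_def
proof (intro conjI allI impI)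
  have "\<forall>\<^sub>F \<epsilon> in at_right 0. f \<epsilon> ` Z \<subseteq> U" "\<forall>\<^sub>F \<epsilon> in at_right 0. g \<epsilon> ` Z \<subseteq> V"
    using assms by (simp_all add: maps_c_boundedly_def)
  then show "\<forall>\<^sub>F \<epsilon> in at_right 0. (\<lambda>z. (f \<epsilon> z, g \<epsilon> z)) ` Z \<subseteq> U \<times> V" by eventually_elim auto
next
  fix K assume K: "compact K" "K \<subseteq> Z"
  obtain L where L: "compact L" "L \<subseteq> U" "\<forall>\<^sub>F \<epsilon> in at_right 0. f \<epsilon> ` K \<subseteq> L"
    using assms(1) K by (auto simp: maps_c_boundedly_def)
  obtain M where M: "compact M" "M \<subseteq> V" "\<forall>\<^sub>F \<epsilon> in at_right 0. g \<epsilon> ` K \<subseteq> M"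
    using assms(2) K by (auto simp: maps_c_boundedly_def)
  have "\<forall>\<^sub>F \<epsilon> in at_right 0. (\<lambda>z. (f \<epsilon> z, g \<epsilon> z)) ` K \<subseteq> L \<times> M" using L(3) M(3) by eventually_elim auto
  then show "\<exists>L. compact L \<and> L \<subseteq> U \<times> V \<and> (\<forall>\<^sub>F \<epsilon> in at_right 0. (\<lambda>z. (f \<epsilon> z, g \<epsilon> z)) ` K \<subseteq> L)"
    using compact_Times[OF L(1) M(1)] L(2) M(2) by (intro exI[of _ "L \<times> M"]) auto
qed

lemma maps_c_boundedly_continuous:
  assumes "continuous_on Z f" "f ` Z \<subseteq> V"
  shows "maps_c_boundedly Z V (\<lambda>\<epsilon>. f)"
  unfolding maps_c_boundedly_def
proof (intro conjI allI impI)
  fix K assume K: "compact K" "K \<subseteq> Z"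
  show "\<exists>L. compact L \<and> L \<subseteq> V \<and> (\<forall>\<^sub>F \<epsilon> in at_right 0. f ` K \<subseteq> L)"
    using K assms compact_continuous_image[OF continuous_on_subset[OF assms(1) K(2)] K(1)]
    by (intro exI[of _ "f ` K"]) auto
qed (use assms(2) in simp)

lemma maps_c_boundedly_param:
  assumes "compact K" "K \<subseteq> V" "\<forall>\<^sub>F \<epsilon> in at_right 0. p \<epsilon> \<in> K"
  shows "maps_c_boundedly Z V (\<lambda>\<epsilon> z. p \<epsilon>)"
  unfolding maps_c_boundedly_def
proof (intro conjI allI impI)
  show "\<forall>\<^sub>F \<epsilon> in at_right 0. (\<lambda>z. p \<epsilon>) ` Z \<subseteq> V" using assms(3) by eventually_elim (use assms(2) in auto)
  show "\<exists>L. compact L \<and> L \<subseteq> V \<and> (\<forall>\<^sub>F \<epsilon> in at_right 0. (\<lambda>z. p \<epsilon>) ` S \<subseteq> L)" for S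
    using assms by (intro exI[of _ K]) (auto elim: eventually_mono)
qed

lemma maps_c_boundedly_into_compact:
  assumes "\<forall>\<^sub>F \<epsilon> in at_right 0. f \<epsilon> ` U \<subseteq> L" "compact L" "L \<subseteq> V"
  shows "maps_c_boundedly U V f"
  unfolding maps_c_boundedly_def
proof (intro conjI allI impI)
  show "\<forall>\<^sub>F \<epsilon> in at_right 0. f \<epsilon> ` U \<subseteq> V" using assms(1) by eventually_elim (use assms(3) in auto)
  fix K assume "K \<subseteq> U"
  have "\<forall>\<^sub>F \<epsilon> in at_right 0. f \<epsilon> ` K \<subseteq> L" using assms(1) by eventually_elim (use \<open>K \<subseteq> U\<close> in auto)
  then show "\<exists>L. compact L \<and> L \<subseteq> V \<and> (\<forall>\<^sub>F \<epsilon> in at_right 0. f \<epsilon> ` K \<subseteq> L)" using assms(2,3) by blast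
qed

lemma maps_c_boundedly_mono:
  assumes "maps_c_boundedly U V f" "V \<subseteq> W"
  shows "maps_c_boundedly U W f"
  unfolding maps_c_boundedly_def
proof (intro conjI allI impI)
  have "\<forall>\<^sub>F \<epsilon> in at_right 0. f \<epsilon> ` U \<subseteq> V" using assms(1) by (simp add: maps_c_boundedly_def)
  then show "\<forall>\<^sub>F \<epsilon> in at_right 0. f \<epsilon> ` U \<subseteq> W" by eventually_elim (use assms(2) in auto)
  fix K assume "compact K" "K \<subseteq> U"
  then show "\<exists>L. compact L \<and> L \<subseteq> W \<and> (\<forall>\<^sub>F \<epsilon> in at_right 0. f \<epsilon> ` K \<subseteq> L)"
    using assms unfolding maps_c_boundedly_def by (meson order_trans)
qed

lemma maps_c_boundedly_compose:
  assumes "maps_c_boundedly U V f" "maps_c_boundedly V W g"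
  shows "maps_c_boundedly U W (\<lambda>\<epsilon> x. g \<epsilon> (f \<epsilon> x))"
  unfolding maps_c_boundedly_def
proof (intro conjI allI impI)
  have "\<forall>\<^sub>F \<epsilon> in at_right 0. f \<epsilon> ` U \<subseteq> V" "\<forall>\<^sub>F \<epsilon> in at_right 0. g \<epsilon> ` V \<subseteq> W"
    using assms by (simp_all add: maps_c_boundedly_def)
  then show "\<forall>\<^sub>F \<epsilon> in at_right 0. (\<lambda>x. g \<epsilon> (f \<epsilon> x)) ` U \<subseteq> W" by eventually_elim auto
  fix K assume "compact K" "K \<subseteq> U"
  then obtain L where L: "compact L" "L \<subseteq> V" "\<forall>\<^sub>F \<epsilon> in at_right 0. f \<epsilon> ` K \<subseteq> L"
    using assms(1) by (auto simp: maps_c_boundedly_def)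
  then obtain M where M: "compact M" "M \<subseteq> W" "\<forall>\<^sub>F \<epsilon> in at_right 0. g \<epsilon> ` L \<subseteq> M"
    using assms(2) by (auto simp: maps_c_boundedly_def)
  have "\<forall>\<^sub>F \<epsilon> in at_right 0. (\<lambda>x. g \<epsilon> (f \<epsilon> x)) ` K \<subseteq> M" using L(3) M(3) by eventually_elim auto
  then show "\<exists>L. compact L \<and> L \<subseteq> W \<and> (\<forall>\<^sub>F \<epsilon> in at_right 0. (\<lambda>x. g \<epsilon> (f \<epsilon> x)) ` K \<subseteq> L)" using M by blast
qed

lemma compact_neighbourhood:
  fixes K U :: "'a::euclidean_space set"
  assumes "compact K" "open U" "K \<subseteq> U"
  obtains \<rho> K' where "\<rho> > 0" "compact K'" "K' \<subseteq> U" "\<And>x y. x \<in> K \<Longrightarrow> dist x y \<le> \<rho> \<Longrightarrow> y \<in> K'"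
proof -
  obtain \<rho> where \<rho>: "\<rho> > 0" "(\<Union>x\<in>K. cball x \<rho>) \<subseteq> U"
    using compact_subset_open_imp_cball_epsilon_subset[OF assms] .
  define K' where "K' = (\<lambda>(x, d). x + d) ` (K \<times> cball 0 \<rho>)"
  have "compact K'" unfolding K'_def split_beta
    by (intro compact_continuous_image compact_Times assms(1) compact_cball continuous_intros)
  moreover have "K' \<subseteq> U" using \<rho>(2) by (force simp: K'_def dist_norm)
  moreover have "y \<in> K'" if "x \<in> K" "dist x y \<le> \<rho>" for x y
    unfolding K'_def using that by (intro image_eqI[of _ _ "(x, y - x)"]) (auto simp: dist_norm norm_minus_commute)
  ultimately show ?thesis using \<rho>(1) that by blast
qed

lemma moderate_Ck_pderivs:
  assumes "open U" "e > 0" "set bs \<subseteq> Basis" "\<And>k. moderate_Ck k e U (\<lambda>\<epsilon> q. f \<epsilon> (snd q))"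
  shows "moderate_Ck k e U (\<lambda>\<epsilon> q. pderivs bs (f \<epsilon>) (snd q))"
  using assms(3)
proof (induction bs arbitrary: k)
  case Nil
  then show ?case using assms(4) by simp
next
  case (Cons b bs)
  have "moderate_Ck (Suc k) e U (\<lambda>\<epsilon> q. pderivs bs (f \<epsilon>) (snd q))" using Cons by auto
  from moderate_Ck_frechet_derivative(2)[OF assms(1,2) this, of b] Cons.prems show ?case
    by simp
qed

lemma pderivs_differentiable:
  assumes "open U" "e > 0" "set bs \<subseteq> Basis" "\<And>k. moderate_Ck k e U (\<lambda>\<epsilon> q. f \<epsilon> (snd q))"
    and "\<epsilon> \<in> {0<..e}" "x \<in> U"
  shows "pderivs bs (f \<epsilon>) differentiable (at x)"
  using moderate_Ck_frechet_derivative(1)[OF assms(1,2) moderate_Ck_pderivs[OF assms(1-4), of "Suc 0"] assms(5) _ assms(6), of 0]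
  by (auto simp: differentiable_def)

lemma moderate_bound_Times_iff:
  assumes "T \<noteq> {}"
  shows "moderate_bound (T \<times> K) (\<lambda>\<epsilon> q. f \<epsilon> (snd q)) \<longleftrightarrow> moderate_bound K f"
proof -
  have "(\<forall>q\<in>T \<times> K. P (snd q)) \<longleftrightarrow> (\<forall>x\<in>K. P x)" for P using assms by force
  then show ?thesis unfolding moderate_bound_def by simp
qed

text \<open>
  Together with \<open>moderate_Ck_pderivs\<close> this translates between iterated partial derivatives and the
  recursive predicate.
\<close>
lemma moderate_Ck_of_moderate_nets:
  assumes "open U" "f \<in> moderate_nets U"
  shows "moderate_Ck k 1 U (\<lambda>\<epsilon> q. f \<epsilon> (snd q))"
proof -
  have diff: "pderivs bs (f \<epsilon>) differentiable (at x)" if "set bs \<subseteq> Basis" "\<epsilon> \<in> {0<..1}" "x \<in> U" for bs \<epsilon> x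
    using assms(2) that by (auto simp: moderate_nets_def smooth_nets_def smooth_on_def)
  have C0: "moderate_C0 1 U (\<lambda>\<epsilon> q. pderivs bs (f \<epsilon>) (snd q))" if bs: "set bs \<subseteq> Basis" for bs
    unfolding moderate_C0_def
  proof (intro conjI ballI allI impI)
    fix \<epsilon> :: real assume "\<epsilon> \<in> {0<..1}"
    then have "continuous_on U (pderivs bs (f \<epsilon>))"
      using diff[OF bs] by (meson continuous_at_imp_continuous_on differentiable_imp_continuous_within)
    then show "continuous_on ({0..1} \<times> U) (\<lambda>q. pderivs bs (f \<epsilon>) (snd q))"
      by (rule continuous_on_compose2) (auto intro!: continuous_intros)
  next
    fix K assume "compact K" "K \<subseteq> U"
    then have "\<exists>N::nat. sup_bigo K (\<lambda>\<epsilon>. pderivs bs (f \<epsilon>)) (\<lambda>\<epsilon>. 1 / \<epsilon> ^ N)"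
      using assms bs by (simp add: moderate_nets_def compactly_in_open)
    then show "moderate_bound ({0..1::real} \<times> K) (\<lambda>\<epsilon> q. pderivs bs (f \<epsilon>) (snd q))"
      using moderate_bound_Times_iff[of "{0..1::real}" K "\<lambda>\<epsilon>. pderivs bs (f \<epsilon>)"]
      by (simp add: sup_bigo_moderate_iff)
  qed
  have "moderate_Ck k 1 U (\<lambda>\<epsilon> q. pderivs bs (f \<epsilon>) (snd q))" if "set bs \<subseteq> Basis" for bs
    using that
  proof (induction k arbitrary: bs)
    case 0
    then show ?case using C0 by simp
  next
    case (Suc k)
    show ?case
    proof (rule moderate_CkI[where f' = "\<lambda>\<epsilon> q. frechet_derivative (pderivs bs (f \<epsilon>)) (at (snd q))", OF C0[OF Suc.prems]])
      show "((\<lambda>z. pderivs bs (f \<epsilon>) (snd (s, z))) has_derivative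
          frechet_derivative (pderivs bs (f \<epsilon>)) (at (snd (s, z)))) (at z)"
        if "\<epsilon> \<in> {0<..1}" "z \<in> U" for \<epsilon> s z
        using diff[OF Suc.prems that] by (simp add: frechet_derivative_works)
      show "moderate_Ck k 1 U (\<lambda>\<epsilon> q. frechet_derivative (pderivs bs (f \<epsilon>)) (at (snd q)) b)"
        if "b \<in> Basis" for b
        using Suc.IH[of "b # bs"] Suc.prems that by simp
    qed
  qed
  from this[of "[]"] show ?thesis by simp
qed

lemma moderate_nets_imp_eventually_moderate:
  "open U \<Longrightarrow> f \<in> moderate_nets U \<Longrightarrow> eventually_moderate U f"
  unfolding eventually_moderate_def by (intro bexI[of _ 1]) (auto intro: moderate_Ck_of_moderate_nets)

lemma eventually_moderate_pderivs_bound: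
  assumes "open U" "eventually_moderate U f" "set bs \<subseteq> Basis" "compact K" "K \<subseteq> U"
  shows "moderate_bound K (\<lambda>\<epsilon>. pderivs bs (f \<epsilon>))"
proof -
  obtain e where e: "e \<in> {0<..1}" "\<And>k. moderate_Ck k e U (\<lambda>\<epsilon> q. f \<epsilon> (snd q))"
    using assms(2) by (auto simp: eventually_moderate_def)
  have "moderate_C0 e U (\<lambda>\<epsilon> q. pderivs bs (f \<epsilon>) (snd q))"
    using moderate_Ck_pderivs[OF assms(1) _ assms(3) e(2), of 0] e(1) by simp
  then have "moderate_bound ({0..1::real} \<times> K) (\<lambda>\<epsilon> q. pderivs bs (f \<epsilon>) (snd q))"
    using assms(4,5) by (rule moderate_C0_bound)
  then show ?thesis
    using moderate_bound_Times_iff[of "{0..1::real}" K "\<lambda>\<epsilon>. pderivs bs (f \<epsilon>)"] by simp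
qed

lemma eventually_moderate_imp_moderate_nets:
  assumes "open U" "eventually_moderate U f" "f \<in> smooth_nets U"
  shows "f \<in> moderate_nets U"
  unfolding moderate_nets_def sup_bigo_moderate_iff
  using assms eventually_moderate_pderivs_bound[OF assms(1,2)] by (auto simp: compactly_in_open)

lemma eventually_moderate_smooth:
  assumes "open U" "eventually_moderate U f"
  shows "\<exists>e\<in>{0<..1}. \<forall>\<epsilon>\<in>{0<..e}. smooth_on U (f \<epsilon>)"
proof -
  obtain e where e: "e \<in> {0<..1}" "\<And>k. moderate_Ck k e U (\<lambda>\<epsilon> q. f \<epsilon> (snd q))"
    using assms(2) by (auto simp: eventually_moderate_def)
  have "smooth_on U (f \<epsilon>)" if "\<epsilon> \<in> {0<..e}" for \<epsilon>
    unfolding smooth_on_def using pderivs_differentiable[OF assms(1) _ _ e(2) that] e(1) by auto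
  then show ?thesis using e(1) by blast
qed

lemma smooth_on_const: "smooth_on U (\<lambda>x. c)"
proof -
  have "\<exists>d. pderivs bs (\<lambda>x::'a. c) = (\<lambda>x. d)" for bs
  proof (induction bs)
    case (Cons b bs)
    then obtain d where "pderivs bs (\<lambda>x::'a. c) = (\<lambda>x. d)" by blast
    then show ?case by (auto simp: frechet_derivative_const)
  qed auto
  then show ?thesis unfolding smooth_on_def by (metis differentiable_const)
qed

lemma eventually_moderate_cong:
  assumes "open U" "eventually_moderate U f" "\<forall>\<^sub>F \<epsilon> in at_right 0. \<forall>x\<in>U. f \<epsilon> x = g \<epsilon> x"
  shows "eventually_moderate U g"
proof -
  obtain e where e: "e \<in> {0<..1}" "\<And>k. moderate_Ck k e U (\<lambda>\<epsilon> q. f \<epsilon> (snd q))"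
    using assms(2) by (auto simp: eventually_moderate_def)
  obtain e' where e': "e' \<in> {0<..1}" "\<And>\<epsilon> x. \<epsilon> \<in> {0<..e'} \<Longrightarrow> x \<in> U \<Longrightarrow> f \<epsilon> x = g \<epsilon> x"
    using assms(3) unfolding eventually_at_right_iff_le by blast
  have "moderate_Ck k (min e e') U (\<lambda>\<epsilon> q. g \<epsilon> (snd q))" for k
    by (rule moderate_Ck_cong[OF assms(1) moderate_Ck_subset[OF e(2) min.cobounded1 order_refl]])
      (use e(1) e' in auto)
  then show ?thesis
    unfolding eventually_moderate_def using e(1) e'(1) by (intro bexI[of _ "min e e'"]) auto
qed

text \<open>
  Replacing \<open>f \<epsilon>\<close> by \<open>0\<close> for large \<open>\<epsilon>\<close> gives a member of the class of \<open>f\<close>. In particular, the class is not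
  empty.
\<close>
lemma eventually_moderate_patch:
  assumes "open U" "eventually_moderate U f"
  obtains w where "w \<in> moderate_nets U" "\<forall>\<^sub>F \<epsilon> in at_right 0. w \<epsilon> = f \<epsilon>"
proof -
  obtain e where e: "e \<in> {0<..1}" "\<And>\<epsilon>. \<epsilon> \<in> {0<..e} \<Longrightarrow> smooth_on U (f \<epsilon>)"
    using eventually_moderate_smooth[OF assms] by blast
  define w where "w = (\<lambda>\<epsilon>. if \<epsilon> \<le> e then f \<epsilon> else (\<lambda>_. 0))"
  have ev: "\<forall>\<^sub>F \<epsilon> in at_right 0. w \<epsilon> = f \<epsilon>"
    by (rule eventually_mono[OF eventually_at_right_small[of e]]) (use e(1) in \<open>auto simp: w_def\<close>)
  have "w \<in> smooth_nets U" using e by (auto simp: smooth_nets_def w_def smooth_on_const)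
  moreover have "eventually_moderate U w"
    by (rule eventually_moderate_cong[OF assms]) (use ev in \<open>auto elim: eventually_mono\<close>)
  ultimately show ?thesis using eventually_moderate_imp_moderate_nets[OF assms(1)] ev that by blast
qed

lemma eventually_moderate_common:
  assumes "eventually_moderate U f" "eventually_moderate V g"
  obtains e where "e \<in> {0<..1}" "\<And>k. moderate_Ck k e U (\<lambda>\<epsilon> q. f \<epsilon> (snd q))"
    "\<And>k. moderate_Ck k e V (\<lambda>\<epsilon> q. g \<epsilon> (snd q))"
proof -
  obtain e where e: "e \<in> {0<..1}" "\<And>k. moderate_Ck k e U (\<lambda>\<epsilon> q. f \<epsilon> (snd q))"
    using assms(1) by (auto simp: eventually_moderate_def)
  obtain e' where e': "e' \<in> {0<..1}" "\<And>k. moderate_Ck k e' V (\<lambda>\<epsilon> q. g \<epsilon> (snd q))"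
    using assms(2) by (auto simp: eventually_moderate_def)
  show ?thesis
    by (rule that[of "min e e'"])
      (use e e' moderate_Ck_subset[OF e(2) min.cobounded1 order_refl]
        moderate_Ck_subset[OF e'(2) min.cobounded2 order_refl] in auto)
qed

lemma eventually_moderate_diff:
  assumes "eventually_moderate U f" "eventually_moderate U g"
  shows "eventually_moderate U (\<lambda>\<epsilon> x. f \<epsilon> x - g \<epsilon> x)"
proof -
  obtain e where e: "e \<in> {0<..1}" "\<And>k. moderate_Ck k e U (\<lambda>\<epsilon> q. f \<epsilon> (snd q))"
    "\<And>k. moderate_Ck k e U (\<lambda>\<epsilon> q. g \<epsilon> (snd q))"
    using eventually_moderate_common[OF assms] by blast
  have "moderate_Ck k e U (\<lambda>\<epsilon> q. f \<epsilon> (snd q) - g \<epsilon> (snd q))" for k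
    using moderate_Ck_add[OF e(2) moderate_Ck_bounded_linear[OF bounded_linear_minus[OF bounded_linear_ident] e(3)]]
    by simp
  then show ?thesis using e(1) unfolding eventually_moderate_def by blast
qed

lemma eventually_moderate_Pair:
  assumes "eventually_moderate U f" "eventually_moderate U g"
  shows "eventually_moderate U (\<lambda>\<epsilon> x. (f \<epsilon> x, g \<epsilon> x))"
proof -
  obtain e where e: "e \<in> {0<..1}" "\<And>k. moderate_Ck k e U (\<lambda>\<epsilon> q. f \<epsilon> (snd q))"
    "\<And>k. moderate_Ck k e U (\<lambda>\<epsilon> q. g \<epsilon> (snd q))"
    using eventually_moderate_common[OF assms] by blast
  then show ?thesis using moderate_Ck_Pair[OF e(2,3)] unfolding eventually_moderate_def by blast
qed

lemma eventually_moderate_linear: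
  assumes "bounded_linear f" shows "eventually_moderate U (\<lambda>\<epsilon>. f)"
  unfolding eventually_moderate_def using moderate_Ck_linear[OF assms] by (intro bexI[of _ 1]) auto

text \<open>Nets of constants, i.e. of parameters which are inserted into some slots.\<close>
lemma eventually_moderate_param:
  assumes "\<forall>\<^sub>F \<epsilon> in at_right 0. norm (p \<epsilon>) \<le> (1 / \<epsilon>) ^ N"
  shows "eventually_moderate U (\<lambda>\<epsilon> x. p \<epsilon>)"
proof -
  have C0: "moderate_C0 1 U (\<lambda>\<epsilon> q. p \<epsilon>)"
    using assms by (auto simp: moderate_C0_def moderate_bound_def elim!: eventually_mono)
  have "moderate_Ck k 1 U (\<lambda>\<epsilon> q. p \<epsilon>)" for k
  proof (cases k)
    case (Suc j)
    show ?thesis unfolding Suc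
      by (rule moderate_CkI[where f' = "\<lambda>\<epsilon> q h. 0"]) (use C0 moderate_Ck_zero in auto)
  qed (simp add: C0)
  then show ?thesis unfolding eventually_moderate_def by (intro bexI[of _ 1]) auto
qed

lemma eventually_moderate_compose:
  assumes "eventually_moderate V G" "eventually_moderate U f" "maps_c_boundedly U V f"
  shows "eventually_moderate U (\<lambda>\<epsilon> x. G \<epsilon> (f \<epsilon> x))"
proof -
  obtain e where e: "e \<in> {0<..1}" "\<And>k. moderate_Ck k e V (\<lambda>\<epsilon> q. G \<epsilon> (snd q))"
    "\<And>k. moderate_Ck k e U (\<lambda>\<epsilon> q. f \<epsilon> (snd q))"
    using eventually_moderate_common[OF assms(1,2)] by blast
  obtain e' where e': "e' \<in> {0<..1}" "\<And>\<epsilon>. \<epsilon> \<in> {0<..e'} \<Longrightarrow> f \<epsilon> ` U \<subseteq> V"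
  proof -
    have "\<forall>\<^sub>F \<epsilon> in at_right 0. f \<epsilon> ` U \<subseteq> V" using assms(3) by (simp add: maps_c_boundedly_def)
    then show ?thesis using that unfolding eventually_at_right_iff_le by blast
  qed
  define d where "d = min e e'"
  have d: "d \<in> {0<..1}" "d \<le> e" "d \<le> e'" using e(1) e'(1) by (auto simp: d_def)
  have "moderate_Ck k d U (\<lambda>\<epsilon> q. (\<lambda>\<epsilon> q. G \<epsilon> (snd q)) \<epsilon> (fst q, (\<lambda>\<epsilon> q. f \<epsilon> (snd q)) \<epsilon> q))" for k
  proof (rule moderate_Ck_compose[OF moderate_Ck_subset[OF e(2) d(2) order_refl] moderate_Ck_subset[OF e(3) d(2) order_refl]])
    show "f \<epsilon> (snd (s, z)) \<in> V" if "\<epsilon> \<in> {0<..d}" "z \<in> U" for \<epsilon> s z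
      using e'(2)[of \<epsilon>] that d by auto
    fix K assume "compact K" "K \<subseteq> U"
    then obtain L where L: "compact L" "L \<subseteq> V" "\<forall>\<^sub>F \<epsilon> in at_right 0. f \<epsilon> ` K \<subseteq> L"
      using assms(3) by (auto simp: maps_c_boundedly_def)
    have "\<forall>\<^sub>F \<epsilon> in at_right 0. \<forall>q\<in>{0..1::real} \<times> K. f \<epsilon> (snd q) \<in> L"
      using L(3) by eventually_elim auto
    then show "\<exists>L. compact L \<and> L \<subseteq> V \<and> (\<forall>\<^sub>F \<epsilon> in at_right 0. \<forall>q\<in>{0..1::real} \<times> K. f \<epsilon> (snd q) \<in> L)"
      using L by blast
  qed (use d in auto)
  then show ?thesis using d(1) unfolding eventually_moderate_def fst_conv snd_conv by blast
qed

text \<open>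
  The mean value inequality, applied twice; it replaces Taylor's formula for vector-valued maps.
\<close>
lemma taylor_second_order_bound:
  fixes f :: "'a::real_normed_vector \<Rightarrow> 'b::real_normed_vector"
  assumes "0 \<le> \<delta>"
    and "\<And>t. t \<in> {0..\<delta>} \<Longrightarrow> (f has_derivative f' (x + t *\<^sub>R b)) (at (x + t *\<^sub>R b))"
    and "\<And>t. t \<in> {0..\<delta>} \<Longrightarrow> ((\<lambda>y. f' y b) has_derivative f'' (x + t *\<^sub>R b)) (at (x + t *\<^sub>R b))"
    and "\<And>t. t \<in> {0..\<delta>} \<Longrightarrow> norm (f'' (x + t *\<^sub>R b) b) \<le> C"
  shows "norm (f (x + \<delta> *\<^sub>R b) - f x - \<delta> *\<^sub>R f' x b) \<le> C * \<delta> * \<delta>"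
proof -
  have bound: "norm (g t - g 0) \<le> B * t"
    if "\<And>t. t \<in> {0..\<delta>} \<Longrightarrow> (g has_vector_derivative g' t) (at t within {0..\<delta>})"
      "\<And>t. t \<in> {0..\<delta>} \<Longrightarrow> norm (g' t) \<le> B" "t \<in> {0..\<delta>}" for g :: "real \<Rightarrow> 'b" and g' B t
  proof -
    have "norm (g t - g 0) \<le> B * norm (t - 0)"
    proof (rule differentiable_bound[OF convex_real_interval(5)])
      fix s assume s: "s \<in> {0..\<delta>}"
      show "(g has_derivative (\<lambda>h. h *\<^sub>R g' s)) (at s within {0..\<delta>})"
        using that(1)[OF s] by (simp add: has_vector_derivative_def)
      show "onorm (\<lambda>h. h *\<^sub>R g' s) \<le> B"
        by (rule onorm_le) (simp add: mult.commute[of B] mult_left_mono that(2)[OF s])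
    qed (use that(3) in auto)
    then show ?thesis using that(3) by simp
  qed
  have line: "((\<lambda>t. h (x + t *\<^sub>R b)) has_vector_derivative h' b) (at t within {0..\<delta>})"
    if "(h has_derivative h') (at (x + t *\<^sub>R b))" for h :: "'a \<Rightarrow> 'b" and h' t
  proof -
    have "((\<lambda>t. x + t *\<^sub>R b) has_derivative (\<lambda>s. s *\<^sub>R b)) (at t within {0..\<delta>})"
      by (auto intro!: derivative_eq_intros)
    from has_derivative_compose[OF this that] show ?thesis
      using linear_scale[OF has_derivative_linear[OF that]] by (simp add: has_vector_derivative_def)
  qed
  have C: "norm (f' (x + t *\<^sub>R b) b - f' x b) \<le> C * \<delta>" if t: "t \<in> {0..\<delta>}" for t
  proof -
    have "norm (f' (x + t *\<^sub>R b) b - f' (x + 0 *\<^sub>R b) b) \<le> C * t"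
      by (rule bound[where g = "\<lambda>t. f' (x + t *\<^sub>R b) b", OF line[OF assms(3)] assms(4) t])
    also have "C * t \<le> C * \<delta>"
      using t order_trans[OF norm_ge_zero assms(4)[OF t]] by (intro mult_left_mono) simp_all
    finally show ?thesis by simp
  qed
  define g where "g = (\<lambda>t. f (x + t *\<^sub>R b) - t *\<^sub>R f' x b)"
  have "norm (g \<delta> - g 0) \<le> C * \<delta> * \<delta>"
  proof (rule bound[OF _ C])
    show "(g has_vector_derivative f' (x + t *\<^sub>R b) b - f' x b) (at t within {0..\<delta>})"
      if "t \<in> {0..\<delta>}" for t
      unfolding g_def by (intro has_vector_derivative_diff line assms(2) that)
        (auto intro!: derivative_eq_intros)
  qed (use assms(1) in auto)
  then show ?thesis by (simp add: g_def algebra_simps)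
qed

text \<open>
  A moderate net which is negligible in order zero has negligible derivatives: the difference
  quotient with increment \<open>\<epsilon>\<^bsup>m+N+1\<^esup>\<close>, where \<open>N\<close> is the order of the second derivatives, is negligible,
  and by Taylor's formula it differs from the derivative by \<open>O(\<epsilon>\<^sup>m)\<close>.
\<close>
lemma null_on_compacts_frechet_derivative:
  fixes f :: "real \<Rightarrow> 'a::euclidean_space \<Rightarrow> 'b::real_normed_vector"
  assumes U: "open U" and e: "e > 0" and f: "\<And>k. moderate_Ck k e U (\<lambda>\<epsilon> q. f \<epsilon> (snd q))"
    and null: "null_on_compacts U f" and b: "b \<in> Basis"
  shows "null_on_compacts U (\<lambda>\<epsilon> x. frechet_derivative (f \<epsilon>) (at x) b)"
  unfolding null_on_compacts_def
proof (intro allI impI)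
  fix K assume K: "compact K" "K \<subseteq> U"
  obtain \<rho> K' where \<rho>: "\<rho> > 0" "compact K'" "K' \<subseteq> U" "\<And>x y. x \<in> K \<Longrightarrow> dist x y \<le> \<rho> \<Longrightarrow> y \<in> K'"
    using compact_neighbourhood[OF K(1) U K(2)] by metis
  define f1 where "f1 = (\<lambda>\<epsilon> x. frechet_derivative (f \<epsilon>) (at x))"
  define f2 where "f2 = (\<lambda>\<epsilon> x. frechet_derivative (\<lambda>y. f1 \<epsilon> y b) (at x))"
  have f1_eq: "(\<lambda>y. f1 \<epsilon> y b) = pderivs [b] (f \<epsilon>)" for \<epsilon> by (simp add: f1_def)
  have f2_eq: "(\<lambda>y. f2 \<epsilon> y b) = pderivs [b, b] (f \<epsilon>)" for \<epsilon> by (simp add: f2_def f1_def)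
  have f1: "(f \<epsilon> has_derivative f1 \<epsilon> x) (at x)" if "\<epsilon> \<in> {0<..e}" "x \<in> U" for \<epsilon> x
    using pderivs_differentiable[OF U e, of "[]" f, OF _ f that] by (simp add: f1_def frechet_derivative_works)
  have f2: "((\<lambda>y. f1 \<epsilon> y b) has_derivative f2 \<epsilon> x) (at x)" if "\<epsilon> \<in> {0<..e}" "x \<in> U" for \<epsilon> x
    using pderivs_differentiable[OF U e, of "[b]" f, OF _ f that] b
    by (simp add: f2_def f1_def frechet_derivative_works)
  have "eventually_moderate U f"
    unfolding eventually_moderate_def
    using moderate_Ck_subset[OF f min.cobounded1 order_refl] e
    by (intro bexI[of _ "min e 1"] allI) simp_all
  then have "moderate_bound K' (\<lambda>\<epsilon> y. f2 \<epsilon> y b)"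
    unfolding f2_eq by (rule eventually_moderate_pderivs_bound[OF U]) (use b \<rho> in auto)
  then obtain N where N: "\<forall>\<^sub>F \<epsilon> in at_right 0. \<forall>x\<in>K'. norm (f2 \<epsilon> x b) \<le> (1 / \<epsilon>) ^ N"
    by (rule moderate_boundE)
  have null': "null_bound K' f" using null \<rho>(2,3) by (rule null_on_compactsD)
  show "null_bound K (\<lambda>\<epsilon> x. frechet_derivative (f \<epsilon>) (at x) b)"
  proof (rule null_boundI)
    fix m
    have "0 < min e (min 1 \<rho>)" using e \<rho>(1) by simp
    from N null_boundD[OF null', of "2 * m + N + 1"]
    have "\<forall>\<^sub>F \<epsilon> in at_right 0. \<forall>x\<in>K. norm (f1 \<epsilon> x b) \<le> 3 * \<epsilon> ^ m"
      using eventually_at_right_small[OF \<open>0 < min e (min 1 \<rho>)\<close>]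
    proof eventually_elim
      case (elim \<epsilon>)
      then have \<epsilon>: "0 < \<epsilon>" "\<epsilon> \<le> e" "\<epsilon> \<le> 1" "\<epsilon> \<le> \<rho>" by auto
      define \<delta> where "\<delta> = \<epsilon> ^ (m + N + 1)"
      have \<delta>: "\<delta> > 0" using \<epsilon> by (simp add: \<delta>_def)
      have "\<delta> \<le> \<epsilon> ^ 1" unfolding \<delta>_def using \<epsilon> by (intro power_decreasing) auto
      then have \<delta>\<rho>: "\<delta> \<le> \<rho>" using \<epsilon>(4) unfolding power_one_right by linarith
      \<comment> \<open>the increment \<open>\<delta>\<close> beats the second derivative of order \<open>-N\<close>, and \<open>f\<close> of order
        \<open>2 m + N + 1\<close> is still \<open>O(\<epsilon>\<^sup>m)\<close> after division by \<open>\<delta>\<close>\<close>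
      have "norm (f1 \<epsilon> x b) \<le> 3 * \<epsilon> ^ m" if x: "x \<in> K" for x
      proof -
        have inK': "x + t *\<^sub>R b \<in> K'" if "t \<in> {0..\<delta>}" for t
          using \<rho>(4)[OF x, of "x + t *\<^sub>R b"] that \<delta>\<rho> b by (auto simp: dist_norm)
        have inU: "x + t *\<^sub>R b \<in> U" if "t \<in> {0..\<delta>}" for t using inK'[OF that] \<rho>(3) by auto
        have "norm (f \<epsilon> (x + \<delta> *\<^sub>R b) - f \<epsilon> x - \<delta> *\<^sub>R f1 \<epsilon> x b) \<le> (1 / \<epsilon>) ^ N * \<delta> * \<delta>"
          by (rule taylor_second_order_bound[where f'' = "f2 \<epsilon>"])
            (use \<delta> f1 f2 inU inK' elim(1) \<epsilon> in auto)
        moreover have "norm (f \<epsilon> (x + \<delta> *\<^sub>R b)) \<le> \<epsilon> ^ (2 * m + N + 1)" "norm (f \<epsilon> x) \<le> \<epsilon> ^ (2 * m + N + 1)"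
          using elim(2) inK'[of \<delta>] inK'[of 0] \<delta> by auto
        moreover have "norm (\<delta> *\<^sub>R f1 \<epsilon> x b) \<le> norm (f \<epsilon> (x + \<delta> *\<^sub>R b) - f \<epsilon> x - \<delta> *\<^sub>R f1 \<epsilon> x b)
            + (norm (f \<epsilon> (x + \<delta> *\<^sub>R b)) + norm (f \<epsilon> x))"
          using norm_triangle_ineq4[of "f \<epsilon> (x + \<delta> *\<^sub>R b) - f \<epsilon> x"
              "f \<epsilon> (x + \<delta> *\<^sub>R b) - f \<epsilon> x - \<delta> *\<^sub>R f1 \<epsilon> x b"]
            norm_triangle_ineq4[of "f \<epsilon> (x + \<delta> *\<^sub>R b)" "f \<epsilon> x"] by simp
        ultimately have "\<delta> * norm (f1 \<epsilon> x b) \<le> (1 / \<epsilon>) ^ N * \<delta> * \<delta> + 2 * \<epsilon> ^ (2 * m + N + 1)"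
          using \<delta> by simp
        also have "2 * \<epsilon> ^ (2 * m + N + 1) = \<delta> * (2 * \<epsilon> ^ m)"
        proof -
          have "\<epsilon> ^ (2 * m + N + 1) = \<delta> * \<epsilon> ^ m"
            unfolding \<delta>_def power_add[symmetric] by (rule arg_cong[where f = "\<lambda>k. \<epsilon> ^ k"]) simp
          then show ?thesis by simp
        qed
        also have "(1 / \<epsilon>) ^ N * \<delta> * \<delta> + \<delta> * (2 * \<epsilon> ^ m) = \<delta> * ((1 / \<epsilon>) ^ N * \<delta> + 2 * \<epsilon> ^ m)"
          by (simp add: algebra_simps)
        finally have "norm (f1 \<epsilon> x b) \<le> (1 / \<epsilon>) ^ N * \<delta> + 2 * \<epsilon> ^ m"
          using \<delta> by simp
        moreover have "(1 / \<epsilon>) ^ N * \<delta> = \<epsilon> ^ (m + 1)"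
        proof -
          have "\<delta> = \<epsilon> ^ N * \<epsilon> ^ (m + 1)"
            unfolding \<delta>_def power_add[symmetric] by (rule arg_cong[where f = "\<lambda>k. \<epsilon> ^ k"]) simp
          then show ?thesis using \<epsilon> by (simp add: power_divide)
        qed
        moreover have "\<epsilon> ^ (m + 1) \<le> \<epsilon> ^ m" using \<epsilon> by (intro power_decreasing) auto
        ultimately show ?thesis by linarith
      qed
      then show ?case by blast
    qed
    then show "\<exists>C. \<forall>\<^sub>F \<epsilon> in at_right 0. \<forall>x\<in>K. norm (frechet_derivative (f \<epsilon>) (at x) b) \<le> C * \<epsilon> ^ m"
      by (auto simp: f1_def)
  qed
qed

lemma null_on_compacts_imp_negligible:
  assumes "open U" "eventually_moderate U f" "null_on_compacts U f"
  shows "negligible_estimates U f"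
proof -
  obtain e where e: "e \<in> {0<..1}" "\<And>k. moderate_Ck k e U (\<lambda>\<epsilon> q. f \<epsilon> (snd q))"
    using assms(2) by (auto simp: eventually_moderate_def)
  have "null_on_compacts U (\<lambda>\<epsilon>. pderivs bs (f \<epsilon>))" if "set bs \<subseteq> Basis" for bs
    using that
  proof (induction bs)
    case Nil
    then show ?case using assms(3) by simp
  next
    case (Cons b bs)
    have "null_on_compacts U (\<lambda>\<epsilon> x. frechet_derivative (pderivs bs (f \<epsilon>)) (at x) b)"
      by (rule null_on_compacts_frechet_derivative[where f = "\<lambda>\<epsilon>. pderivs bs (f \<epsilon>)", OF assms(1)])
        (use e Cons moderate_Ck_pderivs[OF assms(1) _ _ e(2)] in auto)
    then show ?case by simp
  qed
  then show ?thesis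
    unfolding negligible_estimates_def
    by (auto simp: compactly_in_open[OF assms(1)] null_on_compacts_def sup_bigo_null_iff[symmetric])
qed

lemma negligible_imp_null_on_compacts:
  assumes "open U" "negligible_estimates U f" "set bs \<subseteq> Basis"
  shows "null_on_compacts U (\<lambda>\<epsilon>. pderivs bs (f \<epsilon>))"
  using assms unfolding negligible_estimates_def
  by (auto simp: compactly_in_open[OF assms(1)] null_on_compacts_def sup_bigo_null_iff[symmetric])

lemma mem_gf_class_iff:
  assumes "open U" "eventually_moderate U f"
  shows "w \<in> gf_class U f \<longleftrightarrow> w \<in> moderate_nets U \<and> null_on_compacts U (\<lambda>\<epsilon> x. w \<epsilon> x - f \<epsilon> x)"
proof -
  have "negligible_estimates U (\<lambda>\<epsilon> x. w \<epsilon> x - f \<epsilon> x) \<longleftrightarrow> null_on_compacts U (\<lambda>\<epsilon> x. w \<epsilon> x - f \<epsilon> x)"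
    if "w \<in> moderate_nets U"
  proof -
    have "eventually_moderate U (\<lambda>\<epsilon> x. w \<epsilon> x - f \<epsilon> x)"
      by (intro eventually_moderate_diff moderate_nets_imp_eventually_moderate assms that)
    then show ?thesis
      using null_on_compacts_imp_negligible[OF assms(1)]
        negligible_imp_null_on_compacts[OF assms(1), where bs = "[]"] by auto
  qed
  then show ?thesis by (auto simp: gf_class_def)
qed

lemma null_on_compacts_add:
  "null_on_compacts U f \<Longrightarrow> null_on_compacts U g \<Longrightarrow> null_on_compacts U (\<lambda>\<epsilon> x. f \<epsilon> x + g \<epsilon> x)"
  by (simp add: null_on_compacts_def null_bound_add)

lemma null_on_compacts_minus_commute:
  "null_on_compacts U (\<lambda>\<epsilon> x. f \<epsilon> x - g \<epsilon> x) \<longleftrightarrow> null_on_compacts U (\<lambda>\<epsilon> x. g \<epsilon> x - f \<epsilon> x)"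
  by (simp add: null_on_compacts_def null_bound_def norm_minus_commute)

lemma null_on_compacts_trans:
  assumes "null_on_compacts U (\<lambda>\<epsilon> x. f \<epsilon> x - g \<epsilon> x)" "null_on_compacts U (\<lambda>\<epsilon> x. g \<epsilon> x - h \<epsilon> x)"
  shows "null_on_compacts U (\<lambda>\<epsilon> x. f \<epsilon> x - h \<epsilon> x)"
  using null_on_compacts_add[OF assms] by simp

lemma null_on_compacts_eventually_zero:
  assumes "\<forall>\<^sub>F \<epsilon> in at_right 0. \<forall>x\<in>U. f \<epsilon> x = 0"
  shows "null_on_compacts U f"
  unfolding null_on_compacts_def null_bound_def
proof (intro allI impI)
  fix K m assume "K \<subseteq> U"
  show "\<forall>\<^sub>F \<epsilon> in at_right 0. \<forall>x\<in>K. norm (f \<epsilon> x) \<le> \<epsilon> ^ m"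
    using assms eventually_at_right_small[OF zero_less_one]
    by eventually_elim (use \<open>K \<subseteq> U\<close> in auto)
qed

lemma gf_class_eqI:
  assumes "open U" "eventually_moderate U f" "eventually_moderate U g"
    and "null_on_compacts U (\<lambda>\<epsilon> x. f \<epsilon> x - g \<epsilon> x)"
  shows "gf_class U f = gf_class U g"
proof (intro set_eqI)
  fix w
  show "w \<in> gf_class U f \<longleftrightarrow> w \<in> gf_class U g"
    unfolding mem_gf_class_iff[OF assms(1,2)] mem_gf_class_iff[OF assms(1,3)]
    using null_on_compacts_trans[OF _ assms(4)]
      null_on_compacts_trans[OF _ assms(4)[unfolded null_on_compacts_minus_commute[of U f]]] by blast
qed

lemma gf_class_self: "open U \<Longrightarrow> f \<in> moderate_nets U \<Longrightarrow> f \<in> gf_class U f"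
  by (auto simp: mem_gf_class_iff moderate_nets_imp_eventually_moderate intro!: null_on_compacts_eventually_zero)

lemma gf_class_in_gfuns:
  assumes "open U" "eventually_moderate U f"
  shows "gf_class U f \<in> gfuns U"
proof -
  obtain w where w: "w \<in> moderate_nets U" "\<forall>\<^sub>F \<epsilon> in at_right 0. w \<epsilon> = f \<epsilon>"
    using eventually_moderate_patch[OF assms] .
  have "gf_class U f = gf_class U w"
    using w(2) by (intro gf_class_eqI assms moderate_nets_imp_eventually_moderate w null_on_compacts_eventually_zero)
      (auto elim: eventually_mono)
  also have "\<dots> \<in> gfuns U"
    unfolding gf_class_eq_Image[OF assms(1) w(1)] gfuns_def using w(1) by (rule quotientI)
  finally show ?thesis .
qed

lemma gfuns_cases:
  assumes "open U" "u \<in> gfuns U" "w \<in> u"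
  shows "w \<in> moderate_nets U" "u = gf_class U w"
proof -
  obtain f where f: "f \<in> moderate_nets U" "u = gf_class U f"
    using assms(2) gf_class_eq_Image[OF assms(1)] unfolding gfuns_def quotient_def by auto
  note ev = moderate_nets_imp_eventually_moderate[OF assms(1)]
  show w: "w \<in> moderate_nets U" using assms(3) f by (simp add: gf_class_def)
  have "null_on_compacts U (\<lambda>\<epsilon> x. w \<epsilon> x - f \<epsilon> x)"
    using assms(3) unfolding f(2) mem_gf_class_iff[OF assms(1) ev[OF f(1)]] by simp
  then have "gf_class U w = gf_class U f" using gf_class_eqI[OF assms(1) ev[OF w] ev[OF f(1)]] by simp
  then show "u = gf_class U w" using f(2) by simp
qed

lemma gfuns_nonempty: "open U \<Longrightarrow> u \<in> gfuns U \<Longrightarrow> \<exists>w. w \<in> u"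
  unfolding gfuns_def quotient_def using gf_class_eq_Image gf_class_self by fastforce

lemma gf_class_in_gfuns_into:
  assumes "open U" "open V" "eventually_moderate U f" "maps_c_boundedly U V f"
  shows "gf_class U f \<in> gfuns_into U V"
proof -
  obtain w where w: "w \<in> moderate_nets U" "\<forall>\<^sub>F \<epsilon> in at_right 0. w \<epsilon> = f \<epsilon>"
    using eventually_moderate_patch[OF assms(1,3)] .
  have "w \<in> gf_class U f"
    unfolding mem_gf_class_iff[OF assms(1,3)]
    using w by (auto intro!: null_on_compacts_eventually_zero elim: eventually_mono)
  moreover have "maps_c_boundedly U V w"
    unfolding maps_c_boundedly_def
  proof (intro conjI allI impI)
    have "\<forall>\<^sub>F \<epsilon> in at_right 0. f \<epsilon> ` U \<subseteq> V" using assms(4) by (simp add: maps_c_boundedly_def)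
    then show "\<forall>\<^sub>F \<epsilon> in at_right 0. w \<epsilon> ` U \<subseteq> V" using w(2) by eventually_elim simp
    fix K assume "compact K" "K \<subseteq> U"
    then obtain L where L: "compact L" "L \<subseteq> V" "\<forall>\<^sub>F \<epsilon> in at_right 0. f \<epsilon> ` K \<subseteq> L"
      using assms(4) by (auto simp: maps_c_boundedly_def)
    have "\<forall>\<^sub>F \<epsilon> in at_right 0. w \<epsilon> ` K \<subseteq> L" using L(3) w(2) by eventually_elim simp
    then show "\<exists>L. compact L \<and> L \<subseteq> V \<and> (\<forall>\<^sub>F \<epsilon> in at_right 0. w \<epsilon> ` K \<subseteq> L)" using L by blast
  qed
  ultimately show ?thesis
    unfolding gfuns_into_def using gf_class_in_gfuns[OF assms(1,3)] c_bounded_iff[OF assms(1,2)] w(1) by auto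
qed

text \<open>
  Moderate nets are Lipschitz near compact sets with a moderate constant. This is the reason why
  compositions and point values do not depend on the choice of representatives.
\<close>
lemma eventually_moderate_lipschitz:
  fixes G :: "real \<Rightarrow> 'a::euclidean_space \<Rightarrow> 'b::real_normed_vector"
  assumes "open U" "eventually_moderate U G" "compact L" "L \<subseteq> U"
  obtains \<rho> N where "\<rho> > 0" "\<forall>\<^sub>F \<epsilon> in at_right 0. \<forall>x\<in>L. \<forall>y. dist x y \<le> \<rho> \<longrightarrow>
    y \<in> U \<and> norm (G \<epsilon> x - G \<epsilon> y) \<le> (1 / \<epsilon>) ^ N * norm (x - y)"
proof -
  obtain e where e: "e \<in> {0<..1}" "\<And>k. moderate_Ck k e U (\<lambda>\<epsilon> q. G \<epsilon> (snd q))"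
    using assms(2) by (auto simp: eventually_moderate_def)
  have G': "(G \<epsilon> has_derivative frechet_derivative (G \<epsilon>) (at x)) (at x)" if "\<epsilon> \<in> {0<..e}" "x \<in> U" for \<epsilon> x
    using pderivs_differentiable[OF assms(1) _ _ e(2) that, of "[]"] e(1) by (simp add: frechet_derivative_works)
  obtain \<rho> K where \<rho>: "\<rho> > 0" "compact K" "K \<subseteq> U" "\<And>x y. x \<in> L \<Longrightarrow> dist x y \<le> \<rho> \<Longrightarrow> y \<in> K"
    using compact_neighbourhood[OF assms(3,1,4)] by metis
  have bd: "moderate_bound K (\<lambda>\<epsilon> x. frechet_derivative (G \<epsilon>) (at x) b)" if "b \<in> Basis" for b
    using eventually_moderate_pderivs_bound[OF assms(1,2) _ \<rho>(2,3), of "[b]"] that by simp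
  have "moderate_bound K (\<lambda>\<epsilon> x. \<Sum>b\<in>Basis. norm (frechet_derivative (G \<epsilon>) (at x) b))"
    by (intro moderate_bound_sum finite_Basis) (use bd in \<open>simp add: moderate_bound_def\<close>)
  then have "moderate_bound K (\<lambda>\<epsilon> x. real DIM('a) * (\<Sum>b\<in>Basis. norm (frechet_derivative (G \<epsilon>) (at x) b)))"
    by (rule moderate_bound_dominated[where C = "real DIM('a)"]) (auto simp: abs_mult)
  then obtain N where N: "\<forall>\<^sub>F \<epsilon> in at_right 0. \<forall>x\<in>K.
      norm (real DIM('a) * (\<Sum>b\<in>Basis. norm (frechet_derivative (G \<epsilon>) (at x) b))) \<le> (1 / \<epsilon>) ^ N"
    by (rule moderate_boundE)
  have "0 < e" using e(1) by simp
  have "\<forall>\<^sub>F \<epsilon> in at_right 0. \<forall>x\<in>L. \<forall>y. dist x y \<le> \<rho> \<longrightarrow>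
    y \<in> U \<and> norm (G \<epsilon> x - G \<epsilon> y) \<le> (1 / \<epsilon>) ^ N * norm (x - y)"
    using N eventually_at_right_small[OF \<open>0 < e\<close>]
  proof eventually_elim
    case (elim \<epsilon>)
    have "norm (G \<epsilon> x - G \<epsilon> y) \<le> (1 / \<epsilon>) ^ N * norm (x - y)" if "x \<in> L" "dist x y \<le> \<rho>" for x y
    proof (rule differentiable_bound[of "cball x \<rho>" _ "\<lambda>z. frechet_derivative (G \<epsilon>) (at z)"])
      fix z assume "z \<in> cball x \<rho>"
      then have z: "z \<in> K" using \<rho>(4)[OF that(1)] by simp
      have der: "(G \<epsilon> has_derivative frechet_derivative (G \<epsilon>) (at z)) (at z)"
        using G' elim(2) z \<rho>(3) by auto
      then show "(G \<epsilon> has_derivative frechet_derivative (G \<epsilon>) (at z)) (at z within cball x \<rho>)"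
        by (rule has_derivative_at_withinI)
      show "onorm (frechet_derivative (G \<epsilon>) (at z)) \<le> (1 / \<epsilon>) ^ N"
      proof (rule onorm_le)
        fix h
        have "norm (frechet_derivative (G \<epsilon>) (at z) h) \<le>
            real DIM('a) * (\<Sum>b\<in>Basis. norm (frechet_derivative (G \<epsilon>) (at z) b)) * norm h"
          by (rule linear_norm_le_Basis_sum[OF has_derivative_linear[OF der]]) (auto intro!: member_le_sum)
        also have "\<dots> \<le> (1 / \<epsilon>) ^ N * norm h" using elim(1) z by (intro mult_right_mono) force+
        finally show "norm (frechet_derivative (G \<epsilon>) (at z) h) \<le> (1 / \<epsilon>) ^ N * norm h" .
      qed
    qed (use that \<rho>(1) in auto)
    then show ?case using \<rho>(3,4) by blast
  qed
  then show ?thesis using \<rho>(1) that by blast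
qed

lemma null_bound_moderate_image:
  assumes "open U" "eventually_moderate U G" "compact L" "L \<subseteq> U"
    and f: "\<forall>\<^sub>F \<epsilon> in at_right 0. \<forall>k\<in>K. f \<epsilon> k \<in> L"
    and null: "null_bound K (\<lambda>\<epsilon> k. f \<epsilon> k - g \<epsilon> k)"
  shows "null_bound K (\<lambda>\<epsilon> k. G \<epsilon> (f \<epsilon> k) - G \<epsilon> (g \<epsilon> k))"
proof -
  obtain \<rho> N where \<rho>: "\<rho> > 0" 
    and lip: "\<forall>\<^sub>F \<epsilon> in at_right 0. \<forall>x\<in>L. \<forall>y. dist x y \<le> \<rho> \<longrightarrow>
    y \<in> U \<and> norm (G \<epsilon> x - G \<epsilon> y) \<le> (1 / \<epsilon>) ^ N * norm (x - y)"
    by (rule eventually_moderate_lipschitz[OF assms(1-4)])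
  have mod: "moderate_bound K (\<lambda>\<epsilon> k. (1 / \<epsilon>) ^ N)"
    by (rule moderate_boundI[where C = 1 and N = N])
      (rule eventually_mono[OF eventually_at_right_small[OF zero_less_one]], auto)
  show ?thesis
  proof (rule null_bound_dominated[OF null mod])
    show "\<forall>\<^sub>F \<epsilon> in at_right 0. \<forall>k\<in>K. norm (G \<epsilon> (f \<epsilon> k) - G \<epsilon> (g \<epsilon> k))
        \<le> norm ((1 / \<epsilon>) ^ N) * norm (f \<epsilon> k - g \<epsilon> k)"
      using lip f null_boundD[OF null, of 1] eventually_at_right_small[OF \<rho>]
    proof eventually_elim
      case (elim \<epsilon>)
      have "norm (G \<epsilon> (f \<epsilon> k) - G \<epsilon> (g \<epsilon> k)) \<le> (1 / \<epsilon>) ^ N * norm (f \<epsilon> k - g \<epsilon> k)" if "k \<in> K" for k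
      proof -
        have "dist (f \<epsilon> k) (g \<epsilon> k) \<le> \<rho>" using elim(3,4) that by (force simp: dist_norm)
        then show ?thesis using elim(1,2) that by blast
      qed
      then show ?case using elim(4) by auto
    qed
  qed
qed

lemma null_on_compacts_moderate_image:
  assumes "open V" "eventually_moderate V G" "maps_c_boundedly U V f"
    and "null_on_compacts U (\<lambda>\<epsilon> x. f \<epsilon> x - g \<epsilon> x)"
  shows "null_on_compacts U (\<lambda>\<epsilon> x. G \<epsilon> (f \<epsilon> x) - G \<epsilon> (g \<epsilon> x))"
  unfolding null_on_compacts_def
proof (intro allI impI)
  fix K assume K: "compact K" "K \<subseteq> U"
  then obtain L where L: "compact L" "L \<subseteq> V" "\<forall>\<^sub>F \<epsilon> in at_right 0. f \<epsilon> ` K \<subseteq> L"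
    using assms(3) by (auto simp: maps_c_boundedly_def)
  show "null_bound K (\<lambda>\<epsilon> x. G \<epsilon> (f \<epsilon> x) - G \<epsilon> (g \<epsilon> x))"
    by (rule null_bound_moderate_image[OF assms(1,2) L(1,2) _ null_on_compactsD[OF assms(4) K]])
      (use L(3) in \<open>simp add: image_subset_iff\<close>)
qed

lemma null_on_compacts_compose:
  assumes "null_on_compacts V h" "maps_c_boundedly U V f"
  shows "null_on_compacts U (\<lambda>\<epsilon> x. h \<epsilon> (f \<epsilon> x))"
  unfolding null_on_compacts_def
proof (intro allI impI)
  fix K assume K: "compact K" "K \<subseteq> U"
  then obtain L where L: "compact L" "L \<subseteq> V" "\<forall>\<^sub>F \<epsilon> in at_right 0. f \<epsilon> ` K \<subseteq> L"
    using assms(2) by (auto simp: maps_c_boundedly_def)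
  show "null_bound K (\<lambda>\<epsilon> x. h \<epsilon> (f \<epsilon> x))"
    by (rule null_bound_pullback[OF null_on_compactsD[OF assms(1) L(1,2)]])
      (use L(3) in \<open>simp add: image_subset_iff\<close>)
qed

text \<open>
  The class of an eventually moderate net determines the net up to negligible nets because the class is not
  empty.
\<close>
lemma gf_class_eq_iff:
  assumes "open U" "eventually_moderate U f" "eventually_moderate U g"
  shows "gf_class U f = gf_class U g \<longleftrightarrow> null_on_compacts U (\<lambda>\<epsilon> x. f \<epsilon> x - g \<epsilon> x)"
proof
  assume eq: "gf_class U f = gf_class U g"
  obtain w where w: "w \<in> moderate_nets U" "\<forall>\<^sub>F \<epsilon> in at_right 0. w \<epsilon> = f \<epsilon>"
    using eventually_moderate_patch[OF assms(1,2)] .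
  have fw: "null_on_compacts U (\<lambda>\<epsilon> x. f \<epsilon> x - w \<epsilon> x)"
    by (rule null_on_compacts_eventually_zero) (use w(2) in \<open>auto elim: eventually_mono\<close>)
  have "w \<in> gf_class U f"
    unfolding mem_gf_class_iff[OF assms(1,2)] using w(1) fw null_on_compacts_minus_commute[of U w f] by simp
  then have "null_on_compacts U (\<lambda>\<epsilon> x. w \<epsilon> x - g \<epsilon> x)"
    unfolding eq mem_gf_class_iff[OF assms(1,3)] by simp
  with fw show "null_on_compacts U (\<lambda>\<epsilon> x. f \<epsilon> x - g \<epsilon> x)" by (rule null_on_compacts_trans)
qed (use gf_class_eqI[OF assms] in simp)

lemma gf_class_compose_eq:
  assumes "open U" "open V"
    and "eventually_moderate V G1" "eventually_moderate V G2" "null_on_compacts V (\<lambda>\<epsilon> y. G1 \<epsilon> y - G2 \<epsilon> y)"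
    and "eventually_moderate U f1" "eventually_moderate U f2" "null_on_compacts U (\<lambda>\<epsilon> x. f1 \<epsilon> x - f2 \<epsilon> x)"
    and "maps_c_boundedly U V f1" "maps_c_boundedly U V f2"
  shows "gf_class U (\<lambda>\<epsilon> x. G1 \<epsilon> (f1 \<epsilon> x)) = gf_class U (\<lambda>\<epsilon> x. G2 \<epsilon> (f2 \<epsilon> x))"
proof (rule gf_class_eqI)
  show "null_on_compacts U (\<lambda>\<epsilon> x. G1 \<epsilon> (f1 \<epsilon> x) - G2 \<epsilon> (f2 \<epsilon> x))"
    by (rule null_on_compacts_trans[OF null_on_compacts_moderate_image[OF assms(2,3,9,8)]
          null_on_compacts_compose[OF assms(5,10)]])
qed (intro assms eventually_moderate_compose[where V = V])+

section \<open>Generalized points\<close>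

definition null_net :: "(real \<Rightarrow> 'a::real_normed_vector) \<Rightarrow> bool" where
  "null_net x \<longleftrightarrow> null_bound (UNIV :: unit set) (\<lambda>\<epsilon> _. x \<epsilon>)"

lemma null_net_bound: "null_net x \<Longrightarrow> null_bound K (\<lambda>\<epsilon> _. x \<epsilon>)"
  unfolding null_net_def null_bound_def by (auto elim!: eventually_mono)

lemma null_net_trans: "null_net (\<lambda>\<epsilon>. x \<epsilon> - y \<epsilon>) \<Longrightarrow> null_net (\<lambda>\<epsilon>. y \<epsilon> - z \<epsilon>) \<Longrightarrow> null_net (\<lambda>\<epsilon>. x \<epsilon> - z \<epsilon>)"
  unfolding null_net_def using null_bound_add[of UNIV "\<lambda>\<epsilon> _. x \<epsilon> - y \<epsilon>" "\<lambda>\<epsilon> _. y \<epsilon> - z \<epsilon>"] by simp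

lemma null_net_minus_commute: "null_net (\<lambda>\<epsilon>. x \<epsilon> - y \<epsilon>) \<Longrightarrow> null_net (\<lambda>\<epsilon>. y \<epsilon> - x \<epsilon>)"
  by (simp add: null_net_def null_bound_def norm_minus_commute)

lemma null_net_eventually_zero: "\<forall>\<^sub>F \<epsilon> in at_right 0. x \<epsilon> = 0 \<Longrightarrow> null_net x"
  unfolding null_net_def null_bound_def
proof
  fix m assume "\<forall>\<^sub>F \<epsilon> in at_right 0. x \<epsilon> = 0"
  then show "\<forall>\<^sub>F \<epsilon> in at_right 0. \<forall>_\<in>UNIV. norm (x \<epsilon>) \<le> \<epsilon> ^ m"
    using eventually_at_right_small[OF zero_less_one] by eventually_elim simp
qed

lemma point_equiv_iff_null_net: "point_equiv x y \<longleftrightarrow> null_net (\<lambda>\<epsilon>. x \<epsilon> - y \<epsilon>)"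
proof
  assume eq: "point_equiv x y"
  show "null_net (\<lambda>\<epsilon>. x \<epsilon> - y \<epsilon>)"
    unfolding null_net_def
  proof (rule null_boundI)
    fix m
    have "(\<lambda>\<epsilon>. norm (x \<epsilon> - y \<epsilon>)) \<in> O[at_right 0](\<lambda>\<epsilon>. \<epsilon> ^ m)" using eq by (simp add: point_equiv_def)
    then obtain c where "\<forall>\<^sub>F \<epsilon> in at_right 0. norm (norm (x \<epsilon> - y \<epsilon>)) \<le> c * norm (\<epsilon> ^ m :: real)"
      by (elim landau_o.bigE)
    then have "\<forall>\<^sub>F \<epsilon> in at_right 0. \<forall>_\<in>(UNIV :: unit set). norm (x \<epsilon> - y \<epsilon>) \<le> c * \<epsilon> ^ m"
      using eventually_at_right_small[OF zero_less_one] by eventually_elim (simp add: power_abs)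
    then show "\<exists>C. \<forall>\<^sub>F \<epsilon> in at_right 0. \<forall>_\<in>(UNIV :: unit set). norm (x \<epsilon> - y \<epsilon>) \<le> C * \<epsilon> ^ m" by blast
  qed
next
  assume null: "null_net (\<lambda>\<epsilon>. x \<epsilon> - y \<epsilon>)"
  show "point_equiv x y"
    unfolding point_equiv_def
  proof
    fix m :: nat
    have "\<forall>\<^sub>F \<epsilon> in at_right 0. norm (norm (x \<epsilon> - y \<epsilon>)) \<le> 1 * norm (\<epsilon> ^ m :: real)"
      using null_boundD[OF null[unfolded null_net_def], of m] eventually_at_right_small[OF zero_less_one]
      by eventually_elim (simp add: power_abs)
    then show "(\<lambda>\<epsilon>. norm (x \<epsilon> - y \<epsilon>)) \<in> O[at_right 0](\<lambda>\<epsilon>. \<epsilon> ^ m)" by (rule bigoI)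
  qed
qed

lemma point_netsI:
  assumes "\<And>\<epsilon>. \<epsilon> \<in> {0<..1} \<Longrightarrow> x \<epsilon> \<in> U" "compact K" "\<forall>\<^sub>F \<epsilon> in at_right 0. x \<epsilon> \<in> K"
  shows "x \<in> point_nets U"
proof -
  obtain C where "\<And>y. y \<in> K \<Longrightarrow> norm y \<le> C" using compact_imp_bounded[OF assms(2)] by (auto simp: bounded_iff)
  then have "\<forall>\<^sub>F \<epsilon> in at_right 0. norm (norm (x \<epsilon>)) \<le> C * norm (1 / \<epsilon> ^ 0 :: real)"
    using assms(3) by (auto elim!: eventually_mono)
  then have "(\<lambda>\<epsilon>. norm (x \<epsilon>)) \<in> O[at_right 0](\<lambda>\<epsilon>. 1 / \<epsilon> ^ 0)" by (rule bigoI)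
  then show ?thesis using assms(1) by (auto simp: point_nets_def intro!: exI[of _ "0::nat"])
qed

text \<open>
  Representatives of a generalized point differ by less than any fixed \<open>\<rho>\<close> for small \<open>\<epsilon>\<close>. A
  compact neighbourhood of the compact set for one of them therefore serves for all.
\<close>
lemma gpoints_c_cases:
  fixes X :: "(real \<Rightarrow> 'a::euclidean_space) set"
  assumes "open V" "X \<in> gpoints_c V"
  obtains K where "compact K" "K \<subseteq> V" "X \<noteq> {}"
    "\<And>x. x \<in> X \<Longrightarrow> x \<in> point_nets V" "\<And>x. x \<in> X \<Longrightarrow> \<forall>\<^sub>F \<epsilon> in at_right 0. x \<epsilon> \<in> K"
    "\<And>x y. x \<in> X \<Longrightarrow> y \<in> X \<Longrightarrow> null_net (\<lambda>\<epsilon>. x \<epsilon> - y \<epsilon>)"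
proof -
  obtain y where y: "y \<in> point_nets V"
    and X: "X = {z. z \<in> point_nets V \<and> point_equiv y z}"
    using assms(2) by (auto simp: gpoints_c_def gpoints_def quotient_def)
  have equiv: "null_net (\<lambda>\<epsilon>. x \<epsilon> - x' \<epsilon>)" if "x \<in> X" "x' \<in> X" for x x'
    using that unfolding X point_equiv_iff_null_net by (blast intro: null_net_trans null_net_minus_commute)
  obtain x K0 where x: "x \<in> X" and K0: "compact K0" "K0 \<subseteq> V" "\<forall>\<^sub>F \<epsilon> in at_right 0. x \<epsilon> \<in> K0"
    using assms(2) unfolding gpoints_c_def eventually_at_right_iff_le by (auto simp: compactly_in_open[OF assms(1)])
  obtain \<rho> K where \<rho>: "\<rho> > 0" "compact K" "K \<subseteq> V" "\<And>x y. x \<in> K0 \<Longrightarrow> dist x y \<le> \<rho> \<Longrightarrow> y \<in> K"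
    using compact_neighbourhood[OF K0(1) assms(1) K0(2)] by metis
  have "\<forall>\<^sub>F \<epsilon> in at_right 0. x' \<epsilon> \<in> K" if "x' \<in> X" for x'
    using K0(3) null_boundD[OF equiv[OF x that, unfolded null_net_def], of 1] eventually_at_right_small[OF \<rho>(1)]
  proof eventually_elim
    case (elim \<epsilon>)
    then show ?case by (intro \<rho>(4)[of "x \<epsilon>"]) (auto simp: dist_norm)
  qed
  moreover have "x' \<in> point_nets V" if "x' \<in> X" for x' using that X by simp
  ultimately show ?thesis using that[OF \<rho>(2,3)] x equiv by blast
qed

lemma gpoints_c_of_net:
  fixes x :: "real \<Rightarrow> 'a::euclidean_space"
  assumes "open V" "compact K" "K \<subseteq> V" "\<And>\<epsilon>. x \<epsilon> \<in> K"
  obtains X where "X \<in> gpoints_c V" "x \<in> X"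
proof -
  let ?R = "{(x, y). x \<in> point_nets V \<and> y \<in> point_nets V \<and> point_equiv x y}"
  have x: "x \<in> point_nets V" by (rule point_netsI[OF _ assms(2)]) (use assms in auto)
  have mem: "x \<in> ?R `` {x}"
    using x by (simp add: point_equiv_iff_null_net null_net_eventually_zero)
  have "?R `` {x} \<in> gpoints V" unfolding gpoints_def using x by (rule quotientI)
  moreover have "\<exists>e\<in>{0<..1}. \<forall>\<epsilon>\<in>{0<..e}. x \<epsilon> \<in> K" using assms(4) by (intro bexI[of _ 1]) auto
  ultimately have "?R `` {x} \<in> gpoints_c V"
    unfolding gpoints_c_def using mem assms(2,3) compactly_in_open[OF assms(1)] by blast
  then show ?thesis using mem that by blast
qed

lemma point_class_eq:
  "null_net (\<lambda>\<epsilon>. x \<epsilon> - y \<epsilon>) \<Longrightarrow> point_class U x = point_class U y"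
  unfolding point_class_def point_equiv_iff_null_net by (blast intro: null_net_trans null_net_minus_commute)

text \<open>
  A net of points which stays in a compact subset of \<open>U\<close> can be modified for large \<open>\<epsilon>\<close> so as to be
  \<open>U\<close>-valued; hence its class is not empty and determines the net up to equivalence.
\<close>
lemma point_class_eq_iff:
  fixes x :: "real \<Rightarrow> 'a::euclidean_space"
  assumes "compact K" "K \<subseteq> U" "\<forall>\<^sub>F \<epsilon> in at_right 0. x \<epsilon> \<in> K"
  shows "point_class U x = point_class U y \<longleftrightarrow> null_net (\<lambda>\<epsilon>. x \<epsilon> - y \<epsilon>)"
proof
  assume eq: "point_class U x = point_class U y"
  obtain e where e: "e \<in> {0<..1}" "\<And>\<epsilon>. \<epsilon> \<in> {0<..e} \<Longrightarrow> x \<epsilon> \<in> K"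
    using assms(3) unfolding eventually_at_right_iff_le by blast
  define z where "z = (\<lambda>\<epsilon>. if \<epsilon> \<le> e then x \<epsilon> else x e)"
  have ev: "\<forall>\<^sub>F \<epsilon> in at_right 0. z \<epsilon> = x \<epsilon>"
    by (rule eventually_mono[OF eventually_at_right_small[of e]]) (use e(1) in \<open>auto simp: z_def\<close>)
  have "z \<in> point_nets U"
  proof (rule point_netsI[OF _ assms(1)])
    show "z \<epsilon> \<in> U" if "\<epsilon> \<in> {0<..1}" for \<epsilon>
      using e(2)[of \<epsilon>] e(2)[of e] e(1) that assms(2) by (auto simp: z_def)
    show "\<forall>\<^sub>F \<epsilon> in at_right 0. z \<epsilon> \<in> K" using ev assms(3) by eventually_elim simp
  qed
  moreover have xz: "null_net (\<lambda>\<epsilon>. x \<epsilon> - z \<epsilon>)"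
    by (rule null_net_eventually_zero) (use ev in \<open>auto elim: eventually_mono\<close>)
  ultimately have "z \<in> point_class U x"
    by (simp add: point_class_def point_equiv_iff_null_net null_net_minus_commute)
  then have "null_net (\<lambda>\<epsilon>. z \<epsilon> - y \<epsilon>)"
    unfolding eq by (simp add: point_class_def point_equiv_iff_null_net)
  with xz show "null_net (\<lambda>\<epsilon>. x \<epsilon> - y \<epsilon>)" by (rule null_net_trans)
qed (rule point_class_eq)

section \<open>Operations on classes in terms of representatives\<close>

text \<open>
  The operations on classes are unions over representatives.
\<close>
lemma UN_eq_if_all_eq: "A \<noteq> {} \<Longrightarrow> (\<And>x. x \<in> A \<Longrightarrow> f x = c) \<Longrightarrow> (\<Union>x\<in>A. f x) = c"
  by auto

lemma point_embed_eq:
  fixes X :: "(real \<Rightarrow> 'a::euclidean_space) set"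
  assumes "open V" "X \<in> gpoints_c V" "x \<in> X"
  shows "point_embed U X = point_class U x"
proof -
  obtain K where "\<And>x y. x \<in> X \<Longrightarrow> y \<in> X \<Longrightarrow> null_net (\<lambda>\<epsilon>. x \<epsilon> - y \<epsilon>)"
    using gpoints_c_cases[OF assms(1,2)] by metis
  then show ?thesis
    unfolding point_embed_def using assms(3) by (intro UN_eq_if_all_eq point_class_eq; blast)
qed

lemma eventually_moderate_compact_param:
  assumes "compact K" "\<forall>\<^sub>F \<epsilon> in at_right 0. p \<epsilon> \<in> K"
  shows "eventually_moderate Z (\<lambda>\<epsilon> z. p \<epsilon>)"
proof -
  obtain C where C: "\<And>y. y \<in> K \<Longrightarrow> norm y \<le> C" using compact_imp_bounded[OF assms(1)] by (auto simp: bounded_iff)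
  have "\<forall>\<^sub>F \<epsilon> in at_right 0. norm (p \<epsilon>) \<le> (1 / \<epsilon>) ^ 1"
    using assms(2) const_le_inverse_eps[of C]
    by eventually_elim (use C in fastforce)
  then show ?thesis by (rule eventually_moderate_param)
qed

lemma null_on_compacts_param: "null_net (\<lambda>\<epsilon>. p \<epsilon> - q \<epsilon>) \<Longrightarrow> null_on_compacts Z (\<lambda>\<epsilon> z. p \<epsilon> - q \<epsilon>)"
  by (simp add: null_on_compacts_def null_net_bound)

lemma null_on_compacts_Pair:
  assumes "null_on_compacts Z (\<lambda>\<epsilon> z. f \<epsilon> z - f' \<epsilon> z)" "null_on_compacts Z (\<lambda>\<epsilon> z. g \<epsilon> z - g' \<epsilon> z)"
  shows "null_on_compacts Z (\<lambda>\<epsilon> z. (f \<epsilon> z, g \<epsilon> z) - (f' \<epsilon> z, g' \<epsilon> z))"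
  unfolding null_on_compacts_def
proof (intro allI impI)
  fix K assume "compact K" "K \<subseteq> Z"
  then have f: "null_bound K (\<lambda>\<epsilon> z. f \<epsilon> z - f' \<epsilon> z)" and g: "null_bound K (\<lambda>\<epsilon> z. g \<epsilon> z - g' \<epsilon> z)"
    using assms by (simp_all add: null_on_compacts_def)
  show "null_bound K (\<lambda>\<epsilon> z. (f \<epsilon> z, g \<epsilon> z) - (f' \<epsilon> z, g' \<epsilon> z))"
  proof (rule null_boundI)
    fix m
    have "\<forall>\<^sub>F \<epsilon> in at_right 0. \<forall>z\<in>K. norm ((f \<epsilon> z, g \<epsilon> z) - (f' \<epsilon> z, g' \<epsilon> z)) \<le> 2 * \<epsilon> ^ m"
      using null_boundD[OF f, of m] null_boundD[OF g, of m]
    proof eventually_elim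
      case (elim \<epsilon>)
      have "norm ((f \<epsilon> z, g \<epsilon> z) - (f' \<epsilon> z, g' \<epsilon> z)) \<le> 2 * \<epsilon> ^ m" if "z \<in> K" for z
        using elim that norm_Pair_le[of "f \<epsilon> z - f' \<epsilon> z" "g \<epsilon> z - g' \<epsilon> z"] by fastforce
      then show ?case by blast
    qed
    then show "\<exists>C. \<forall>\<^sub>F \<epsilon> in at_right 0. \<forall>z\<in>K. norm ((f \<epsilon> z, g \<epsilon> z) - (f' \<epsilon> z, g' \<epsilon> z)) \<le> C * \<epsilon> ^ m" by blast
  qed
qed

lemma null_on_compacts_zero: "null_on_compacts Z (\<lambda>\<epsilon> z. f \<epsilon> z - f \<epsilon> z)"
  by (rule null_on_compacts_eventually_zero) simp

text \<open>
  Inserting parameters is composition with the \<open>c\<close>-bounded net \<open>(t, x) \<mapsto> (t, x, p\<^sub>\<epsilon>)\<close>, and different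
  representatives of \<open>p\<close> give equivalent nets of this kind.
\<close>
lemma insert_param_eq:
  fixes F :: "(real \<Rightarrow> 't::euclidean_space \<times> 'a::euclidean_space \<times> 'p::euclidean_space \<Rightarrow> 'b::real_normed_vector) set"
  assumes "open I" "open U" "open P" "F \<in> gfuns (I \<times> U \<times> P)" "F' \<in> F" "p \<in> gpoints_c P" "p' \<in> p"
  shows "insert_param (I \<times> U) F p = gf_class (I \<times> U) (\<lambda>\<epsilon> (t, x). F' \<epsilon> (t, x, p' \<epsilon>))"
    and "eventually_moderate (I \<times> U) (\<lambda>\<epsilon> (t, x). F' \<epsilon> (t, x, p' \<epsilon>))"
proof -
  have O: "open (I \<times> U)" "open (I \<times> U \<times> P)" using assms(1-3) by (auto intro: open_Times)
  obtain K where K: "compact K" "K \<subseteq> P" "\<And>x. x \<in> p \<Longrightarrow> \<forall>\<^sub>F \<epsilon> in at_right 0. x \<epsilon> \<in> K"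
    "\<And>x y. x \<in> p \<Longrightarrow> y \<in> p \<Longrightarrow> null_net (\<lambda>\<epsilon>. x \<epsilon> - y \<epsilon>)"
    using gpoints_c_cases[OF assms(3,6)] by metis
  define \<phi> where "\<phi> = (\<lambda>(q :: real \<Rightarrow> 'p) \<epsilon> (z :: 't \<times> 'a). (fst z, snd z, q \<epsilon>))"
  have \<phi>_mod: "eventually_moderate (I \<times> U) (\<phi> q)" if "q \<in> p" for q
    unfolding \<phi>_def
    by (intro eventually_moderate_Pair eventually_moderate_linear bounded_linear_fst bounded_linear_snd
        eventually_moderate_compact_param[OF K(1) K(3)[OF that]])
  have \<phi>_c: "maps_c_boundedly (I \<times> U) (I \<times> U \<times> P) (\<phi> q)" if "q \<in> p" for q
    unfolding \<phi>_def
    by (intro maps_c_boundedly_Pair maps_c_boundedly_param[OF K(1,2) K(3)[OF that]] maps_c_boundedly_continuous)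
      (auto intro!: continuous_intros)
  have \<phi>_null: "null_on_compacts (I \<times> U) (\<lambda>\<epsilon> z. \<phi> q \<epsilon> z - \<phi> q' \<epsilon> z)" if "q \<in> p" "q' \<in> p" for q q'
    unfolding \<phi>_def
    by (intro null_on_compacts_Pair null_on_compacts_zero null_on_compacts_param K(4) that)
  have F_mod: "eventually_moderate (I \<times> U \<times> P) G" if "G \<in> F" for G
    by (rule moderate_nets_imp_eventually_moderate[OF O(2) gfuns_cases(1)[OF O(2) assms(4) that]])
  have F_null: "null_on_compacts (I \<times> U \<times> P) (\<lambda>\<epsilon> y. G \<epsilon> y - F' \<epsilon> y)" if "G \<in> F" for G
    using that unfolding gfuns_cases(2)[OF O(2) assms(4,5)] mem_gf_class_iff[OF O(2) F_mod[OF assms(5)]] by simp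
  have form: "(\<lambda>\<epsilon> (t, x). G \<epsilon> (t, x, q \<epsilon>)) = (\<lambda>\<epsilon> z. G \<epsilon> (\<phi> q \<epsilon> z))"
    for G :: "real \<Rightarrow> 't \<times> 'a \<times> 'p \<Rightarrow> 'b" and q
    by (auto simp: \<phi>_def fun_eq_iff)
  show "eventually_moderate (I \<times> U) (\<lambda>\<epsilon> (t, x). F' \<epsilon> (t, x, p' \<epsilon>))"
    unfolding form by (rule eventually_moderate_compose[OF F_mod[OF assms(5)] \<phi>_mod[OF assms(7)] \<phi>_c[OF assms(7)]])
  have "gf_class (I \<times> U) (\<lambda>\<epsilon> z. G \<epsilon> (\<phi> q \<epsilon> z)) = gf_class (I \<times> U) (\<lambda>\<epsilon> z. F' \<epsilon> (\<phi> p' \<epsilon> z))"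
    if "G \<in> F" "q \<in> p" for G q
    using that assms(5,7)
    by (intro gf_class_compose_eq[OF O] F_mod F_null \<phi>_mod \<phi>_null \<phi>_c)
  then show "insert_param (I \<times> U) F p = gf_class (I \<times> U) (\<lambda>\<epsilon> (t, x). F' \<epsilon> (t, x, p' \<epsilon>))"
    unfolding insert_param_def form using assms(5,7) by (intro UN_eq_if_all_eq; blast)
qed

lemma insert_data_eq:
  fixes u :: "(real \<Rightarrow> real \<times> 'a::euclidean_space \<times> 'p::euclidean_space \<times> real \<Rightarrow> 'b::real_normed_vector) set"
  assumes "open T" "open U" "open P" "open J" "u \<in> gfuns (T \<times> U \<times> P \<times> J)" "u' \<in> u"
    and t: "t1 \<in> gpoints_c T" "t' \<in> t1" and x: "x1 \<in> gpoints_c U" "x' \<in> x1" and p: "p \<in> gpoints_c P" "p' \<in> p"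
  shows "insert_data J u t1 x1 p = gf_class J (\<lambda>\<epsilon> t. u' \<epsilon> (t' \<epsilon>, x' \<epsilon>, p' \<epsilon>, t))"
    and "eventually_moderate J (\<lambda>\<epsilon> t. u' \<epsilon> (t' \<epsilon>, x' \<epsilon>, p' \<epsilon>, t))"
    and "maps_c_boundedly J (T \<times> U \<times> P \<times> J) (\<lambda>\<epsilon> t. (t' \<epsilon>, x' \<epsilon>, p' \<epsilon>, t))"
proof -
  have O: "open (T \<times> U \<times> P \<times> J)" using assms(1-4) by (auto intro: open_Times)
  obtain K where K: "compact K" "K \<subseteq> P" "\<And>x. x \<in> p \<Longrightarrow> \<forall>\<^sub>F \<epsilon> in at_right 0. x \<epsilon> \<in> K"
    "\<And>x y. x \<in> p \<Longrightarrow> y \<in> p \<Longrightarrow> null_net (\<lambda>\<epsilon>. x \<epsilon> - y \<epsilon>)"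
    using gpoints_c_cases[OF assms(3) p(1)] by metis
  obtain L where L: "compact L" "L \<subseteq> U" "\<And>x. x \<in> x1 \<Longrightarrow> \<forall>\<^sub>F \<epsilon> in at_right 0. x \<epsilon> \<in> L"
    "\<And>x y. x \<in> x1 \<Longrightarrow> y \<in> x1 \<Longrightarrow> null_net (\<lambda>\<epsilon>. x \<epsilon> - y \<epsilon>)"
    using gpoints_c_cases[OF assms(2) x(1)] by metis
  obtain M where M: "compact M" "M \<subseteq> T" "\<And>x. x \<in> t1 \<Longrightarrow> \<forall>\<^sub>F \<epsilon> in at_right 0. x \<epsilon> \<in> M"
    "\<And>x y. x \<in> t1 \<Longrightarrow> y \<in> t1 \<Longrightarrow> null_net (\<lambda>\<epsilon>. x \<epsilon> - y \<epsilon>)"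
    using gpoints_c_cases[OF assms(1) t(1)] by metis
  define \<phi> where "\<phi> = (\<lambda>(a :: real \<Rightarrow> real, b :: real \<Rightarrow> 'a, c :: real \<Rightarrow> 'p) \<epsilon> (s :: real). (a \<epsilon>, b \<epsilon>, c \<epsilon>, s))"
  have \<phi>_mod: "eventually_moderate J (\<phi> (a, b, c))" if "a \<in> t1" "b \<in> x1" "c \<in> p" for a b c
    unfolding \<phi>_def prod.case
    by (intro eventually_moderate_Pair eventually_moderate_linear bounded_linear_ident
        eventually_moderate_compact_param[OF K(1) K(3)[OF that(3)]]
        eventually_moderate_compact_param[OF L(1) L(3)[OF that(2)]]
        eventually_moderate_compact_param[OF M(1) M(3)[OF that(1)]])
  have \<phi>_c: "maps_c_boundedly J (T \<times> U \<times> P \<times> J) (\<phi> (a, b, c))" if "a \<in> t1" "b \<in> x1" "c \<in> p" for a b c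
    unfolding \<phi>_def prod.case
    by (intro maps_c_boundedly_Pair maps_c_boundedly_param[OF K(1,2) K(3)[OF that(3)]]
        maps_c_boundedly_param[OF L(1,2) L(3)[OF that(2)]]
        maps_c_boundedly_param[OF M(1,2) M(3)[OF that(1)]] maps_c_boundedly_continuous)
      (auto intro!: continuous_intros)
  have \<phi>_null: "null_on_compacts J (\<lambda>\<epsilon> z. \<phi> (a, b, c) \<epsilon> z - \<phi> (a', b', c') \<epsilon> z)"
    if "a \<in> t1" "b \<in> x1" "c \<in> p" "a' \<in> t1" "b' \<in> x1" "c' \<in> p" for a b c a' b' c'
    unfolding \<phi>_def prod.case
    by (intro null_on_compacts_Pair null_on_compacts_zero null_on_compacts_param K(4) L(4) M(4) that)
  have u_mod: "eventually_moderate (T \<times> U \<times> P \<times> J) v" if "v \<in> u" for v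
    by (rule moderate_nets_imp_eventually_moderate[OF O gfuns_cases(1)[OF O assms(5) that]])
  have u_null: "null_on_compacts (T \<times> U \<times> P \<times> J) (\<lambda>\<epsilon> y. v \<epsilon> y - u' \<epsilon> y)" if "v \<in> u" for v
    using that unfolding gfuns_cases(2)[OF O assms(5,6)] mem_gf_class_iff[OF O u_mod[OF assms(6)]] by simp
  have form: "(\<lambda>\<epsilon> s. v \<epsilon> (a \<epsilon>, b \<epsilon>, c \<epsilon>, s)) = (\<lambda>\<epsilon> z. v \<epsilon> (\<phi> (a, b, c) \<epsilon> z))"
    for v :: "real \<Rightarrow> real \<times> 'a \<times> 'p \<times> real \<Rightarrow> 'b" and a b c
    by (simp add: \<phi>_def)
  show "eventually_moderate J (\<lambda>\<epsilon> t. u' \<epsilon> (t' \<epsilon>, x' \<epsilon>, p' \<epsilon>, t))"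
    unfolding form
    by (rule eventually_moderate_compose[OF u_mod[OF assms(6)] \<phi>_mod[OF t(2) x(2) p(2)] \<phi>_c[OF t(2) x(2) p(2)]])
  show "maps_c_boundedly J (T \<times> U \<times> P \<times> J) (\<lambda>\<epsilon> t. (t' \<epsilon>, x' \<epsilon>, p' \<epsilon>, t))"
    using \<phi>_c[OF t(2) x(2) p(2)] by (simp add: \<phi>_def)
  have "gf_class J (\<lambda>\<epsilon> z. v \<epsilon> (\<phi> (a, b, c) \<epsilon> z)) = gf_class J (\<lambda>\<epsilon> z. u' \<epsilon> (\<phi> (t', x', p') \<epsilon> z))"
    if "v \<in> u" "a \<in> t1" "b \<in> x1" "c \<in> p" for v a b c
    using that assms(6) t(2) x(2) p(2)
    by (intro gf_class_compose_eq[OF assms(4) O] u_mod u_null \<phi>_mod \<phi>_null \<phi>_c)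
  then show "insert_data J u t1 x1 p = gf_class J (\<lambda>\<epsilon> t. u' \<epsilon> (t' \<epsilon>, x' \<epsilon>, p' \<epsilon>, t))"
    unfolding insert_data_def form using assms(6) t(2) x(2) p(2) by (intro UN_eq_if_all_eq; blast)
qed

text \<open>
  Representatives differ by a negligible net, whose derivative is negligible, too.
\<close>
lemma gf_deriv_eq:
  fixes w :: "real \<Rightarrow> real \<Rightarrow> 'b::real_normed_vector"
  assumes "open J" "eventually_moderate J w"
  shows "gf_deriv J (gf_class J w) = gf_class J (\<lambda>\<epsilon> t. vector_derivative (w \<epsilon>) (at t))"
    and "eventually_moderate J (\<lambda>\<epsilon> t. vector_derivative (w \<epsilon>) (at t))"
proof -
  have vd: "vector_derivative f (at t) = pderivs [1] f t" if "smooth_on J f" "t \<in> J" for f :: "real \<Rightarrow> 'b" and t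
  proof -
    have "f differentiable (at t)" using that smooth_on_def[of J f] by (metis empty_subsetI list.set(1) pderivs.simps(1))
    then have der: "(f has_derivative frechet_derivative f (at t)) (at t)" by (simp add: frechet_derivative_works)
    have eq: "(\<lambda>r. r *\<^sub>R frechet_derivative f (at t) 1) = frechet_derivative f (at t)"
    proof
      fix r show "r *\<^sub>R frechet_derivative f (at t) 1 = frechet_derivative f (at t) r"
        using linear_scale[OF has_derivative_linear[OF der], of r 1] by simp
    qed
    have "(f has_vector_derivative frechet_derivative f (at t) 1) (at t)"
      unfolding has_vector_derivative_def eq by (rule der)
    then show ?thesis by (simp add: vector_derivative_at)
  qed
  have ev_eq: "\<forall>\<^sub>F \<epsilon> in at_right 0. \<forall>t\<in>J. pderivs [1] (f \<epsilon>) t = vector_derivative (f \<epsilon>) (at t)"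
    if "eventually_moderate J f" for f :: "real \<Rightarrow> real \<Rightarrow> 'b"
    using eventually_moderate_smooth[OF assms(1) that] unfolding eventually_at_right_iff_le by (metis vd)
  have mod: "eventually_moderate J (\<lambda>\<epsilon> t. vector_derivative (f \<epsilon>) (at t))"
    if f: "eventually_moderate J f" for f :: "real \<Rightarrow> real \<Rightarrow> 'b"
  proof (rule eventually_moderate_cong[OF assms(1) _ ev_eq[OF f]])
    obtain e where e: "e \<in> {0<..1}" "\<And>k. moderate_Ck k e J (\<lambda>\<epsilon> q. f \<epsilon> (snd q))"
      using f by (auto simp: eventually_moderate_def)
    have "moderate_Ck k e J (\<lambda>\<epsilon> q. pderivs [1] (f \<epsilon>) (snd q))" for k
      by (rule moderate_Ck_pderivs[OF assms(1) _ _ e(2)]) (use e(1) in auto)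
    then show "eventually_moderate J (\<lambda>\<epsilon>. pderivs [1] (f \<epsilon>))"
      unfolding eventually_moderate_def using e(1) by blast
  qed
  show "eventually_moderate J (\<lambda>\<epsilon> t. vector_derivative (w \<epsilon>) (at t))" by (rule mod[OF assms(2)])
  have "gf_class J (\<lambda>\<epsilon> t. vector_derivative (v \<epsilon>) (at t)) = gf_class J (\<lambda>\<epsilon> t. vector_derivative (w \<epsilon>) (at t))"
    if "v \<in> gf_class J w" for v
  proof -
    have v: "v \<in> moderate_nets J" "null_on_compacts J (\<lambda>\<epsilon> t. v \<epsilon> t - w \<epsilon> t)"
      using that unfolding mem_gf_class_iff[OF assms] by auto
    note v_mod = moderate_nets_imp_eventually_moderate[OF assms(1) v(1)]
    have "negligible_estimates J (\<lambda>\<epsilon> t. v \<epsilon> t - w \<epsilon> t)"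
      by (rule null_on_compacts_imp_negligible[OF assms(1) eventually_moderate_diff[OF v_mod assms(2)] v(2)])
    then have null: "null_on_compacts J (\<lambda>\<epsilon>. pderivs [1] (\<lambda>t. v \<epsilon> t - w \<epsilon> t))"
      by (rule negligible_imp_null_on_compacts[OF assms(1)]) simp
    obtain e where e: "e \<in> {0<..1}" "\<And>\<epsilon>. \<epsilon> \<in> {0<..e} \<Longrightarrow> smooth_on J (w \<epsilon>)"
      using eventually_moderate_smooth[OF assms] by blast
    have sv: "smooth_on J (v \<epsilon>)" if "\<epsilon> \<in> {0<..1}" for \<epsilon>
      using v(1) that by (simp add: moderate_nets_def smooth_nets_def)
    have "\<forall>\<epsilon>\<in>{0<..e}. \<forall>t\<in>J. (vector_derivative (v \<epsilon>) (at t) - vector_derivative (w \<epsilon>) (at t))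
        - pderivs [1] (\<lambda>t. v \<epsilon> t - w \<epsilon> t) t = 0"
    proof (intro ballI)
      fix \<epsilon> t assume *: "\<epsilon> \<in> {0<..e}" "t \<in> J"
      have s: "smooth_on J (v \<epsilon>)" "smooth_on J (w \<epsilon>)" using sv e * by auto
      show "(vector_derivative (v \<epsilon>) (at t) - vector_derivative (w \<epsilon>) (at t))
        - pderivs [1] (\<lambda>t. v \<epsilon> t - w \<epsilon> t) t = 0"
        using vd[OF s(1) *(2)] vd[OF s(2) *(2)] pderivs_diff[OF assms(1) s, of "[1]" t] *(2) by simp
    qed
    then have "\<forall>\<^sub>F \<epsilon> in at_right 0. \<forall>t\<in>J. (vector_derivative (v \<epsilon>) (at t) - vector_derivative (w \<epsilon>) (at t))
        - pderivs [1] (\<lambda>t. v \<epsilon> t - w \<epsilon> t) t = 0"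
      unfolding eventually_at_right_iff_le using e(1) by blast
    from null_on_compacts_add[OF null_on_compacts_eventually_zero[OF this] null]
    have "null_on_compacts J (\<lambda>\<epsilon> t. vector_derivative (v \<epsilon>) (at t) - vector_derivative (w \<epsilon>) (at t))" by simp
    then show ?thesis by (intro gf_class_eqI[OF assms(1)] mod v_mod assms(2))
  qed
  moreover have "gf_class J w \<noteq> {}" using gfuns_nonempty[OF assms(1) gf_class_in_gfuns[OF assms]] by auto
  ultimately show "gf_deriv J (gf_class J w) = gf_class J (\<lambda>\<epsilon> t. vector_derivative (w \<epsilon>) (at t))"
    unfolding gf_deriv_def by (intro UN_eq_if_all_eq)
qed

lemma gf_id_pair_eq:
  fixes w :: "real \<Rightarrow> 'a::euclidean_space \<Rightarrow> 'b::real_normed_vector"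
  assumes "open J" "eventually_moderate J w"
  shows "gf_id_pair J (gf_class J w) = gf_class J (\<lambda>\<epsilon> t. (t, w \<epsilon> t))"
    and "eventually_moderate J (\<lambda>\<epsilon> t. (t, w \<epsilon> t))"
proof -
  have mod: "eventually_moderate J (\<lambda>\<epsilon> t. (t, v \<epsilon> t))" if "eventually_moderate J v" for v :: "real \<Rightarrow> 'a \<Rightarrow> 'b"
    by (intro eventually_moderate_Pair eventually_moderate_linear bounded_linear_ident that)
  show "eventually_moderate J (\<lambda>\<epsilon> t. (t, w \<epsilon> t))" by (rule mod[OF assms(2)])
  have "gf_class J (\<lambda>\<epsilon> t. (t, v \<epsilon> t)) = gf_class J (\<lambda>\<epsilon> t. (t, w \<epsilon> t))" if "v \<in> gf_class J w" for v
  proof -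
    have v: "v \<in> moderate_nets J" "null_on_compacts J (\<lambda>\<epsilon> t. v \<epsilon> t - w \<epsilon> t)"
      using that unfolding mem_gf_class_iff[OF assms] by auto
    show ?thesis
      by (intro gf_class_eqI[OF assms(1)] mod moderate_nets_imp_eventually_moderate[OF assms(1)] v assms(2)
          null_on_compacts_Pair null_on_compacts_zero[of J "\<lambda>\<epsilon> t. t"])
  qed
  moreover have "gf_class J w \<noteq> {}" using gfuns_nonempty[OF assms(1) gf_class_in_gfuns[OF assms]] by auto
  ultimately show "gf_id_pair J (gf_class J w) = gf_class J (\<lambda>\<epsilon> t. (t, w \<epsilon> t))"
    unfolding gf_id_pair_def by (intro UN_eq_if_all_eq)
qed

lemma gf_comp_eq:
  fixes G :: "real \<Rightarrow> 'b::euclidean_space \<Rightarrow> 'c::real_normed_vector"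
  assumes "open U" "open V" "eventually_moderate V G" "eventually_moderate U f" "maps_c_boundedly U V f"
  shows "gf_comp U V (gf_class V G) (gf_class U f) = gf_class U (\<lambda>\<epsilon> x. G \<epsilon> (f \<epsilon> x))"
proof -
  have "gf_class U (\<lambda>\<epsilon> x. g \<epsilon> (h \<epsilon> x)) = gf_class U (\<lambda>\<epsilon> x. G \<epsilon> (f \<epsilon> x))"
    if "g \<in> gf_class V G" "h \<in> gf_class U f" "c_bounded U V h" for g h
    using that assms unfolding mem_gf_class_iff[OF assms(2,3)] mem_gf_class_iff[OF assms(1,4)] c_bounded_iff[OF assms(1,2)]
    by (intro gf_class_compose_eq[OF assms(1,2)]) (auto intro: moderate_nets_imp_eventually_moderate)
  moreover have "\<exists>g. g \<in> gf_class V G"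
    using gfuns_nonempty[OF assms(2) gf_class_in_gfuns[OF assms(2,3)]] .
  moreover have "\<exists>h. h \<in> gf_class U f \<and> c_bounded U V h"
    using gf_class_in_gfuns_into[OF assms(1,2,4,5)] by (auto simp: gfuns_into_def)
  ultimately show ?thesis
    unfolding gf_comp_def by (intro UN_eq_if_all_eq; blast)
qed

lemma point_value_eq:
  fixes w :: "real \<Rightarrow> 'a::euclidean_space \<Rightarrow> 'b::euclidean_space"
  assumes "open J" "eventually_moderate J w" "compact K" "K \<subseteq> J" "t \<in> point_nets J" "\<forall>\<^sub>F \<epsilon> in at_right 0. t \<epsilon> \<in> K"
  shows "point_value V (gf_class J w) (point_class J t) = point_class V (\<lambda>\<epsilon>. w \<epsilon> (t \<epsilon>))"
proof -
  have "point_class V (\<lambda>\<epsilon>. v \<epsilon> (s \<epsilon>)) = point_class V (\<lambda>\<epsilon>. w \<epsilon> (t \<epsilon>))"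
    if "v \<in> gf_class J w" "s \<in> point_class J t" for v s
  proof -
    have v: "v \<in> moderate_nets J" "null_on_compacts J (\<lambda>\<epsilon> t. v \<epsilon> t - w \<epsilon> t)"
      using that(1) unfolding mem_gf_class_iff[OF assms(1,2)] by auto
    have ts: "null_net (\<lambda>\<epsilon>. t \<epsilon> - s \<epsilon>)"
      using that(2) unfolding point_class_def point_equiv_iff_null_net by (auto intro: null_net_minus_commute)
    have "null_bound (UNIV :: unit set) (\<lambda>\<epsilon> k. v \<epsilon> (t \<epsilon>) - v \<epsilon> (s \<epsilon>))"
      by (rule null_bound_moderate_image[OF assms(1) moderate_nets_imp_eventually_moderate[OF assms(1) v(1)] assms(3,4)])
        (use assms(6) null_net_bound[OF ts] in auto)
    then have 1: "null_net (\<lambda>\<epsilon>. v \<epsilon> (s \<epsilon>) - v \<epsilon> (t \<epsilon>))" 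
      unfolding null_net_def[symmetric, where x = "\<lambda>\<epsilon>. v \<epsilon> (t \<epsilon>) - v \<epsilon> (s \<epsilon>)"] by (rule null_net_minus_commute)
    have "null_bound (UNIV :: unit set) (\<lambda>\<epsilon> k. v \<epsilon> (t \<epsilon>) - w \<epsilon> (t \<epsilon>))"
      by (rule null_bound_pullback[OF null_on_compactsD[OF v(2) assms(3,4)], where \<phi> = "\<lambda>\<epsilon> k. t \<epsilon>"])
        (use assms(6) in auto)
    then have "null_net (\<lambda>\<epsilon>. v \<epsilon> (t \<epsilon>) - w \<epsilon> (t \<epsilon>))" by (simp add: null_net_def)
    from null_net_trans[OF 1 this] show ?thesis by (rule point_class_eq)
  qed
  moreover have "\<exists>v. v \<in> gf_class J w" using gfuns_nonempty[OF assms(1) gf_class_in_gfuns[OF assms(1,2)]] .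
  moreover have "t \<in> point_class J t"
    using assms(5) by (simp add: point_class_def point_equiv_iff_null_net null_net_eventually_zero)
  ultimately show ?thesis unfolding point_value_def by (intro UN_eq_if_all_eq; blast)
qed

text \<open>
  On representatives, being a solution means solving the initial value problem up to negligible
  errors.
\<close>
lemma ivp_solution_iff:
  fixes w :: "real \<Rightarrow> real \<Rightarrow> 'a::euclidean_space"
  assumes "open I" "open U" "open J" "J \<subseteq> I" "open T" "T \<subseteq> J" "open X" "X \<subseteq> U"
    and w: "eventually_moderate J w" "maps_c_boundedly J U w"
    and G: "eventually_moderate (I \<times> U) G"
    and t: "t1 \<in> gpoints_c T" "t' \<in> t1" and x: "x1 \<in> gpoints_c X" "x' \<in> x1"
  shows "ivp_solution I U J (gf_class (I \<times> U) G) (point_embed J t1) (point_embed U x1) (gf_class J w) \<longleftrightarrow>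
    null_on_compacts J (\<lambda>\<epsilon> t. vector_derivative (w \<epsilon>) (at t) - G \<epsilon> (t, w \<epsilon> t)) \<and>
    null_net (\<lambda>\<epsilon>. w \<epsilon> (t' \<epsilon>) - x' \<epsilon>)"
proof -
  have O: "open (I \<times> U)" using assms(1,2) by (rule open_Times)
  have pair_c: "maps_c_boundedly J (I \<times> U) (\<lambda>\<epsilon> t. (t, w \<epsilon> t))"
    by (intro maps_c_boundedly_Pair w(2) maps_c_boundedly_continuous) (use assms(4) in \<open>auto intro: continuous_intros\<close>)
  note pair = gf_id_pair_eq[OF assms(3) w(1)]
  have Gw: "eventually_moderate J (\<lambda>\<epsilon> t. G \<epsilon> (t, w \<epsilon> t))"
    by (rule eventually_moderate_compose[OF G pair(2) pair_c])
  have comp: "gf_comp J (I \<times> U) (gf_class (I \<times> U) G) (gf_id_pair J (gf_class J w)) =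
      gf_class J (\<lambda>\<epsilon> t. G \<epsilon> (t, w \<epsilon> t))"
    unfolding pair(1) by (rule gf_comp_eq[OF assms(3) O G pair(2) pair_c])
  obtain K where K: "compact K" "K \<subseteq> T" "\<And>x. x \<in> t1 \<Longrightarrow> x \<in> point_nets T"
    "\<And>x. x \<in> t1 \<Longrightarrow> \<forall>\<^sub>F \<epsilon> in at_right 0. x \<epsilon> \<in> K"
    using gpoints_c_cases[OF assms(5) t(1)] by metis
  obtain L where L: "compact L" "L \<subseteq> U" "\<forall>\<^sub>F \<epsilon> in at_right 0. w \<epsilon> ` K \<subseteq> L"
    using w(2) K(1,2) assms(6) unfolding maps_c_boundedly_def by (meson order_trans)
  have wt: "\<forall>\<^sub>F \<epsilon> in at_right 0. w \<epsilon> (t' \<epsilon>) \<in> L"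
    using L(3) K(4)[OF t(2)] by eventually_elim auto
  have t'J: "t' \<in> point_nets J" using K(3)[OF t(2)] assms(6) by (auto simp: point_nets_def)
  have val: "point_value U (gf_class J w) (point_embed J t1) = point_class U (\<lambda>\<epsilon>. w \<epsilon> (t' \<epsilon>))"
    unfolding point_embed_eq[OF assms(5) t]
    by (rule point_value_eq[OF assms(3) w(1) K(1) _ t'J K(4)[OF t(2)]]) (use K(2) assms(6) in auto)
  have "point_value U (gf_class J w) (point_embed J t1) = point_embed U x1 \<longleftrightarrow> null_net (\<lambda>\<epsilon>. w \<epsilon> (t' \<epsilon>) - x' \<epsilon>)"
    unfolding val point_embed_eq[OF assms(7) x] by (rule point_class_eq_iff[OF L(1,2) wt])
  moreover have "gf_deriv J (gf_class J w) = gf_class J (\<lambda>\<epsilon> t. G \<epsilon> (t, w \<epsilon> t)) \<longleftrightarrow>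
      null_on_compacts J (\<lambda>\<epsilon> t. vector_derivative (w \<epsilon>) (at t) - G \<epsilon> (t, w \<epsilon> t))"
    unfolding gf_deriv_eq(1)[OF assms(3) w(1)]
    by (rule gf_class_eq_iff[OF assms(3) gf_deriv_eq(2)[OF assms(3) w(1)] Gw])
  ultimately show ?thesis
    unfolding ivp_solution_def comp using gf_class_in_gfuns_into[OF assms(3,2) w] by simp
qed

section \<open>The net of solutions\<close>

lemma convex_line_point:
  fixes t1 t :: real
  assumes "convex S" "t1 \<in> S" "t \<in> S" "s \<in> {0..1}"
  shows "t1 + s * (t - t1) \<in> S"
proof -
  have "(1 - s) *\<^sub>R t1 + s *\<^sub>R t \<in> S" using assms by (intro convexD_alt) auto
  moreover have "(1 - s) *\<^sub>R t1 + s *\<^sub>R t = t1 + s * (t - t1)" by (simp add: algebra_simps)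
  ultimately show ?thesis by simp
qed

text \<open>
  For \<open>\<epsilon> > e\<close> there is no control over \<open>F \<epsilon>\<close>, and solutions need not exist on all of \<open>J\<close>; the
  net is constant there. That \<open>u\<close> solves the equation in the original time follows from the scaling
  relation \<open>u(t1, x1, p, t1 + \<sigma> (t - t1)) = v(\<sigma>)\<close>, where \<open>v\<close> is the solution on \<open>[0, 1]\<close> with
  final time \<open>t\<close>: differentiate it in \<open>\<sigma>\<close>.
\<close>
lemma solution_net:
  fixes F :: "real \<Rightarrow> real \<times> 'x::euclidean_space \<times> 'p::euclidean_space \<Rightarrow> 'x"
  assumes "open I" "open U" "open P" and F: "F \<in> moderate_nets (I \<times> U \<times> P)"
    and e: "e \<in> {0<..1}" and sub: "{t0 - h..t0 + h} \<subseteq> I" "cball x0 \<beta> \<subseteq> U"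
    and bd: "\<And>\<epsilon> t x p. \<epsilon> \<in> {0<..e} \<Longrightarrow> t \<in> {t0 - h..t0 + h} \<Longrightarrow> x \<in> cball x0 \<beta> \<Longrightarrow> p \<in> P \<Longrightarrow>
       norm (F \<epsilon> (t, x, p)) \<le> a"
    and F_log: "\<And>K. compact K \<Longrightarrow> K \<subseteq> P \<Longrightarrow> \<exists>C. \<forall>\<^sub>F \<epsilon> in at_right 0. \<forall>t\<in>{t0 - h..t0 + h}.
       \<forall>x\<in>cball x0 \<beta>. \<forall>p\<in>K. \<forall>c\<in>Basis.
         norm (frechet_derivative (\<lambda>y. F \<epsilon> (t, y, p)) (at x) c) \<le> C * \<bar>ln \<epsilon>\<bar>"
    and d: "0 < d" "d \<le> h" and r: "d + a * (h + d) \<le> r" "r < \<beta>" and a: "0 \<le> a"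
    and T_def: "T = ball t0 d" and X_def: "X = ball x0 d" and J_def: "J = {t0 - h<..<t0 + h}"
  obtains u where "u \<in> moderate_nets (T \<times> X \<times> P \<times> J)"
    "\<And>\<epsilon> z. z \<in> T \<times> X \<times> P \<times> J \<Longrightarrow> u \<epsilon> z \<in> cball x0 r"
    "\<And>\<epsilon> t1 x1 p. \<epsilon> \<in> {0<..e} \<Longrightarrow> t1 \<in> T \<Longrightarrow> x1 \<in> X \<Longrightarrow> p \<in> P \<Longrightarrow> u \<epsilon> (t1, x1, p, t1) = x1"
    "\<And>\<epsilon> t1 x1 p t. \<epsilon> \<in> {0<..e} \<Longrightarrow> t1 \<in> T \<Longrightarrow> x1 \<in> X \<Longrightarrow> p \<in> P \<Longrightarrow> t \<in> J \<Longrightarrow>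
       ((\<lambda>t. u \<epsilon> (t1, x1, p, t)) has_vector_derivative F \<epsilon> (t, u \<epsilon> (t1, x1, p, t), p)) (at t)"
proof -
  define Z where "Z = T \<times> X \<times> P \<times> J"
  define D where "D = ball x0 \<beta>"
  have opn: "open (I \<times> U \<times> P)" "open Z" "open D"
    using assms(1-3) by (auto simp: Z_def T_def X_def J_def D_def intro!: open_Times)
  have e0: "e > 0" using e by simp
  have TJ: "T \<subseteq> J" using d by (auto simp: T_def J_def dist_real_def)
  have J_sub: "J \<subseteq> {t0 - h..t0 + h}" by (auto simp: J_def)
  have D0_sub: "cball x0 r \<subseteq> D" using r by (auto simp: D_def)
  have D_sub: "D \<subseteq> cball x0 \<beta>" by (auto simp: D_def)
  have line: "t1 + s * (t - t1) \<in> J" if "t1 \<in> T" "t \<in> J" "s \<in> {0..1}" for t1 t s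
    by (rule convex_line_point) (use that TJ in \<open>auto simp: J_def\<close>)
  \<comment> \<open>the substitution \<open>t1 + s (t - t1)\<close> moves the initial time to \<open>s = 0\<close> and the final time to \<open>s = 1\<close>\<close>
  define \<phi> where "\<phi> = (\<lambda>q :: real \<times> 'x \<times> real \<times> 'x \<times> 'p \<times> real.
     (fst (snd (snd q)) + fst q *\<^sub>R (snd (snd (snd (snd (snd q)))) - fst (snd (snd q))),
      fst (snd q), fst (snd (snd (snd (snd q))))))"
  define H where "H = (\<lambda>\<epsilon> q. (snd (snd (snd (snd (snd q)))) - fst (snd (snd q))) *\<^sub>R F \<epsilon> (snd (fst q, \<phi> q)))"
  have H_eq: "H \<epsilon> (s, x, t1, x1, p, t) = (t - t1) *\<^sub>R F \<epsilon> (t1 + s * (t - t1), x, p)" for \<epsilon> s x t1 x1 p t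
    by (simp add: H_def \<phi>_def)
  have \<phi>_in: "\<phi> q \<in> {t0 - h..t0 + h} \<times> cball x0 \<beta> \<times> P" if q: "q \<in> {0..1} \<times> D \<times> Z" for q
  proof -
    obtain s x t1 x1 p t where [simp]: "q = (s, x, t1, x1, p, t)" by (cases q) auto
    have "t1 + s * (t - t1) \<in> {t0 - h..t0 + h}"
      by (rule subsetD[OF J_sub line]) (use q in \<open>auto simp: Z_def\<close>)
    moreover have "x \<in> cball x0 \<beta>" "p \<in> P" using q D_sub by (auto simp: Z_def)
    ultimately show ?thesis by (simp add: \<phi>_def)
  qed
  have sub3: "{t0 - h..t0 + h} \<times> cball x0 \<beta> \<times> P \<subseteq> I \<times> U \<times> P" using sub by (intro Sigma_mono) auto
  have F_Ck: "moderate_Ck k e (I \<times> U \<times> P) (\<lambda>\<epsilon> q. F \<epsilon> (snd q))" for k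
    by (rule moderate_Ck_subset[OF moderate_Ck_of_moderate_nets[OF opn(1) F]]) (use e in auto)
  have H_Ck: "moderate_Ck k e (D \<times> Z) H" for k
    unfolding H_def
  proof (rule moderate_Ck_prod[OF bounded_bilinear_scaleR])
    show "moderate_Ck k e (D \<times> Z) (\<lambda>\<epsilon> q. snd (snd (snd (snd (snd q)))) - fst (snd (snd q)))"
      by (rule moderate_Ck_linear[where f = "\<lambda>y. snd (snd (snd (snd y))) - fst (snd y)"])
        (intro bounded_linear_intros)
    show "moderate_Ck k e (D \<times> Z) (\<lambda>\<epsilon> q. F \<epsilon> (snd (fst q, \<phi> q)))"
    proof (rule moderate_Ck_compose[where G = "\<lambda>\<epsilon> q. F \<epsilon> (snd q)" and f = "\<lambda>\<epsilon>. \<phi>", OF F_Ck _ e0])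
      have lin: "moderate_Ck k e (D \<times> Z) (\<lambda>\<epsilon> q. fst (snd (snd q)))"
        "moderate_Ck k e (D \<times> Z) (\<lambda>\<epsilon> q. snd (snd (snd (snd (snd q)))) - fst (snd (snd q)))"
        "moderate_Ck k e (D \<times> Z) (\<lambda>\<epsilon> q. fst (snd q))"
        "moderate_Ck k e (D \<times> Z) (\<lambda>\<epsilon> q. fst (snd (snd (snd (snd q)))))"
        by (rule moderate_Ck_linear[where f = "\<lambda>y. fst (snd y)"]
            moderate_Ck_linear[where f = "\<lambda>y. snd (snd (snd (snd y))) - fst (snd y)"]
            moderate_Ck_linear[where f = "\<lambda>y. fst y"]
            moderate_Ck_linear[where f = "\<lambda>y. fst (snd (snd (snd y)))"];
          intro bounded_linear_intros)+
      show "moderate_Ck k e (D \<times> Z) (\<lambda>\<epsilon>. \<phi>)"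
        unfolding \<phi>_def
        by (intro moderate_Ck_Pair moderate_Ck_add moderate_Ck_prod[OF bounded_bilinear_scaleR] lin
            moderate_Ck_time[where f = "\<lambda>s. s"] continuous_on_id)
      show "\<phi> (s, y) \<in> I \<times> U \<times> P" if "s \<in> {0..1}" "y \<in> D \<times> Z" for s y
        by (rule subsetD[OF sub3 \<phi>_in]) (use that in simp)
      fix K assume K: "compact K" "K \<subseteq> D \<times> Z"
      define Kp where "Kp = (\<lambda>y. fst (snd (snd (snd y)))) ` K"
      have "compact Kp" unfolding Kp_def by (intro compact_continuous_image K continuous_intros)
      moreover have "Kp \<subseteq> P" using K(2) by (force simp: Kp_def Z_def)
      moreover have "\<phi> q \<in> {t0 - h..t0 + h} \<times> cball x0 \<beta> \<times> Kp" if "q \<in> {0..1} \<times> K" for q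
      proof -
        have "snd (snd (\<phi> q)) \<in> Kp" using that by (auto simp: \<phi>_def Kp_def)
        moreover have "\<phi> q \<in> {t0 - h..t0 + h} \<times> cball x0 \<beta> \<times> P"
          by (rule \<phi>_in) (use that K(2) in auto)
        ultimately show ?thesis by (auto simp: mem_Times_iff)
      qed
      ultimately show "\<exists>L. compact L \<and> L \<subseteq> I \<times> U \<times> P \<and> (\<forall>\<^sub>F \<epsilon> in at_right 0. \<forall>q\<in>{0..1} \<times> K. \<phi> q \<in> L)"
        using sub by (intro exI[of _ "{t0 - h..t0 + h} \<times> cball x0 \<beta> \<times> Kp"] conjI compact_Times Sigma_mono) auto
    qed
  qed
  define H' where "H' = (\<lambda>\<epsilon> q. frechet_derivative (\<lambda>y. H \<epsilon> (fst q, y)) (at (snd q)))"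
  have DZ: "open (D \<times> Z)" using opn by (intro open_Times)
  have H': "\<And>\<epsilon> s q. \<epsilon> \<in> {0<..e} \<Longrightarrow> s \<in> {0..1} \<Longrightarrow> q \<in> D \<times> Z \<Longrightarrow>
      ((\<lambda>q. H \<epsilon> (s, q)) has_derivative H' \<epsilon> (s, q)) (at q)"
    "\<And>b k. b \<in> Basis \<Longrightarrow> moderate_Ck k e (D \<times> Z) (\<lambda>\<epsilon> q. H' \<epsilon> q b)"
    using moderate_Ck_frechet_derivative[OF DZ e0 H_Ck] by (simp_all add: H'_def)
  note C0 = moderate_Ck_C0[THEN moderate_C0_continuous_on]
  have lip: "\<exists>L. \<forall>s\<in>{0..1}. \<forall>x\<in>cball x0 r. \<forall>y\<in>cball x0 r. norm (H \<epsilon> (s, x, z) - H \<epsilon> (s, y, z)) \<le> L * norm (x - y)"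
    if \<epsilon>: "\<epsilon> \<in> {0<..e}" and z: "z \<in> Z" for \<epsilon> z
  proof -
    have sub1: "cball x0 r \<times> {z} \<subseteq> D \<times> Z" using D0_sub z by auto
    show ?thesis
    proof (rule lipschitz_first_slot[of "cball x0 r" "{z}" "H \<epsilon>" "H' \<epsilon>"])
      show "((\<lambda>q. H \<epsilon> (s, q)) has_derivative H' \<epsilon> (s, q)) (at q)"
        if "s \<in> {0..1}" "q \<in> cball x0 r \<times> {z}" for s q
        by (rule H'(1)[OF \<epsilon> that(1) subsetD[OF sub1 that(2)]])
      show "continuous_on ({0..1} \<times> cball x0 r \<times> {z}) (\<lambda>q. H' \<epsilon> q b)" if "b \<in> Basis" for b
        using C0[OF H'(2)[OF that] \<epsilon>] by (rule continuous_on_subset) (use sub1 in auto)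
    qed (blast | simp)+
  qed
  define sol where "sol = (\<lambda>\<epsilon> z v. v 0 = fst (snd z) \<and> (\<forall>s\<in>{0..1}. v s \<in> cball x0 r \<and>
     (v has_vector_derivative H \<epsilon> (s, v s, z)) (at s within {0..1})))"
  have "\<exists>v. sol \<epsilon> z v" if \<epsilon>: "\<epsilon> \<in> {0<..e}" and z: "z \<in> Z" for \<epsilon> z
  proof -
    obtain t1 x1 p t where z_eq: "z = (t1, x1, p, t)" by (cases z) auto
    have mem: "t1 \<in> T" "x1 \<in> X" "p \<in> P" "t \<in> J" using z by (auto simp: z_eq Z_def)
    obtain L where L: "\<And>s x y. s \<in> {0..1} \<Longrightarrow> x \<in> cball x0 r \<Longrightarrow> y \<in> cball x0 r \<Longrightarrow>
        norm (H \<epsilon> (s, x, z) - H \<epsilon> (s, y, z)) \<le> L * norm (x - y)"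
      using lip[OF \<epsilon> z] by blast
    have cont: "continuous_on ({0..1} \<times> cball x0 r) (\<lambda>q. H \<epsilon> (fst q, snd q, z))"
      by (rule continuous_on_compose2[OF C0[OF H_Ck \<epsilon>]])
        (use D0_sub z in \<open>auto intro!: continuous_intros\<close>)
    show ?thesis
    proof (rule ode_solution_in_ball[OF cont, where g = x1 and L = L and M = "a * (h + d)"])
      show "norm (H \<epsilon> (fst (s, x), snd (s, x), z)) \<le> a * (h + d)" if s: "s \<in> {0..1}" and x: "x \<in> cball x0 r" for s x
      proof -
        have "\<bar>t - t1\<bar> \<le> h + d" using mem by (auto simp: T_def J_def dist_real_def)
        moreover have "norm (F \<epsilon> (t1 + s * (t - t1), x, p)) \<le> a"
          using bd[OF \<epsilon> _ _ mem(3)] line[OF mem(1,4) s] J_sub x D0_sub D_sub by blast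
        ultimately have "\<bar>t - t1\<bar> * norm (F \<epsilon> (t1 + s * (t - t1), x, p)) \<le> (h + d) * a"
          by (intro mult_mono) auto
        then show ?thesis by (simp add: z_eq H_eq mult.commute)
      qed
      show "dist x0 x1 + a * (h + d) \<le> r" using mem(2) r by (simp add: X_def)
      show "0 \<le> a * (h + d)" using a d by simp
      fix v assume "v 0 = x1" "\<And>s. s \<in> {0..1} \<Longrightarrow> v s \<in> cball x0 r"
        "\<And>s. s \<in> {0..1} \<Longrightarrow> (v has_vector_derivative H \<epsilon> (fst (s, v s), snd (s, v s), z)) (at s within {0..1})"
      then show "\<exists>v. sol \<epsilon> z v" unfolding sol_def by (intro exI[of _ v]) (simp add: z_eq)
    qed (simp add: L)
  qed
  then obtain y where sol: "\<And>\<epsilon> z. \<epsilon> \<in> {0<..e} \<Longrightarrow> z \<in> Z \<Longrightarrow> sol \<epsilon> z (y \<epsilon> z)" by metis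
  define V where "V = (\<lambda>\<epsilon> q. y \<epsilon> (snd q) (fst q))"
  have V0: "V \<epsilon> (0, z) = fst (snd z)" if "\<epsilon> \<in> {0<..e}" "z \<in> Z" for \<epsilon> z
    using sol[OF that] by (simp add: sol_def V_def)
  have V_in: "V \<epsilon> (s, z) \<in> cball x0 r" if "\<epsilon> \<in> {0<..e}" "s \<in> {0..1}" "z \<in> Z" for \<epsilon> s z
    using sol[OF that(1,3)] that(2) by (simp add: sol_def V_def)
  have V_ode: "((\<lambda>s. V \<epsilon> (s, z)) has_vector_derivative H \<epsilon> (s, V \<epsilon> (s, z), z)) (at s within {0..1})"
    if "\<epsilon> \<in> {0<..e}" "s \<in> {0..1}" "z \<in> Z" for \<epsilon> s z
    using sol[OF that(1,3)] that(2) by (simp add: sol_def V_def)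
  have V_Ck: "moderate_Ck k e Z V" for k
  proof (rule ode_moderate_Ck[OF opn(3,2) e0 H_Ck compact_cball convex_cball D0_sub V_in V_ode])
    show "moderate_Ck k e Z (\<lambda>\<epsilon> q. V \<epsilon> (0, snd q))" for k
      by (rule moderate_Ck_cong[OF opn(2) moderate_Ck_linear[of "\<lambda>z. fst (snd z)"] e0])
        (simp_all add: V0 bounded_linear_intros)
  next
    fix K assume K: "compact K" "K \<subseteq> Z"
    define Kp where "Kp = (\<lambda>z. fst (snd (snd z))) ` K"
    have "compact Kp" unfolding Kp_def by (intro compact_continuous_image K continuous_intros)
    moreover have Kp: "Kp \<subseteq> P" using K(2) by (force simp: Kp_def Z_def)
    ultimately obtain C where C: "\<forall>\<^sub>F \<epsilon> in at_right 0. \<forall>t\<in>{t0 - h..t0 + h}. \<forall>x\<in>cball x0 \<beta>. \<forall>p\<in>Kp. \<forall>c\<in>Basis.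
         norm (frechet_derivative (\<lambda>y. F \<epsilon> (t, y, p)) (at x) c) \<le> C * \<bar>ln \<epsilon>\<bar>"
      using F_log by blast
    have "\<forall>\<^sub>F \<epsilon> in at_right 0. \<forall>s\<in>{0..1}. \<forall>x\<in>cball x0 r. \<forall>z\<in>K. \<forall>c\<in>Basis.
         norm (frechet_derivative (\<lambda>q. H \<epsilon> (s, q)) (at (x, z)) (c, 0)) \<le> (2 * h * C) * \<bar>ln \<epsilon>\<bar>"
      using C eventually_at_right_small[OF e0]
    proof eventually_elim
      case (elim \<epsilon>)
      then have \<epsilon>: "\<epsilon> \<in> {0<..e}" by simp
      show ?case
      proof (intro ballI)
        fix s x z and c :: 'x assume s: "s \<in> {0..1::real}" and x: "x \<in> cball x0 r" and zK: "z \<in> K" and c: "c \<in> Basis"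
        have z: "z \<in> Z" using zK K by auto
        obtain t1 x1 p t where z_eq: "z = (t1, x1, p, t)" by (cases z) auto
        have mem: "t1 \<in> T" "x1 \<in> X" "p \<in> P" "t \<in> J" using z by (auto simp: z_eq Z_def)
        have xD: "x \<in> D" "x \<in> cball x0 \<beta>" using x D0_sub D_sub by blast+
        define \<tau> where "\<tau> = t1 + s * (t - t1)"
        have \<tau>: "\<tau> \<in> {t0 - h..t0 + h}" using line[OF mem(1,4) s] J_sub by (auto simp: \<tau>_def)
        have dH: "((\<lambda>x. H \<epsilon> (s, x, z)) has_derivative (\<lambda>h. H' \<epsilon> (s, x, z) (h, 0))) (at x)"
          by (rule has_derivative_compose[OF has_derivative_Pair[OF has_derivative_ident has_derivative_const]
                H'(1)[OF \<epsilon> s]]) (use xD z in auto)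
        have "(\<tau>, x, p) \<in> I \<times> U \<times> P" using \<tau> xD(2) mem(3) by (intro subsetD[OF sub3]) simp
        then have "((\<lambda>q. F \<epsilon> q) has_derivative frechet_derivative (F \<epsilon>) (at (\<tau>, x, p))) (at (\<tau>, x, p))"
          using pderivs_differentiable[OF opn(1) e0, of "[]" F \<epsilon> "(\<tau>, x, p)", OF _ F_Ck \<epsilon>]
          by (simp add: frechet_derivative_works)
        then have "((\<lambda>x. F \<epsilon> (\<tau>, x, p)) has_derivative (\<lambda>h. frechet_derivative (F \<epsilon>) (at (\<tau>, x, p)) (0, h, 0))) (at x)"
          by (intro has_derivative_compose[OF has_derivative_Pair[OF has_derivative_const
                  has_derivative_Pair[OF has_derivative_ident has_derivative_const]]])
        then have "(\<lambda>x. F \<epsilon> (\<tau>, x, p)) differentiable (at x)" by (auto simp: differentiable_def)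
        then have "((\<lambda>x. F \<epsilon> (\<tau>, x, p)) has_derivative frechet_derivative (\<lambda>y. F \<epsilon> (\<tau>, y, p)) (at x)) (at x)"
          by (simp add: frechet_derivative_works)
        then have "((\<lambda>x. H \<epsilon> (s, x, z)) has_derivative
            (\<lambda>h. (t - t1) *\<^sub>R frechet_derivative (\<lambda>y. F \<epsilon> (\<tau>, y, p)) (at x) h)) (at x)"
          unfolding z_eq H_eq \<tau>_def by (rule has_derivative_scaleR_right)
        from has_derivative_unique[OF dH this]
        have "H' \<epsilon> (s, x, z) (c, 0) = (t - t1) *\<^sub>R frechet_derivative (\<lambda>y. F \<epsilon> (\<tau>, y, p)) (at x) c"
          by (rule fun_cong)
        moreover have "norm (frechet_derivative (\<lambda>y. F \<epsilon> (\<tau>, y, p)) (at x) c) \<le> C * \<bar>ln \<epsilon>\<bar>"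
        proof -
          have "p \<in> Kp" unfolding Kp_def using zK by (force simp: z_eq)
          then show ?thesis using elim(1) \<tau> xD(2) c by blast
        qed
        moreover have "\<bar>t - t1\<bar> \<le> 2 * h" using mem d by (auto simp: T_def J_def dist_real_def)
        ultimately have "norm (H' \<epsilon> (s, x, z) (c, 0)) \<le> (2 * h) * (C * \<bar>ln \<epsilon>\<bar>)"
          unfolding norm_scaleR by (simp only: norm_scaleR) (intro mult_mono, auto)
        then show "norm (frechet_derivative (\<lambda>q. H \<epsilon> (s, q)) (at (x, z)) (c, 0)) \<le> (2 * h * C) * \<bar>ln \<epsilon>\<bar>"
          by (simp add: H'_def mult.assoc)
      qed
    qed
    then show "\<exists>C. \<forall>\<^sub>F \<epsilon> in at_right 0. \<forall>s\<in>{0..1}. \<forall>x\<in>cball x0 r. \<forall>z\<in>K. \<forall>c\<in>Basis.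
         norm (frechet_derivative (\<lambda>q. H \<epsilon> (s, q)) (at (x, z)) (c, 0)) \<le> C * \<bar>ln \<epsilon>\<bar>" by blast
  qed
  have U_Ck: "moderate_Ck k e Z (\<lambda>\<epsilon> q. V \<epsilon> (1, snd q))" for k
    by (rule moderate_Ck_slice[OF V_Ck]) simp
  have U_diff: "(\<lambda>z. V \<epsilon> (1, z)) differentiable (at z)" if "\<epsilon> \<in> {0<..e}" "z \<in> Z" for \<epsilon> z
    using pderivs_differentiable[OF opn(2) e0, of "[]" "\<lambda>\<epsilon> z. V \<epsilon> (1, z)", OF _ U_Ck that] by simp
  define u where "u = (\<lambda>\<epsilon>. if \<epsilon> \<in> {0<..e} then (\<lambda>z. V \<epsilon> (1, z)) else (\<lambda>_. x0))"
  show ?thesis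
  proof (rule that[of u], unfold Z_def[symmetric])
    have "eventually_moderate Z (\<lambda>\<epsilon> z. V \<epsilon> (1, z))"
      unfolding eventually_moderate_def using U_Ck e by blast
    then have "eventually_moderate Z u"
      by (rule eventually_moderate_cong[OF opn(2)])
        (rule eventually_mono[OF eventually_at_right_small[OF e0]], simp add: u_def)
    moreover have "u \<in> smooth_nets Z"
      using pderivs_differentiable[OF opn(2) e0 _ U_Ck]
      by (auto simp: smooth_nets_def u_def smooth_on_const smooth_on_def[of Z "\<lambda>z. V _ (1, z)"])
    ultimately show "u \<in> moderate_nets Z" by (rule eventually_moderate_imp_moderate_nets[OF opn(2)])
    have "0 \<le> r" using r d a mult_nonneg_nonneg[of a "h + d"] by linarith
    then show "u \<epsilon> z \<in> cball x0 r" if "z \<in> Z" for \<epsilon> z using V_in[OF _ _ that, of \<epsilon> 1] by (simp add: u_def)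
  next
    fix \<epsilon> t1 x1 p assume \<epsilon>: "\<epsilon> \<in> {0<..e}" and mem: "t1 \<in> T" "x1 \<in> X" "p \<in> P"
    have Z: "(t1, x1, p, t) \<in> Z" if "t \<in> J" for t using mem that by (simp add: Z_def)
    have t1J: "t1 \<in> J" using mem TJ by auto
    define w where "w = (\<lambda>t. V \<epsilon> (1, t1, x1, p, t))"
    \<comment> \<open>with \<open>z'\<close> the point of final time \<open>t1 + \<sigma> (t - t1)\<close>, the curves \<open>V \<epsilon> (s, z')\<close> and \<open>V \<epsilon> (\<sigma> s, z)\<close>
      solve the same initial value problem in \<open>s\<close>; the claim is their equality at \<open>s = 1\<close>\<close>
    have scaling: "w (t1 + \<sigma> * (t - t1)) = V \<epsilon> (\<sigma>, t1, x1, p, t)" if t: "t \<in> J" and \<sigma>: "\<sigma> \<in> {0..1}" for t \<sigma>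
    proof -
      define z z' where "z = (t1, x1, p, t)" and "z' = (t1, x1, p, t1 + \<sigma> * (t - t1))"
      have zZ: "z \<in> Z" "z' \<in> Z" using Z t line[OF mem(1) t \<sigma>] by (auto simp: z_def z'_def)
      obtain L where L: "\<And>s x y. s \<in> {0..1} \<Longrightarrow> x \<in> cball x0 r \<Longrightarrow> y \<in> cball x0 r \<Longrightarrow>
          norm (H \<epsilon> (s, x, z') - H \<epsilon> (s, y, z')) \<le> L * norm (x - y)"
        using lip[OF \<epsilon> zZ(2)] by blast
      have \<sigma>s: "\<sigma> * s \<in> {0..1}" if "s \<in> {0..1}" for s using \<sigma> that by (auto intro: mult_le_one)
      define \<rho> where "\<rho> = (\<lambda>s. V \<epsilon> (s, z') - V \<epsilon> (\<sigma> * s, z))"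
      have "norm (\<rho> 1) \<le> exp (\<bar>L\<bar> + 1) * (norm (\<rho> 0) + 0)"
      proof (rule gronwall_unit_interval[where r' = "\<lambda>s. H \<epsilon> (s, V \<epsilon> (s, z'), z') - H \<epsilon> (s, V \<epsilon> (\<sigma> * s, z), z')"])
        fix s :: real assume s: "s \<in> {0..1}"
        have img: "(\<lambda>s. \<sigma> * s) ` {0..1} \<subseteq> {0..1}" using \<sigma>s by blast
        have d1: "((\<lambda>s. \<sigma> * s) has_vector_derivative \<sigma>) (at s within {0..1})"
          by (auto intro!: derivative_eq_intros simp: has_real_derivative_iff_has_vector_derivative[symmetric])
        have d2: "((\<lambda>s. V \<epsilon> (s, z)) has_vector_derivative H \<epsilon> (\<sigma> * s, V \<epsilon> (\<sigma> * s, z), z))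
            (at (\<sigma> * s) within (\<lambda>s. \<sigma> * s) ` {0..1})"
          by (rule has_vector_derivative_within_subset[OF V_ode[OF \<epsilon> \<sigma>s[OF s] zZ(1)] img])
        have H_scale: "\<sigma> *\<^sub>R H \<epsilon> (\<sigma> * s, x, z) = H \<epsilon> (s, x, z')" for x
          by (simp add: z_def z'_def H_eq algebra_simps)
        have "((\<lambda>s. V \<epsilon> (\<sigma> * s, z)) has_vector_derivative H \<epsilon> (s, V \<epsilon> (\<sigma> * s, z), z')) (at s within {0..1})"
          using vector_diff_chain_within[OF d1 d2] by (simp add: o_def H_scale)
        then show "(\<rho> has_vector_derivative H \<epsilon> (s, V \<epsilon> (s, z'), z') - H \<epsilon> (s, V \<epsilon> (\<sigma> * s, z), z')) (at s within {0..1})"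
          unfolding \<rho>_def by (rule has_vector_derivative_diff[OF V_ode[OF \<epsilon> s zZ(2)]])
        have "norm (H \<epsilon> (s, V \<epsilon> (s, z'), z') - H \<epsilon> (s, V \<epsilon> (\<sigma> * s, z), z')) \<le> L * norm (\<rho> s)"
          unfolding \<rho>_def by (rule L[OF s V_in[OF \<epsilon> s zZ(2)] V_in[OF \<epsilon> \<sigma>s[OF s] zZ(1)]])
        also have "\<dots> \<le> \<bar>L\<bar> * norm (\<rho> s)" by (intro mult_right_mono) auto
        finally show "norm (H \<epsilon> (s, V \<epsilon> (s, z'), z') - H \<epsilon> (s, V \<epsilon> (\<sigma> * s, z), z')) \<le> \<bar>L\<bar> * norm (\<rho> s) + 0" by simp
      qed auto
      moreover have "\<rho> 0 = 0" using V0[OF \<epsilon>] zZ by (simp add: \<rho>_def z_def z'_def)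
      ultimately show ?thesis by (simp add: \<rho>_def w_def z_def z'_def)
    qed
    have w_diff: "(w has_vector_derivative vector_derivative w (at t)) (at t)" if "t \<in> J" for t
    proof -
      have "(\<lambda>t. (t1, x1, p, t)) differentiable (at t)" by (auto intro!: derivative_intros)
      then have "(\<lambda>t. V \<epsilon> (1, (t1, x1, p, t))) differentiable (at t)"
        using differentiable_chain_at[of "\<lambda>t. (t1, x1, p, t)" t "\<lambda>z. V \<epsilon> (1, z)"] U_diff[OF \<epsilon> Z[OF that]]
        by (simp add: o_def)
      then show ?thesis by (simp add: w_def vector_derivative_works)
    qed
    have key: "vector_derivative w (at \<tau>) = F \<epsilon> (\<tau>, w \<tau>, p)"
      if t: "t \<in> J" "t \<noteq> t1" and \<sigma>: "\<sigma> \<in> {0..1}" and \<tau>: "\<tau> = t1 + \<sigma> * (t - t1)" for t \<sigma> \<tau>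
    proof -
      have d1: "((\<lambda>\<sigma>. t1 + \<sigma> * (t - t1)) has_vector_derivative (t - t1)) (at \<sigma> within {0..1})"
        by (auto intro!: derivative_eq_intros simp: has_real_derivative_iff_has_vector_derivative[symmetric])
      have "((\<lambda>\<sigma>. w (t1 + \<sigma> * (t - t1))) has_vector_derivative (t - t1) *\<^sub>R vector_derivative w (at \<tau>)) (at \<sigma> within {0..1})"
        using vector_diff_chain_within[OF d1 has_vector_derivative_at_within[OF w_diff]] line[OF mem(1) t(1) \<sigma>]
        by (simp add: o_def \<tau>)
      moreover have "((\<lambda>\<sigma>. w (t1 + \<sigma> * (t - t1))) has_vector_derivative (t - t1) *\<^sub>R F \<epsilon> (\<tau>, w \<tau>, p)) (at \<sigma> within {0..1})"
      proof (rule has_vector_derivative_transform[OF \<sigma>])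
        show "((\<lambda>\<sigma>. V \<epsilon> (\<sigma>, t1, x1, p, t)) has_vector_derivative (t - t1) *\<^sub>R F \<epsilon> (\<tau>, w \<tau>, p)) (at \<sigma> within {0..1})"
          using V_ode[OF \<epsilon> \<sigma> Z[OF t(1)]] scaling[OF t(1) \<sigma>] by (simp add: H_eq \<tau>)
      qed (use scaling[OF t(1)] in simp)
      ultimately have "(t - t1) *\<^sub>R vector_derivative w (at \<tau>) = (t - t1) *\<^sub>R F \<epsilon> (\<tau>, w \<tau>, p)"
        using \<sigma> by (intro vector_derivative_unique_within_closed_interval[of 0 1 \<sigma>]) auto
      then show ?thesis using t(2) by simp
    qed
    have ode: "vector_derivative w (at t) = F \<epsilon> (t, w t, p)" if t: "t \<in> J" for t
    proof (cases "t = t1")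
      case False
      then show ?thesis using key[OF t False, of 1 t] by simp
    next
      case True
      \<comment> \<open>at the initial time, the scaling relation is used with any other end point\<close>
      obtain t' where "t' \<in> J" "t' \<noteq> t1"
      proof (cases "t1 = t0")
        case True
        show ?thesis by (rule that[of "t0 + h / 2"]) (use True d in \<open>auto simp: J_def\<close>)
      next
        case False
        show ?thesis by (rule that[of t0]) (use False d in \<open>auto simp: J_def\<close>)
      qed
      then show ?thesis using key[of t' 0 t] True by simp
    qed
    show "u \<epsilon> (t1, x1, p, t1) = x1"
      using scaling[OF t1J, of 0] V0[OF \<epsilon> Z[OF t1J]] \<epsilon> by (simp add: u_def w_def)
    show "((\<lambda>t. u \<epsilon> (t1, x1, p, t)) has_vector_derivative F \<epsilon> (t, u \<epsilon> (t1, x1, p, t), p)) (at t)" if "t \<in> J" for t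
      using w_diff[OF that] \<epsilon> unfolding ode[OF that] by (simp add: u_def w_def)
  qed
qed

section \<open>Uniqueness and the main result\<close>

text \<open>
  Gronwall's inequality for nets: an approximate solution with negligible residual and negligible
  initial error differs from the exact one by a negligible amount, because the growth factor
  \<open>e\<^bsup>C |log \<epsilon>|\<^esup>\<close> is moderate.
\<close>
lemma null_net_solution_difference:
  fixes v w :: "real \<Rightarrow> real \<Rightarrow> 'x::euclidean_space"
  assumes "compact S" "convex S" and \<tau>: "\<And>\<epsilon>. \<sigma> \<epsilon> \<in> S" "\<And>\<epsilon>. \<tau> \<epsilon> \<in> S"
    and w: "\<forall>\<^sub>F \<epsilon> in at_right 0. \<forall>t\<in>S. w \<epsilon> t \<in> B \<and> (w \<epsilon> has_vector_derivative w' \<epsilon> t) (at t)"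
    and v: "\<forall>\<^sub>F \<epsilon> in at_right 0. \<forall>t\<in>S. v \<epsilon> t \<in> B \<and> (v \<epsilon> has_vector_derivative g \<epsilon> t (v \<epsilon> t)) (at t)"
    and lip: "\<forall>\<^sub>F \<epsilon> in at_right 0. \<forall>t\<in>S. \<forall>x\<in>B. \<forall>y\<in>B. norm (g \<epsilon> t x - g \<epsilon> t y) \<le> C * \<bar>ln \<epsilon>\<bar> * norm (x - y)"
    and res: "null_bound S (\<lambda>\<epsilon> t. w' \<epsilon> t - g \<epsilon> t (w \<epsilon> t))"
    and init: "null_net (\<lambda>\<epsilon>. w \<epsilon> (\<sigma> \<epsilon>) - v \<epsilon> (\<sigma> \<epsilon>))"
  shows "null_net (\<lambda>\<epsilon>. w \<epsilon> (\<tau> \<epsilon>) - v \<epsilon> (\<tau> \<epsilon>))"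
  unfolding null_net_def
proof (rule null_boundI)
  fix m
  obtain R where R: "\<And>t. t \<in> S \<Longrightarrow> norm t \<le> R"
    using compact_imp_bounded[OF assms(1)] by (auto simp: bounded_iff)
  define D where "D = 2 * \<bar>R\<bar>"
  have D: "D \<ge> 0" "\<bar>\<tau> \<epsilon> - \<sigma> \<epsilon>\<bar> \<le> D" for \<epsilon>
    using R[OF \<tau>(1), of \<epsilon>] R[OF \<tau>(2), of \<epsilon>] by (auto simp: D_def)
  have "moderate_bound (UNIV :: unit set) (\<lambda>\<epsilon> _. exp (D * \<bar>C\<bar> * \<bar>ln \<epsilon>\<bar> + 1))"
    by (rule moderate_bound_exp_log)
  then obtain N where N: "\<forall>\<^sub>F \<epsilon> in at_right 0. \<forall>_\<in>(UNIV :: unit set). norm (exp (D * \<bar>C\<bar> * \<bar>ln \<epsilon>\<bar> + 1)) \<le> (1 / \<epsilon>) ^ N"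
    by (rule moderate_boundE)
  \<comment> \<open>errors of order \<open>N + m\<close> make up for the growth factor of order \<open>-N\<close>\<close>
  have "\<forall>\<^sub>F \<epsilon> in at_right 0. \<forall>_\<in>(UNIV :: unit set). norm (w \<epsilon> (\<tau> \<epsilon>) - v \<epsilon> (\<tau> \<epsilon>)) \<le> (1 + D) * \<epsilon> ^ m"
    using N w v lip null_boundD[OF res, of "N + m"] null_boundD[OF init[unfolded null_net_def], of "N + m"]
      eventually_at_right_small[OF zero_less_one]
  proof eventually_elim
    case (elim \<epsilon>)
    have \<epsilon>: "0 < \<epsilon>" using elim(7) by simp
    define \<theta> where "\<theta> = (\<lambda>s. \<sigma> \<epsilon> + s * (\<tau> \<epsilon> - \<sigma> \<epsilon>))"
    have \<theta>: "\<theta> s \<in> S" if "s \<in> {0..1}" for s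
      unfolding \<theta>_def by (rule convex_line_point[OF assms(2) \<tau> that])
    define \<rho> where "\<rho> = (\<lambda>s. w \<epsilon> (\<theta> s) - v \<epsilon> (\<theta> s))"
    have "norm (\<rho> 1) \<le> exp (D * \<bar>C\<bar> * \<bar>ln \<epsilon>\<bar> + 1) * (norm (\<rho> 0) + D * \<epsilon> ^ (N + m))"
    proof (rule gronwall_unit_interval[where r' = "\<lambda>s. (\<tau> \<epsilon> - \<sigma> \<epsilon>) *\<^sub>R (w' \<epsilon> (\<theta> s) - g \<epsilon> (\<theta> s) (v \<epsilon> (\<theta> s)))"])
      fix s :: real assume s: "s \<in> {0..1}"
      note \<theta>s = \<theta>[OF s]
      have d1: "(\<theta> has_vector_derivative (\<tau> \<epsilon> - \<sigma> \<epsilon>)) (at s within {0..1})"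
        unfolding \<theta>_def
        by (auto intro!: derivative_eq_intros simp: has_real_derivative_iff_has_vector_derivative[symmetric])
      have "(w \<epsilon> has_vector_derivative w' \<epsilon> (\<theta> s)) (at (\<theta> s) within \<theta> ` {0..1})"
        using elim(2) \<theta>s by (blast intro: has_vector_derivative_at_within)
      from vector_diff_chain_within[OF d1 this]
      have dw: "((\<lambda>s. w \<epsilon> (\<theta> s)) has_vector_derivative (\<tau> \<epsilon> - \<sigma> \<epsilon>) *\<^sub>R w' \<epsilon> (\<theta> s)) (at s within {0..1})"
        by (simp add: o_def)
      have "(v \<epsilon> has_vector_derivative g \<epsilon> (\<theta> s) (v \<epsilon> (\<theta> s))) (at (\<theta> s) within \<theta> ` {0..1})"
        using elim(3) \<theta>s by (blast intro: has_vector_derivative_at_within)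
      from vector_diff_chain_within[OF d1 this]
      have dv: "((\<lambda>s. v \<epsilon> (\<theta> s)) has_vector_derivative (\<tau> \<epsilon> - \<sigma> \<epsilon>) *\<^sub>R g \<epsilon> (\<theta> s) (v \<epsilon> (\<theta> s))) (at s within {0..1})"
        by (simp add: o_def)
      show "(\<rho> has_vector_derivative (\<tau> \<epsilon> - \<sigma> \<epsilon>) *\<^sub>R (w' \<epsilon> (\<theta> s) - g \<epsilon> (\<theta> s) (v \<epsilon> (\<theta> s)))) (at s within {0..1})"
        unfolding \<rho>_def scaleR_diff_right by (rule has_vector_derivative_diff[OF dw dv])
      have "norm (g \<epsilon> (\<theta> s) (w \<epsilon> (\<theta> s)) - g \<epsilon> (\<theta> s) (v \<epsilon> (\<theta> s))) \<le> C * \<bar>ln \<epsilon>\<bar> * norm (\<rho> s)"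
        using elim(2-4) \<theta>s unfolding \<rho>_def by blast
      also have "\<dots> \<le> \<bar>C\<bar> * \<bar>ln \<epsilon>\<bar> * norm (\<rho> s)" by (intro mult_right_mono) auto
      finally have 1: "norm (g \<epsilon> (\<theta> s) (w \<epsilon> (\<theta> s)) - g \<epsilon> (\<theta> s) (v \<epsilon> (\<theta> s))) \<le> \<bar>C\<bar> * \<bar>ln \<epsilon>\<bar> * norm (\<rho> s)" .
      have 2: "norm (w' \<epsilon> (\<theta> s) - g \<epsilon> (\<theta> s) (w \<epsilon> (\<theta> s))) \<le> \<epsilon> ^ (N + m)" using elim(5) \<theta>s by blast
      have "norm (w' \<epsilon> (\<theta> s) - g \<epsilon> (\<theta> s) (v \<epsilon> (\<theta> s))) \<le> \<epsilon> ^ (N + m) + \<bar>C\<bar> * \<bar>ln \<epsilon>\<bar> * norm (\<rho> s)"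
        by (rule norm_diff_triangle_le[OF 2 1])
      then have "norm ((\<tau> \<epsilon> - \<sigma> \<epsilon>) *\<^sub>R (w' \<epsilon> (\<theta> s) - g \<epsilon> (\<theta> s) (v \<epsilon> (\<theta> s))))
          \<le> D * (\<epsilon> ^ (N + m) + \<bar>C\<bar> * \<bar>ln \<epsilon>\<bar> * norm (\<rho> s))"
        unfolding norm_scaleR real_norm_def using D by (intro mult_mono) auto
      then show "norm ((\<tau> \<epsilon> - \<sigma> \<epsilon>) *\<^sub>R (w' \<epsilon> (\<theta> s) - g \<epsilon> (\<theta> s) (v \<epsilon> (\<theta> s))))
          \<le> D * \<bar>C\<bar> * \<bar>ln \<epsilon>\<bar> * norm (\<rho> s) + D * \<epsilon> ^ (N + m)"
        by (simp add: algebra_simps)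
    qed (use D \<epsilon> in auto)
    also have "\<dots> \<le> (1 / \<epsilon>) ^ N * (\<epsilon> ^ (N + m) + D * \<epsilon> ^ (N + m))"
      using elim(1,6) D(1) \<epsilon> by (intro mult_mono add_right_mono) (auto simp: \<rho>_def \<theta>_def)
    also have "\<dots> = (1 + D) * \<epsilon> ^ m" using \<epsilon> by (simp add: power_add power_divide field_simps)
    finally show ?case by (simp add: \<rho>_def \<theta>_def)
  qed
  then show "\<exists>C. \<forall>\<^sub>F \<epsilon> in at_right 0. \<forall>_\<in>(UNIV :: unit set). norm (w \<epsilon> (\<tau> \<epsilon>) - v \<epsilon> (\<tau> \<epsilon>)) \<le> C * \<epsilon> ^ m"
    by blast
qed

theorem theorem3p10:
  fixes I J :: "real set"
    and U :: "(real ^ 'n) set"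
    and P :: "(real ^ 'l) set"
    and tg0 :: "(real \<Rightarrow> real) set" and t0 :: real
    and xg0 :: "(real \<Rightarrow> real ^ 'n) set" and x0 :: "real ^ 'n"
    and F :: "(real \<Rightarrow> real \<times> (real ^ 'n) \<times> (real ^ 'l) \<Rightarrow> real ^ 'n) set"
    and F' :: "real \<Rightarrow> real \<times> (real ^ 'n) \<times> (real ^ 'l) \<Rightarrow> real ^ 'n"
    and Q :: "(real \<times> (real ^ 'n)) set"
    and \<alpha> \<beta> a \<epsilon>0 h :: real
  assumes "open I" "is_interval I" "open U" "open P" "P \<noteq> {}"
    and "near_standard I tg0 t0"
    and "near_standard U xg0 x0"
    and "F \<in> gfuns (I \<times> U \<times> P)"
    and "\<alpha> > 0" "compactly_in {t0 - \<alpha>..t0 + \<alpha>} I"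
    and "\<beta> > 0" "compactly_in (cball x0 \<beta>) U"
    and Q_def: "Q = {t0 - \<alpha>..t0 + \<alpha>} \<times> cball x0 \<beta>"
    and "F' \<in> F"
    and "a > 0" "\<epsilon>0 \<in> {0<..1}"
    and "\<forall>\<epsilon>\<in>{0<..\<epsilon>0}. \<forall>(t, x)\<in>Q. \<forall>p\<in>P. norm (F' \<epsilon> (t, x, p)) \<le> a"
    and "\<forall>K. compact K \<and> K \<subseteq> P \<longrightarrow>
      sup_bigo (Q \<times> K)
        (\<lambda>\<epsilon> ((t, x), p). onorm (frechet_derivative (\<lambda>y. F' \<epsilon> (t, y, p)) (at x)))
        (\<lambda>\<epsilon>. \<bar>ln \<epsilon>\<bar>)"
    and "h \<in> {0<..<min \<alpha> (\<beta> / a)}"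
    and J_def: "J = {t0 - h<..<t0 + h}"
  shows "\<exists>J1 U1. open J1 \<and> t0 \<in> J1 \<and> J1 \<subseteq> J \<and> open U1 \<and> x0 \<in> U1 \<and> U1 \<subseteq> U \<and>
    (\<exists>\<delta>>0. \<forall>\<gamma>\<in>{0<..<\<beta>}. \<beta> - \<gamma> < \<delta> \<longrightarrow>
      (\<exists>!u. u \<in> gfuns_into (J1 \<times> U1 \<times> P \<times> J) (ball x0 \<gamma>) \<and>
        (\<forall>t1\<in>gpoints_c J1. \<forall>x1\<in>gpoints_c U1. \<forall>p\<in>gpoints_c P.
          insert_data J u t1 x1 p \<in> gfuns_into J (ball x0 \<gamma>) \<and>
          ivp_solution I U J (insert_param (I \<times> U) F p)
            (point_embed J t1) (point_embed U x1) (insert_data J u t1 x1 p))))"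
proof -
  note opnI = assms(1) and opnU = assms(3) and opnP = assms(4)
  note F_gf = assms(8) and F'_in = assms(14)
  have h: "0 < h" "h < \<alpha>" "a * h < \<beta>"
    using assms(19,15) by (auto simp: pos_less_divide_eq mult.commute)
  have a: "a > 0" by (rule assms(15))
  have eps0: "\<epsilon>0 \<in> {0<..1}" by (rule assms(16))
  have opnIUP: "open (I \<times> U \<times> P)" using opnI opnU opnP by (intro open_Times)
  have F'_mod: "F' \<in> moderate_nets (I \<times> U \<times> P)" by (rule gfuns_cases(1)[OF opnIUP F_gf F'_in])
  \<comment> \<open>solutions starting within \<open>d\<close> of \<open>(t0, x0)\<close> move by at most \<open>a (h + d)\<close>, so that they stay in
    the ball of radius \<open>r < \<beta>\<close>\<close>
  define r where "r = (\<beta> + a * h) / 2"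
  define d where "d = min h ((\<beta> - a * h) / (2 * (1 + a)))"
  have d: "0 < d" "d \<le> h" using h a by (auto simp: d_def)
  have "d \<le> (\<beta> - a * h) / (2 * (1 + a))" by (simp add: d_def)
  then have "d * (2 * (1 + a)) \<le> \<beta> - a * h" using a by (subst (asm) pos_le_divide_eq) auto
  then have r: "d + a * (h + d) \<le> r" "r < \<beta>" using h by (auto simp: r_def algebra_simps)
  have r0: "0 \<le> r" "d \<le> r"
  proof -
    have "0 \<le> a * (h + d)" using a h d by simp
    then show "0 \<le> r" "d \<le> r" using r(1) d by linarith+
  qed
  define T where "T = ball t0 d"
  define X where "X = ball x0 d"
  define Z where "Z = T \<times> X \<times> P \<times> J"
  have h_sub: "{t0 - h..t0 + h} \<subseteq> {t0 - \<alpha>..t0 + \<alpha>}" using h by auto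
  have I_sub: "{t0 - h..t0 + h} \<subseteq> I"
    using h_sub assms(10) compactly_in_open[OF opnI] by blast
  have U_sub: "cball x0 \<beta> \<subseteq> U" using assms(12) compactly_in_open[OF opnU] by blast
  have J_sub: "J \<subseteq> {t0 - h..t0 + h}" by (auto simp: J_def)
  have opn: "open T" "open X" "open J" by (auto simp: T_def X_def J_def)
  have opnZ: "open Z" unfolding Z_def using opn opnP by (intro open_Times)
  have TJ: "T \<subseteq> J" using d by (auto simp: T_def J_def dist_real_def)
  have XU: "X \<subseteq> U" using U_sub r r0 by (auto simp: X_def)
  have JI: "J \<subseteq> I" using J_sub I_sub by auto
  have bd: "norm (F' \<epsilon> (t, x, p)) \<le> a"
    if "\<epsilon> \<in> {0<..\<epsilon>0}" "t \<in> {t0 - h..t0 + h}" "x \<in> cball x0 \<beta>" "p \<in> P" for \<epsilon> t x p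
  proof -
    have "(t, x) \<in> Q" using that(2,3) h_sub by (auto simp: Q_def)
    then show ?thesis using assms(17) that(1,4) by fast
  qed
  have F'_der: "((\<lambda>y. F' \<epsilon> (t, y, p)) has_derivative frechet_derivative (\<lambda>y. F' \<epsilon> (t, y, p)) (at x)) (at x)"
    if "\<epsilon> \<in> {0<..1}" "t \<in> I" "x \<in> U" "p \<in> P" for \<epsilon> t x p
  proof -
    have "pderivs [] (F' \<epsilon>) differentiable (at (t, x, p))"
      by (rule pderivs_differentiable[OF opnIUP zero_less_one _ moderate_Ck_of_moderate_nets[OF opnIUP F'_mod]])
        (use that in auto)
    then have "(F' \<epsilon> has_derivative frechet_derivative (F' \<epsilon>) (at (t, x, p))) (at (t, x, p))"
      by (simp add: frechet_derivative_works)
    from has_derivative_compose[OF has_derivative_Pair[OF has_derivative_const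
          has_derivative_Pair[OF has_derivative_ident has_derivative_const]] this]
    have "(\<lambda>y. F' \<epsilon> (t, y, p)) differentiable (at x)" by (auto simp: differentiable_def)
    then show ?thesis by (simp add: frechet_derivative_works)
  qed
  have F'_log: "\<exists>C. \<forall>\<^sub>F \<epsilon> in at_right 0. \<forall>t\<in>{t0 - h..t0 + h}. \<forall>x\<in>cball x0 \<beta>. \<forall>p\<in>K. \<forall>c\<in>Basis.
         norm (frechet_derivative (\<lambda>y. F' \<epsilon> (t, y, p)) (at x) c) \<le> C * \<bar>ln \<epsilon>\<bar>"
    if K: "compact K" "K \<subseteq> P" for K
  proof -
    obtain C where C: "\<forall>\<^sub>F \<epsilon> in at_right 0. \<forall>q\<in>Q \<times> K.
        norm ((\<lambda>((t, x), p). onorm (frechet_derivative (\<lambda>y. F' \<epsilon> (t, y, p)) (at x))) q) \<le> C * \<bar>ln \<epsilon>\<bar>"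
      using assms(18) K unfolding sup_bigo_def by blast
    have "\<forall>\<^sub>F \<epsilon> in at_right 0. \<forall>t\<in>{t0 - h..t0 + h}. \<forall>x\<in>cball x0 \<beta>. \<forall>p\<in>K. \<forall>c\<in>Basis.
         norm (frechet_derivative (\<lambda>y. F' \<epsilon> (t, y, p)) (at x) c) \<le> C * \<bar>ln \<epsilon>\<bar>"
      using C eventually_at_right_small[OF zero_less_one]
    proof eventually_elim
      case (elim \<epsilon>)
      show ?case
      proof (intro ballI)
        fix t x p and c :: "real ^ 'n"
        assume t: "t \<in> {t0 - h..t0 + h}" and x: "x \<in> cball x0 \<beta>" and p: "p \<in> K" and c: "c \<in> Basis"
        let ?D = "frechet_derivative (\<lambda>y. F' \<epsilon> (t, y, p)) (at x)"
        have "((\<lambda>y. F' \<epsilon> (t, y, p)) has_derivative ?D) (at x)"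
        proof (rule F'_der)
          show "\<epsilon> \<in> {0<..1}" using elim(2) by simp
          show "t \<in> I" "x \<in> U" "p \<in> P" using subsetD[OF I_sub t] subsetD[OF U_sub x] subsetD[OF K(2) p] .
        qed
        then have "norm (?D c) \<le> onorm ?D * norm c"
          by (intro onorm has_derivative_bounded_linear)
        also have "\<dots> = onorm ?D" using c by simp
        also have "\<dots> \<le> C * \<bar>ln \<epsilon>\<bar>"
        proof -
          have "((t, x), p) \<in> Q \<times> K" using t x p h_sub by (auto simp: Q_def)
          from bspec[OF elim(1) this] show ?thesis by simp
        qed
        finally show "norm (?D c) \<le> C * \<bar>ln \<epsilon>\<bar>" .
      qed
    qed
    then show ?thesis by blast
  qed
  obtain v where v_mod: "v \<in> moderate_nets Z"
    and v_in: "\<And>\<epsilon> z. z \<in> Z \<Longrightarrow> v \<epsilon> z \<in> cball x0 r"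
    and v_init: "\<And>\<epsilon> t1 x1 p. \<epsilon> \<in> {0<..\<epsilon>0} \<Longrightarrow> t1 \<in> T \<Longrightarrow> x1 \<in> X \<Longrightarrow> p \<in> P \<Longrightarrow> v \<epsilon> (t1, x1, p, t1) = x1"
    and v_ode: "\<And>\<epsilon> t1 x1 p t. \<epsilon> \<in> {0<..\<epsilon>0} \<Longrightarrow> t1 \<in> T \<Longrightarrow> x1 \<in> X \<Longrightarrow> p \<in> P \<Longrightarrow> t \<in> J \<Longrightarrow>
       ((\<lambda>t. v \<epsilon> (t1, x1, p, t)) has_vector_derivative F' \<epsilon> (t, v \<epsilon> (t1, x1, p, t), p)) (at t)"
    by (rule solution_net[OF opnI opnU opnP F'_mod eps0 I_sub U_sub bd F'_log d r less_imp_le[OF a]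
          T_def X_def J_def, folded Z_def]; (assumption | rule that; assumption))
  have v_ev: "eventually_moderate Z v" by (rule moderate_nets_imp_eventually_moderate[OF opnZ v_mod])
  have eps0': "0 < \<epsilon>0" using eps0 by simp
  have main: "\<exists>!u. u \<in> gfuns_into (T \<times> X \<times> P \<times> J) (ball x0 \<gamma>) \<and>
        (\<forall>t1\<in>gpoints_c T. \<forall>x1\<in>gpoints_c X. \<forall>p\<in>gpoints_c P.
          insert_data J u t1 x1 p \<in> gfuns_into J (ball x0 \<gamma>) \<and>
          ivp_solution I U J (insert_param (I \<times> U) F p)
            (point_embed J t1) (point_embed U x1) (insert_data J u t1 x1 p))"
    if \<gamma>: "r < \<gamma>" "\<gamma> < \<beta>" for \<gamma>
    unfolding Z_def[symmetric]
  proof (rule ex1I[of _ "gf_class Z v"])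
    define V where "V = ball x0 \<gamma>"
    have opnV: "open V" by (simp add: V_def)
    have rV: "cball x0 r \<subseteq> V" using \<gamma> by (auto simp: V_def)
    have V\<beta>: "V \<subseteq> cball x0 \<beta>" using \<gamma> by (auto simp: V_def)
    have VU: "V \<subseteq> U" using V\<beta> U_sub by auto
    have "maps_c_boundedly Z V v"
      by (rule maps_c_boundedly_into_compact[OF always_eventually compact_cball rV])
        (use v_in in blast)
    then have v_into: "gf_class Z v \<in> gfuns_into Z V"
      by (rule gf_class_in_gfuns_into[OF opnZ opnV v_ev])
    have v_gf: "gf_class Z v \<in> gfuns Z" by (rule gf_class_in_gfuns[OF opnZ v_ev])
    have v_self: "v \<in> gf_class Z v" by (rule gf_class_self[OF opnZ v_mod])
    have "insert_data J (gf_class Z v) t1 x1 p \<in> gfuns_into J V \<and>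
          ivp_solution I U J (insert_param (I \<times> U) F p)
            (point_embed J t1) (point_embed U x1) (insert_data J (gf_class Z v) t1 x1 p)"
      if t1: "t1 \<in> gpoints_c T" and x1: "x1 \<in> gpoints_c X" and p: "p \<in> gpoints_c P" for t1 x1 p
    proof -
      obtain t' where t': "t' \<in> t1" using gpoints_c_cases[OF opn(1) t1] by blast
      obtain x' where x': "x' \<in> x1" using gpoints_c_cases[OF opn(2) x1] by blast
      obtain p' where p': "p' \<in> p" using gpoints_c_cases[OF opnP p] by blast
      define w where "w = (\<lambda>\<epsilon> t. v \<epsilon> (t' \<epsilon>, x' \<epsilon>, p' \<epsilon>, t))"
      note ins = insert_data_eq[OF opn(1,2) opnP opn(3) v_gf[unfolded Z_def] v_self[unfolded Z_def] t1 t' x1 x' p p',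
          folded Z_def]
      have w_ev: "eventually_moderate J w" using ins(2) by (simp add: w_def)
      have w_eq: "insert_data J (gf_class Z v) t1 x1 p = gf_class J w" using ins(1) by (simp add: w_def)
      have slot: "\<forall>\<^sub>F \<epsilon> in at_right 0. \<forall>t\<in>J. (t' \<epsilon>, x' \<epsilon>, p' \<epsilon>, t) \<in> Z"
        using ins(3) by (simp add: maps_c_boundedly_def image_subset_iff)
      have w_r: "\<forall>\<^sub>F \<epsilon> in at_right 0. w \<epsilon> ` J \<subseteq> cball x0 r"
        using slot by eventually_elim (use v_in in \<open>unfold w_def, blast\<close>)
      have w_V: "maps_c_boundedly J V w" by (rule maps_c_boundedly_into_compact[OF w_r compact_cball rV])
      have w_U: "maps_c_boundedly J U w" by (rule maps_c_boundedly_mono[OF w_V VU])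
      note par = insert_param_eq[OF opnI opnU opnP F_gf F'_in p p']
      have "null_on_compacts J (\<lambda>\<epsilon> t. vector_derivative (w \<epsilon>) (at t) - (\<lambda>(t, x). F' \<epsilon> (t, x, p' \<epsilon>)) (t, w \<epsilon> t))"
      proof (rule null_on_compacts_eventually_zero)
        show "\<forall>\<^sub>F \<epsilon> in at_right 0. \<forall>t\<in>J. vector_derivative (w \<epsilon>) (at t) - (\<lambda>(t, x). F' \<epsilon> (t, x, p' \<epsilon>)) (t, w \<epsilon> t) = 0"
          using slot eventually_at_right_small[OF eps0']
        proof eventually_elim
          case (elim \<epsilon>)
          show ?case
          proof
            fix t assume t: "t \<in> J"
            have "(t' \<epsilon>, x' \<epsilon>, p' \<epsilon>, t) \<in> Z" using elim(1) t by blast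
            then have "(w \<epsilon> has_vector_derivative F' \<epsilon> (t, w \<epsilon> t, p' \<epsilon>)) (at t)"
              unfolding w_def using elim(2) by (intro v_ode) (auto simp: Z_def)
            then show "vector_derivative (w \<epsilon>) (at t) - (\<lambda>(t, x). F' \<epsilon> (t, x, p' \<epsilon>)) (t, w \<epsilon> t) = 0"
              by (simp add: vector_derivative_at)
          qed
        qed
      qed
      moreover have "null_net (\<lambda>\<epsilon>. w \<epsilon> (t' \<epsilon>) - x' \<epsilon>)"
      proof (rule null_net_eventually_zero)
        have "t0 \<in> J" using h by (simp add: J_def)
        show "\<forall>\<^sub>F \<epsilon> in at_right 0. w \<epsilon> (t' \<epsilon>) - x' \<epsilon> = 0"
          using slot eventually_at_right_small[OF eps0']
        proof eventually_elim
          case (elim \<epsilon>)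
          have "(t' \<epsilon>, x' \<epsilon>, p' \<epsilon>, t0) \<in> Z" using elim(1) \<open>t0 \<in> J\<close> by blast
          then show ?case unfolding w_def using elim(2) by (simp add: v_init Z_def)
        qed
      qed
      ultimately have "ivp_solution I U J (insert_param (I \<times> U) F p) (point_embed J t1) (point_embed U x1) (gf_class J w)"
        unfolding par(1)
        using ivp_solution_iff[OF opnI opnU opn(3) JI opn(1) TJ opn(2) XU w_ev w_U par(2) t1 t' x1 x'] by blast
      then show ?thesis
        unfolding w_eq using gf_class_in_gfuns_into[OF opn(3) opnV w_ev w_V] by blast
    qed
    then show "gf_class Z v \<in> gfuns_into Z (ball x0 \<gamma>) \<and>
        (\<forall>t1\<in>gpoints_c T. \<forall>x1\<in>gpoints_c X. \<forall>p\<in>gpoints_c P.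
          insert_data J (gf_class Z v) t1 x1 p \<in> gfuns_into J (ball x0 \<gamma>) \<and>
          ivp_solution I U J (insert_param (I \<times> U) F p)
            (point_embed J t1) (point_embed U x1) (insert_data J (gf_class Z v) t1 x1 p))"
      using v_into unfolding V_def by blast
    fix y assume y: "y \<in> gfuns_into Z (ball x0 \<gamma>) \<and>
        (\<forall>t1\<in>gpoints_c T. \<forall>x1\<in>gpoints_c X. \<forall>p\<in>gpoints_c P.
          insert_data J y t1 x1 p \<in> gfuns_into J (ball x0 \<gamma>) \<and>
          ivp_solution I U J (insert_param (I \<times> U) F p)
            (point_embed J t1) (point_embed U x1) (insert_data J y t1 x1 p))"
    obtain y' where y': "y' \<in> y" "c_bounded Z V y'" and y_gf: "y \<in> gfuns Z"
      using y unfolding gfuns_into_def V_def by blast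
    have y'_mod: "y' \<in> moderate_nets Z" and y'_c: "maps_c_boundedly Z V y'"
      using y'(2) unfolding c_bounded_iff[OF opnZ opnV] by auto
    have y'_ev: "eventually_moderate Z y'" by (rule moderate_nets_imp_eventually_moderate[OF opnZ y'_mod])
    have diff: "pderivs [] (f \<epsilon>) differentiable (at z)" if "f \<in> moderate_nets Z" "\<epsilon> \<in> {0<..1}" "z \<in> Z" for f \<epsilon> z
      by (rule pderivs_differentiable[OF opnZ zero_less_one _ moderate_Ck_of_moderate_nets[OF opnZ that(1)] that(2,3)]) simp
    have "null_on_compacts Z (\<lambda>\<epsilon> z. y' \<epsilon> z - v \<epsilon> z)"
      unfolding null_on_compacts_def
    proof (intro allI impI)
      fix K assume K: "compact K" "K \<subseteq> Z"
      show "null_bound K (\<lambda>\<epsilon> z. y' \<epsilon> z - v \<epsilon> z)"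
      proof (cases "K = {}")
        case True
        then show ?thesis by (simp add: null_bound_def)
      next
        case False
        \<comment> \<open>test the two solutions at the points where they differ most\<close>
        have "\<exists>z\<in>K. \<epsilon> \<in> {0<..1} \<longrightarrow> (\<forall>z'\<in>K. norm (y' \<epsilon> z' - v \<epsilon> z') \<le> norm (y' \<epsilon> z - v \<epsilon> z))" for \<epsilon>
        proof (cases "\<epsilon> \<in> {0<..1}")
          case True
          have "continuous_on K (f \<epsilon>)" if "f \<in> moderate_nets Z" for f :: "real \<Rightarrow> real \<times> (real ^ 'n) \<times> (real ^ 'l) \<times> real \<Rightarrow> real ^ 'n"
            using diff[OF that True] K(2)
            by (intro continuous_at_imp_continuous_on ballI differentiable_imp_continuous_within) auto
          then have "continuous_on K (\<lambda>z. norm (y' \<epsilon> z - v \<epsilon> z))"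
            using y'_mod v_mod by (intro continuous_intros)
          from continuous_attains_sup[OF K(1) False this] show ?thesis by blast
        qed (use False in auto)
        then obtain z where z: "\<And>\<epsilon>. z \<epsilon> \<in> K"
          "\<And>\<epsilon> z'. \<epsilon> \<in> {0<..1} \<Longrightarrow> z' \<in> K \<Longrightarrow> norm (y' \<epsilon> z' - v \<epsilon> z') \<le> norm (y' \<epsilon> (z \<epsilon>) - v \<epsilon> (z \<epsilon>))"
          by metis
        define t' x' p' \<tau> where "t' = (\<lambda>\<epsilon>. fst (z \<epsilon>))" and "x' = (\<lambda>\<epsilon>. fst (snd (z \<epsilon>)))"
          and "p' = (\<lambda>\<epsilon>. fst (snd (snd (z \<epsilon>))))" and "\<tau> = (\<lambda>\<epsilon>. snd (snd (snd (z \<epsilon>))))"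
        have z_eq: "z \<epsilon> = (t' \<epsilon>, x' \<epsilon>, p' \<epsilon>, \<tau> \<epsilon>)" for \<epsilon> by (simp add: t'_def x'_def p'_def \<tau>_def)
        define Kt Kx Kp K\<tau> where "Kt = fst ` K" and "Kx = (\<lambda>z. fst (snd z)) ` K"
          and "Kp = (\<lambda>z. fst (snd (snd z))) ` K" and "K\<tau> = (\<lambda>z. snd (snd (snd z))) ` K"
        have cpt: "compact Kt" "compact Kx" "compact Kp" "compact K\<tau>"
          unfolding Kt_def Kx_def Kp_def K\<tau>_def by (intro compact_continuous_image K continuous_intros)+
        have inc: "Kt \<subseteq> T" "Kx \<subseteq> X" "Kp \<subseteq> P" "K\<tau> \<subseteq> J"
          using K(2) unfolding Kt_def Kx_def Kp_def K\<tau>_def Z_def by force+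
        have mem: "t' \<epsilon> \<in> Kt" "x' \<epsilon> \<in> Kx" "p' \<epsilon> \<in> Kp" "\<tau> \<epsilon> \<in> K\<tau>" for \<epsilon>
          using z(1)[of \<epsilon>] unfolding t'_def x'_def p'_def \<tau>_def Kt_def Kx_def Kp_def K\<tau>_def by auto
        obtain t1 where t1: "t1 \<in> gpoints_c T" "t' \<in> t1" by (rule gpoints_c_of_net[OF opn(1) cpt(1) inc(1) mem(1)])
        obtain x1 where x1: "x1 \<in> gpoints_c X" "x' \<in> x1" by (rule gpoints_c_of_net[OF opn(2) cpt(2) inc(2) mem(2)])
        obtain p where p: "p \<in> gpoints_c P" "p' \<in> p" by (rule gpoints_c_of_net[OF opnP cpt(3) inc(3) mem(3)])
        define w where "w = (\<lambda>\<epsilon> t. y' \<epsilon> (t' \<epsilon>, x' \<epsilon>, p' \<epsilon>, t))"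
        note ins = insert_data_eq[OF opn(1,2) opnP opn(3) y_gf[unfolded Z_def] y'(1) t1 x1 p, folded Z_def]
        have w_ev: "eventually_moderate J w" using ins(2) by (simp add: w_def)
        have w_eq: "insert_data J y t1 x1 p = gf_class J w" using ins(1) by (simp add: w_def)
        have w_V: "maps_c_boundedly J V w"
          unfolding w_def by (rule maps_c_boundedly_compose[OF ins(3) y'_c])
        note par = insert_param_eq[OF opnI opnU opnP F_gf F'_in p]
        have "ivp_solution I U J (gf_class (I \<times> U) (\<lambda>\<epsilon> (t, x). F' \<epsilon> (t, x, p' \<epsilon>)))
            (point_embed J t1) (point_embed U x1) (gf_class J w)"
          using y t1(1) x1(1) p(1) unfolding w_eq[symmetric] par(1)[symmetric] by blast
        then have w_ode: "null_on_compacts J (\<lambda>\<epsilon> t. vector_derivative (w \<epsilon>) (at t) - F' \<epsilon> (t, w \<epsilon> t, p' \<epsilon>))"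
          and w_init: "null_net (\<lambda>\<epsilon>. w \<epsilon> (t' \<epsilon>) - x' \<epsilon>)"
          unfolding ivp_solution_iff[OF opnI opnU opn(3) JI opn(1) TJ opn(2) XU w_ev
              maps_c_boundedly_mono[OF w_V VU] par(2) t1 x1] by simp_all
        define S where "S = convex hull (Kt \<union> K\<tau>)"
        have S: "compact S" "convex S" "Kt \<union> K\<tau> \<subseteq> S"
          unfolding S_def
          by (rule compact_convex_hull[OF compact_Un[OF cpt(1,4)]] convex_convex_hull hull_subset)+
        have SJ: "S \<subseteq> J"
          unfolding S_def
        proof (rule hull_minimal)
          show "Kt \<union> K\<tau> \<subseteq> J" using inc(1,4) TJ by blast
          show "convex J" by (simp add: J_def)
        qed
        obtain C where C: "\<forall>\<^sub>F \<epsilon> in at_right 0. \<forall>t\<in>{t0 - h..t0 + h}. \<forall>x\<in>cball x0 \<beta>. \<forall>p\<in>Kp. \<forall>c\<in>Basis.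
           norm (frechet_derivative (\<lambda>y. F' \<epsilon> (t, y, p)) (at x) c) \<le> C * \<bar>ln \<epsilon>\<bar>"
          using F'_log[OF cpt(3) inc(3)] by blast
        define vp where "vp = (\<lambda>\<epsilon> t. v \<epsilon> (t' \<epsilon>, x' \<epsilon>, p' \<epsilon>, t))"
        have in_Z: "(t' \<epsilon>, x' \<epsilon>, p' \<epsilon>, t) \<in> Z" if "t \<in> J" for \<epsilon> t
          using that mem[of \<epsilon>] inc by (auto simp: Z_def)
        have "null_net (\<lambda>\<epsilon>. w \<epsilon> (\<tau> \<epsilon>) - vp \<epsilon> (\<tau> \<epsilon>))"
        proof (rule null_net_solution_difference[where S = S and B = "cball x0 \<beta>" and \<sigma> = t' and
              w' = "\<lambda>\<epsilon> t. vector_derivative (w \<epsilon>) (at t)" and g = "\<lambda>\<epsilon> t x. F' \<epsilon> (t, x, p' \<epsilon>)"])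
          show "t' \<epsilon> \<in> S" "\<tau> \<epsilon> \<in> S" for \<epsilon> using mem[of \<epsilon>] S(3) by auto
          have w_in: "\<forall>\<^sub>F \<epsilon> in at_right 0. w \<epsilon> ` J \<subseteq> V" using w_V by (simp add: maps_c_boundedly_def)
          obtain e where e: "e \<in> {0<..1}" "\<And>\<epsilon>. \<epsilon> \<in> {0<..e} \<Longrightarrow> smooth_on J (w \<epsilon>)"
            using eventually_moderate_smooth[OF opn(3) w_ev] by blast
          have w_diff: "(w \<epsilon> has_vector_derivative vector_derivative (w \<epsilon>) (at t)) (at t)"
            if "\<epsilon> \<in> {0<..e}" "t \<in> J" for \<epsilon> t
          proof -
            have "pderivs [] (w \<epsilon>) differentiable (at t)"
              using e(2)[OF that(1)] that(2) unfolding smooth_on_def by (metis empty_set empty_subsetI)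
            then show ?thesis by (simp add: vector_derivative_works)
          qed
          have "0 < e" using e(1) by simp
          show "\<forall>\<^sub>F \<epsilon> in at_right 0. \<forall>t\<in>S. w \<epsilon> t \<in> cball x0 \<beta> \<and>
              (w \<epsilon> has_vector_derivative vector_derivative (w \<epsilon>) (at t)) (at t)"
            using w_in eventually_at_right_small[OF \<open>0 < e\<close>]
          proof eventually_elim
            case (elim \<epsilon>)
            show ?case
            proof (intro ballI conjI)
              fix t assume "t \<in> S"
              then have t: "t \<in> J" using SJ by auto
              show "w \<epsilon> t \<in> cball x0 \<beta>" using elim(1) t V\<beta> by blast
              show "(w \<epsilon> has_vector_derivative vector_derivative (w \<epsilon>) (at t)) (at t)"
                by (rule w_diff[OF _ t]) (use elim(2) in simp)
            qed
          qed
          show "\<forall>\<^sub>F \<epsilon> in at_right 0. \<forall>t\<in>S. vp \<epsilon> t \<in> cball x0 \<beta> \<and>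
              (vp \<epsilon> has_vector_derivative F' \<epsilon> (t, vp \<epsilon> t, p' \<epsilon>)) (at t)"
            using eventually_at_right_small[OF eps0']
          proof eventually_elim
            case (elim \<epsilon>)
            show ?case
            proof (intro ballI conjI)
              fix t assume "t \<in> S"
              then have t: "t \<in> J" using SJ by auto
              show "vp \<epsilon> t \<in> cball x0 \<beta>"
                using v_in[OF in_Z[OF t], of \<epsilon> \<epsilon>] rV V\<beta> unfolding vp_def by blast
              show "(vp \<epsilon> has_vector_derivative F' \<epsilon> (t, vp \<epsilon> t, p' \<epsilon>)) (at t)"
                unfolding vp_def using elim in_Z[OF t, of \<epsilon>] by (intro v_ode) (auto simp: Z_def)
            qed
          qed
          show "\<forall>\<^sub>F \<epsilon> in at_right 0. \<forall>t\<in>S. \<forall>x\<in>cball x0 \<beta>. \<forall>y\<in>cball x0 \<beta>.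
              norm (F' \<epsilon> (t, x, p' \<epsilon>) - F' \<epsilon> (t, y, p' \<epsilon>)) \<le> (real DIM(real ^ 'n) * C) * \<bar>ln \<epsilon>\<bar> * norm (x - y)"
            using C eventually_at_right_small[OF zero_less_one]
          proof eventually_elim
            case (elim \<epsilon>)
            show ?case
            proof (intro ballI)
              fix t x y assume t: "t \<in> S" and xy: "x \<in> cball x0 \<beta>" "y \<in> cball x0 \<beta>"
              have th: "t \<in> {t0 - h..t0 + h}" using t SJ J_sub by auto
              have "norm (F' \<epsilon> (t, x, p' \<epsilon>) - F' \<epsilon> (t, y, p' \<epsilon>)) \<le> real DIM(real ^ 'n) * (C * \<bar>ln \<epsilon>\<bar>) * norm (x - y)"
              proof (rule lipschitz_by_partial_derivatives[OF convex_cball _ _ xy])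
                fix q assume q: "q \<in> cball x0 \<beta>"
                show "((\<lambda>x. F' \<epsilon> (t, x, p' \<epsilon>)) has_derivative frechet_derivative (\<lambda>y. F' \<epsilon> (t, y, p' \<epsilon>)) (at q)) (at q)"
                proof (rule F'_der)
                  show "\<epsilon> \<in> {0<..1}" using elim(2) by simp
                  show "t \<in> I" "q \<in> U" "p' \<epsilon> \<in> P"
                    using subsetD[OF I_sub th] subsetD[OF U_sub q] subsetD[OF inc(3) mem(3)] .
                qed
                show "norm (frechet_derivative (\<lambda>y. F' \<epsilon> (t, y, p' \<epsilon>)) (at q) c) \<le> C * \<bar>ln \<epsilon>\<bar>" if "c \<in> Basis" for c
                  using elim(1) th q mem(3) that by blast
              qed
              then show "norm (F' \<epsilon> (t, x, p' \<epsilon>) - F' \<epsilon> (t, y, p' \<epsilon>)) \<le> (real DIM(real ^ 'n) * C) * \<bar>ln \<epsilon>\<bar> * norm (x - y)"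
                by (simp only: mult.assoc)
            qed
          qed
          show "null_bound S (\<lambda>\<epsilon> t. vector_derivative (w \<epsilon>) (at t) - F' \<epsilon> (t, w \<epsilon> t, p' \<epsilon>))"
            by (rule null_on_compactsD[OF w_ode S(1) SJ])
          have "null_net (\<lambda>\<epsilon>. x' \<epsilon> - vp \<epsilon> (t' \<epsilon>))"
          proof (rule null_net_eventually_zero)
            show "\<forall>\<^sub>F \<epsilon> in at_right 0. x' \<epsilon> - vp \<epsilon> (t' \<epsilon>) = 0"
              using eventually_at_right_small[OF eps0']
            proof eventually_elim
              case (elim \<epsilon>)
              have "t' \<epsilon> \<in> T" "x' \<epsilon> \<in> X" "p' \<epsilon> \<in> P" using mem[of \<epsilon>] inc by auto
              then show ?case using v_init[of \<epsilon>] elim by (simp add: vp_def)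
            qed
          qed
          with w_init show "null_net (\<lambda>\<epsilon>. w \<epsilon> (t' \<epsilon>) - vp \<epsilon> (t' \<epsilon>))" by (rule null_net_trans)
        qed (use S in auto)
        then have null: "null_net (\<lambda>\<epsilon>. y' \<epsilon> (z \<epsilon>) - v \<epsilon> (z \<epsilon>))" by (simp add: w_def vp_def z_eq)
        show ?thesis
          unfolding null_bound_def
        proof
          fix m
          show "\<forall>\<^sub>F \<epsilon> in at_right 0. \<forall>z\<in>K. norm (y' \<epsilon> z - v \<epsilon> z) \<le> \<epsilon> ^ m"
            using null_boundD[OF null[unfolded null_net_def], of m] eventually_at_right_small[OF zero_less_one]
          proof eventually_elim
            case (elim \<epsilon>)
            have "norm (y' \<epsilon> (z \<epsilon>) - v \<epsilon> (z \<epsilon>)) \<le> \<epsilon> ^ m" using elim(1) by blast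
            then show ?case using z(2)[of \<epsilon>] elim(2) by (meson greaterThanAtMost_iff order_trans)
          qed
        qed
      qed
    qed
    then have "gf_class Z y' = gf_class Z v" by (rule gf_class_eqI[OF opnZ y'_ev v_ev])
    then show "y = gf_class Z v" using gfuns_cases(2)[OF opnZ y_gf y'(1)] by simp
  qed
  have "\<exists>\<delta>>0. \<forall>\<gamma>\<in>{0<..<\<beta>}. \<beta> - \<gamma> < \<delta> \<longrightarrow>
      (\<exists>!u. u \<in> gfuns_into (T \<times> X \<times> P \<times> J) (ball x0 \<gamma>) \<and>
        (\<forall>t1\<in>gpoints_c T. \<forall>x1\<in>gpoints_c X. \<forall>p\<in>gpoints_c P.
          insert_data J u t1 x1 p \<in> gfuns_into J (ball x0 \<gamma>) \<and>
          ivp_solution I U J (insert_param (I \<times> U) F p)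
            (point_embed J t1) (point_embed U x1) (insert_data J u t1 x1 p)))"
  proof (intro exI[of _ "\<beta> - r"] conjI ballI impI)
    show "0 < \<beta> - r" using r by simp
  qed (rule main; simp)
  then show ?thesis
    using opn(1,2) TJ XU d(1) by (intro exI[of _ T] exI[of _ X] conjI) (auto simp: T_def X_def)
qed

end
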